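(* Let $(\mathcal{H},\Lambda)$ be a Hopf Galois order setting, let $F$ be an $\mathcal{H}$-Galois $\Lambda$-order, and let $\mathfrak{m}$ be a maximal ideal of $\Lambda$. Then: (i) There exists a maximal right ideal $J$ of $F$ containing $\mathfrak{m}$. (ii) There exists a simple left $F^{\mathrm{op}}$-module $M$ with $M^{\mathfrak{m}}\neq 0$. (iii) If $\mathfrak{m}$ has finite codimension in $\Lambda$, then $\mathrm{Irr}(F^{\mathrm{op}},\mathfrak{m})\neq\emptyset$.
   Context: Let $\Bbbk$ be an arbitrary field; all algebras are over $\Bbbk$ and $\otimes=\otimes_{\Bbbk}$. A Hopf Galois order setting (or setting) is a pair $(\mathcal{H},\Lambda)$ where $\mathcal{H}$ is a left coideal subalgebra (a subalgebra with $\Delta(\mathcal{H})\subset\tilde{\mathcal{H}}\otimes\mathcal{H}$) of a Hopf algebra $\tilde{\mathcal{H}}$ (which is part of the data) with comultiplication $\Delta(x)=x_{(1)}\otimes x_{(2)}$, counit $\varepsilon$ and invertible antipode $S$, and $\Lambda$ is a left $\tilde{\mathcal{H}}$-module algebra (action denoted $x\triangleright a$) such that (i) $\Lambda$ is a noetherian (commutative) integral domain; (ii) the action of $\tilde{\mathcal{H}}$ on $\Lambda$ extends to an action on the field of fractions $L=\mathrm{Frac}(\Lambda)$ (also denoted $\triangleright$); (iii) $\Lambda$ is faithful as a left module over the smash product $\Lambda\#\mathcal{H}$. The smash product $A\#\mathcal{H}$ (for $A=\Lambda$ or $L$) is the algebra containing $A$ and $\mathcal{H}$ as subalgebras such that $A\otimes\mathcal{H}\to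 A\#\mathcal{H}$, $a\otimes x\mapsto ax$, is a vector space isomorphism and $xa=(x_{(1)}\triangleright a)x_{(2)}$ for $x\in\mathcal{H}$, $a\in A$. For $X\in L\#\tilde{\mathcal{H}}$, $\hat X$ denotes the corresponding linear endomorphism of $L$, determined by $\hat f(g)=fg$ for $f,g\in L$ and $\hat x(f)=x\triangleright f$ for $x\in\tilde{\mathcal{H}}$. An $\mathcal{H}$-Galois $\Lambda$-order is a subalgebra $F\subset L\#\mathcal{H}$ such that $\Lambda\subset F$, $LF=L\#\mathcal{H}$, and $\hat X(\Lambda)\subset\Lambda$ for all $X\in F$. For an algebra $A\in\{F,F^{\mathrm{op}}\}$ (both containing the commutative algebra $\Lambda$), a left $A$-module $V$ and a maximal ideal $\mathfrak{m}$ of $\Lambda$, put $V^{\mathfrak{m}}=\{v\in V\mid \mathfrak{m}^Nv=0 \text{ for } N\gg 0\}$. $V$ is a Harish-Chandra module (with respect to $\Lambda$) if $V=\bigoplus V^{\mathfrak{m}}$, the sum being over all maximal ideals $\mathfrak{m}$ of $\Lambda$ of finite codimension. $\mathrm{Irr}(A,\mathfrak{m})$ is the set of isomorphism classes of simple Harish-Chandra $A$-modules $V$ with $V^{\mathfrak{m}}\neq 0$. *)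

theory Defs
  imports "HOL-Algebra.Ring_Divisibility" "HOL-Algebra.Ideal_Product" "HOL-Algebra.Subrings"
begin

text \<open>Algebras and vector spaces over a field \<open>K\<close> are records of the library type
  \<open>('k, 'a) module\<close>; a subalgebra \<open>B\<close> of \<open>A\<close>, seen as an algebra, is \<open>A\<lparr>carrier := B\<rparr>\<close>.\<close>

section \<open>Vector spaces and algebras over a field\<close>

text \<open>The library locale \<open>algebra\<close> is restricted to commutative algebras.\<close>

locale k_algebra = K: field K + module K A + A: ring A
  for K :: "'k ring" and A :: "('k, 'a) module" +
  assumes smult_mult_left:
      "\<lbrakk>c \<in> carrier K; x \<in> carrier A; y \<in> carrier A\<rbrakk> \<Longrightarrow>
         (c \<odot>\<^bsub>A\<^esub> x) \<otimes>\<^bsub>A\<^esub> y = c \<odot>\<^bsub>A\<^esub> (x \<otimes>\<^bsub>A\<^esub> y)"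
    and smult_mult_right:
      "\<lbrakk>c \<in> carrier K; x \<in> carrier A; y \<in> carrier A\<rbrakk> \<Longrightarrow>
         x \<otimes>\<^bsub>A\<^esub> (c \<odot>\<^bsub>A\<^esub> y) = c \<odot>\<^bsub>A\<^esub> (x \<otimes>\<^bsub>A\<^esub> y)"

definition k_subalgebra :: "'k ring \<Rightarrow> 'a set \<Rightarrow> ('k, 'a) module \<Rightarrow> bool" where
  "k_subalgebra K B A \<longleftrightarrow> subring B A \<and> submodule B K A"

definition k_linear :: "'k ring \<Rightarrow> ('k, 'v) module \<Rightarrow> ('k, 'w) module \<Rightarrow> ('v \<Rightarrow> 'w) \<Rightarrow> bool" where
  "k_linear K V W f \<longleftrightarrow>
     f \<in> carrier V \<rightarrow> carrier W \<and>
     (\<forall>x\<in>carrier V. \<forall>y\<in>carrier V. f (x \<oplus>\<^bsub>V\<^esub> y) = f x \<oplus>\<^bsub>W\<^esub> f y) \<and>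
     (\<forall>c\<in>carrier K. \<forall>x\<in>carrier V. f (c \<odot>\<^bsub>V\<^esub> x) = c \<odot>\<^bsub>W\<^esub> f x)"

definition k_alg_hom :: "'k ring \<Rightarrow> ('k, 'a) module \<Rightarrow> ('k, 'b) module \<Rightarrow> ('a \<Rightarrow> 'b) \<Rightarrow> bool" where
  "k_alg_hom K A B f \<longleftrightarrow> f \<in> ring_hom A B \<and> k_linear K A B f"

definition k_span :: "'k ring \<Rightarrow> ('k, 'v) module \<Rightarrow> 'v set \<Rightarrow> 'v set" where
  "k_span K V X = \<Inter> {N. submodule N K V \<and> X \<subseteq> N}"

text \<open>\<open>K\<close> as a vector space over itself.\<close>

definition ground :: "'k ring \<Rightarrow> ('k, 'k) module" where
  "ground K = \<lparr>carrier = carrier K, mult = mult K, one = one K, zero = zero K, add = add K,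
               smult = mult K\<rparr>"


section \<open>Tensor products\<close>

text \<open>The tensor product of \<open>V\<close> and \<open>W\<close> is the vector space with basis
  \<open>carrier V \<times> carrier W\<close> modulo the bilinearity relations. The multiplication of
  \<open>free_space\<close> and of \<open>tensor_space\<close> is a dummy required by the record type;
  only \<open>tensor\<close> below carries the multiplication of a tensor product of algebras.\<close>

definition free_space :: "'k ring \<Rightarrow> 'x set \<Rightarrow> ('k, 'x \<Rightarrow> 'k) module" where
  "free_space K X =
     \<lparr>carrier = {f. (\<forall>x. f x \<in> carrier K) \<and> (\<forall>x. x \<notin> X \<longrightarrow> f x = \<zero>\<^bsub>K\<^esub>) \<and>
                    finite {x. f x \<noteq> \<zero>\<^bsub>K\<^esub>}},
      mult = (\<lambda>f g x. \<zero>\<^bsub>K\<^esub>), one = (\<lambda>x. \<zero>\<^bsub>K\<^esub>),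
      zero = (\<lambda>x. \<zero>\<^bsub>K\<^esub>), add = (\<lambda>f g x. f x \<oplus>\<^bsub>K\<^esub> g x),
      smult = (\<lambda>c f x. c \<otimes>\<^bsub>K\<^esub> f x)\<rparr>"

definition basis_vec :: "'k ring \<Rightarrow> 'x \<Rightarrow> 'x \<Rightarrow> 'k" where
  "basis_vec K x = (\<lambda>y. if y = x then \<one>\<^bsub>K\<^esub> else \<zero>\<^bsub>K\<^esub>)"

definition bilin_rels ::
  "'k ring \<Rightarrow> ('k, 'v) module \<Rightarrow> ('k, 'w) module \<Rightarrow> ('v \<times> 'w \<Rightarrow> 'k) set" where
  "bilin_rels K V W =
     (let E = free_space K (carrier V \<times> carrier W); e = basis_vec K in
       {e (v \<oplus>\<^bsub>V\<^esub> v', w) \<ominus>\<^bsub>E\<^esub> (e (v, w) \<oplus>\<^bsub>E\<^esub> e (v', w)) | v v' w.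
          v \<in> carrier V \<and> v' \<in> carrier V \<and> w \<in> carrier W} \<union>
       {e (v, w \<oplus>\<^bsub>W\<^esub> w') \<ominus>\<^bsub>E\<^esub> (e (v, w) \<oplus>\<^bsub>E\<^esub> e (v, w')) | v w w'.
          v \<in> carrier V \<and> w \<in> carrier W \<and> w' \<in> carrier W} \<union>
       {e (c \<odot>\<^bsub>V\<^esub> v, w) \<ominus>\<^bsub>E\<^esub> c \<odot>\<^bsub>E\<^esub> e (v, w) | c v w.
          c \<in> carrier K \<and> v \<in> carrier V \<and> w \<in> carrier W} \<union>
       {e (v, c \<odot>\<^bsub>W\<^esub> w) \<ominus>\<^bsub>E\<^esub> c \<odot>\<^bsub>E\<^esub> e (v, w) | c v w.
          c \<in> carrier K \<and> v \<in> carrier V \<and> w \<in> carrier W})"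

definition tensor_null ::
  "'k ring \<Rightarrow> ('k, 'v) module \<Rightarrow> ('k, 'w) module \<Rightarrow> ('v \<times> 'w \<Rightarrow> 'k) set" where
  "tensor_null K V W = k_span K (free_space K (carrier V \<times> carrier W)) (bilin_rels K V W)"

definition quotient_space :: "('k, 'v) module \<Rightarrow> 'v set \<Rightarrow> ('k, 'v set) module" where
  "quotient_space V N =
     \<lparr>carrier = a_rcosets\<^bsub>V\<^esub> N, mult = (\<lambda>C D. N), one = N, zero = N, add = set_add V,
      smult = (\<lambda>c C. \<Union>x\<in>C. N +>\<^bsub>V\<^esub> (c \<odot>\<^bsub>V\<^esub> x))\<rparr>"

definition tensor_space ::
  "'k ring \<Rightarrow> ('k, 'v) module \<Rightarrow> ('k, 'w) module \<Rightarrow> ('k, ('v \<times> 'w \<Rightarrow> 'k) set) module" where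
  "tensor_space K V W =
     quotient_space (free_space K (carrier V \<times> carrier W)) (tensor_null K V W)"

definition pure_tensor ::
  "'k ring \<Rightarrow> ('k, 'v) module \<Rightarrow> ('k, 'w) module \<Rightarrow> 'v \<Rightarrow> 'w \<Rightarrow> ('v \<times> 'w \<Rightarrow> 'k) set" where
  "pure_tensor K V W v w =
     tensor_null K V W +>\<^bsub>free_space K (carrier V \<times> carrier W)\<^esub> basis_vec K (v, w)"

text \<open>\<open>tensor_lift K P \<beta>\<close> is the linear map out of the tensor product induced by a bilinear map
  \<open>\<beta>\<close> into \<open>P\<close>: it sends \<open>\<Sum> c\<^sub>i (v\<^sub>i \<otimes> w\<^sub>i)\<close> to \<open>\<Sum> c\<^sub>i \<beta> v\<^sub>i w\<^sub>i\<close>. It is only used for bilinear \<open>\<beta>\<close>,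
  where the choice of the representative does not matter (\<open>tensor_lift_bilinear\<close> below).
  In particular the Sweedler expression \<open>\<Sum> \<beta> x\<^sub>(\<^sub>1\<^sub>) x\<^sub>(\<^sub>2\<^sub>)\<close> is \<open>tensor_lift K P \<beta> (\<Delta> x)\<close>.\<close>

definition bilin_eval ::
  "'k ring \<Rightarrow> ('k, 'p) module \<Rightarrow> ('v \<Rightarrow> 'w \<Rightarrow> 'p) \<Rightarrow> ('v \<times> 'w \<Rightarrow> 'k) \<Rightarrow> 'p" where
  "bilin_eval K P \<beta> f = (\<Oplus>\<^bsub>P\<^esub>p\<in>{p. f p \<noteq> \<zero>\<^bsub>K\<^esub>}. f p \<odot>\<^bsub>P\<^esub> \<beta> (fst p) (snd p))"

definition tensor_lift ::
  "'k ring \<Rightarrow> ('k, 'p) module \<Rightarrow> ('v \<Rightarrow> 'w \<Rightarrow> 'p) \<Rightarrow> ('v \<times> 'w \<Rightarrow> 'k) set \<Rightarrow> 'p" where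
  "tensor_lift K P \<beta> t = bilin_eval K P \<beta> (SOME f. f \<in> t)"

definition tensor ::
  "'k ring \<Rightarrow> ('k, 'a) module \<Rightarrow> ('k, 'b) module \<Rightarrow> ('k, ('a \<times> 'b \<Rightarrow> 'k) set) module" where
  "tensor K A B =
     (let T = tensor_space K A B in
      T\<lparr>mult := (\<lambda>s t. tensor_lift K T (\<lambda>a b. tensor_lift K T
                   (\<lambda>a' b'. pure_tensor K A B (a \<otimes>\<^bsub>A\<^esub> a') (b \<otimes>\<^bsub>B\<^esub> b')) t) s),
        one := pure_tensor K A B \<one>\<^bsub>A\<^esub> \<one>\<^bsub>B\<^esub>\<rparr>)"


text \<open>The definitions above do give a vector space with the universal property of the tensor product.\<close>

lemma free_space_simps:
  "carrier (free_space K X) = {f. (\<forall>x. f x \<in> carrier K) \<and> (\<forall>x. x \<notin> X \<longrightarrow> f x = \<zero>\<^bsub>K\<^esub>) \<and> finite {x. f x \<noteq> \<zero>\<^bsub>K\<^esub>}}"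
  "\<zero>\<^bsub>free_space K X\<^esub> = (\<lambda>x. \<zero>\<^bsub>K\<^esub>)"
  "f \<oplus>\<^bsub>free_space K X\<^esub> g = (\<lambda>x. f x \<oplus>\<^bsub>K\<^esub> g x)"
  "c \<odot>\<^bsub>free_space K X\<^esub> f = (\<lambda>x. c \<otimes>\<^bsub>K\<^esub> f x)"
  by (simp_all add: free_space_def)

lemma free_space_module:
  fixes K :: "'k ring" and X :: "'x set"
  assumes "field K" shows "module K (free_space K X)"
proof -
  interpret K: field K by fact
  have fa: "finite {x. f x \<oplus>\<^bsub>K\<^esub> g x \<noteq> \<zero>\<^bsub>K\<^esub>}" if "finite {x. f x \<noteq> \<zero>\<^bsub>K\<^esub>}" "finite {x. g x \<noteq> \<zero>\<^bsub>K\<^esub>}" for f g :: "'x \<Rightarrow> 'k"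
    by (rule finite_subset[OF _ finite_UnI[OF that(1,2)]]) auto
  have fm: "finite {x. c \<otimes>\<^bsub>K\<^esub> f x \<noteq> \<zero>\<^bsub>K\<^esub>}" if "finite {x. f x \<noteq> \<zero>\<^bsub>K\<^esub>}" "c \<in> carrier K" for f :: "'x \<Rightarrow> 'k" and c
    by (rule finite_subset[OF _ that(1)]) (use that in auto)
  show ?thesis
  proof (rule moduleI)
    show "cring K" by (rule K.is_cring)
    show "abelian_group (free_space K X)"
    proof (rule abelian_groupI)
      fix f assume f: "f \<in> carrier (free_space K X)"
      have "(\<lambda>x. \<ominus>\<^bsub>K\<^esub> f x) \<in> carrier (free_space K X)"
        using f by (auto simp: free_space_simps elim: finite_subset[rotated])
      moreover have "(\<lambda>x. \<ominus>\<^bsub>K\<^esub> f x) \<oplus>\<^bsub>free_space K X\<^esub> f = \<zero>\<^bsub>free_space K X\<^esub>"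
        using f by (auto simp: free_space_simps K.l_neg)
      ultimately show "\<exists>y\<in>carrier (free_space K X). y \<oplus>\<^bsub>free_space K X\<^esub> f = \<zero>\<^bsub>free_space K X\<^esub>" by blast
    qed (use fa in \<open>auto simp: free_space_simps K.a_ac\<close>)
  qed (auto simp: free_space_simps fm K.l_distr K.r_distr K.m_assoc)
qed

lemma k_span_submodule:
  assumes "module K V" "X \<subseteq> carrier V" shows "submodule (k_span K V X) K V"
proof -
  interpret module K V by fact
  have c: "submodule (carrier V) K V" by (rule carrier_is_submodule)
  show ?thesis
    apply (rule submoduleI)
    using c assms(2) unfolding k_span_def
        apply blast
       apply (auto intro: submoduleE(4,5) simp: submoduleE(3) submodule.smult_closed)
    using submodule.axioms(1) subgroup.one_closed apply fastforce
    done
qed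

lemma quotient_space_module:
  assumes "module K V" "submodule N K V" shows "module K (quotient_space V N)"
    and "\<And>x. x \<in> carrier V \<Longrightarrow> N +>\<^bsub>V\<^esub> x \<in> carrier (quotient_space V N)"
    and "\<And>x y. x \<in> carrier V \<Longrightarrow> y \<in> carrier V \<Longrightarrow>
       (N +>\<^bsub>V\<^esub> x) \<oplus>\<^bsub>quotient_space V N\<^esub> (N +>\<^bsub>V\<^esub> y) = N +>\<^bsub>V\<^esub> (x \<oplus>\<^bsub>V\<^esub> y)"
    and "\<And>c x. c \<in> carrier K \<Longrightarrow> x \<in> carrier V \<Longrightarrow>
       c \<odot>\<^bsub>quotient_space V N\<^esub> (N +>\<^bsub>V\<^esub> x) = N +>\<^bsub>V\<^esub> (c \<odot>\<^bsub>V\<^esub> x)"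
proof -
  interpret module K V by fact
  interpret N: submodule N K V by fact
  interpret ab: abelian_subgroup N V
    by (rule abelian_subgroupI3) (auto simp: additive_subgroup_def N.subgroup_axioms abelian_group_axioms)
  show closed: "N +>\<^bsub>V\<^esub> x \<in> carrier (quotient_space V N)" if "x \<in> carrier V" for x
    using that using ab.a_subset by (auto simp: quotient_space_def A_RCOSETS_def')
  show add: "(N +>\<^bsub>V\<^esub> x) \<oplus>\<^bsub>quotient_space V N\<^esub> (N +>\<^bsub>V\<^esub> y) = N +>\<^bsub>V\<^esub> (x \<oplus>\<^bsub>V\<^esub> y)"
    if "x \<in> carrier V" "y \<in> carrier V" for x y
    using that by (simp add: quotient_space_def ab.a_rcos_sum)
  show sm: "c \<odot>\<^bsub>quotient_space V N\<^esub> (N +>\<^bsub>V\<^esub> x) = N +>\<^bsub>V\<^esub> (c \<odot>\<^bsub>V\<^esub> x)"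
    if "c \<in> carrier K" "x \<in> carrier V" for c x
  proof -
    have "N +>\<^bsub>V\<^esub> (c \<odot>\<^bsub>V\<^esub> y) = N +>\<^bsub>V\<^esub> (c \<odot>\<^bsub>V\<^esub> x)" if y: "y \<in> N +>\<^bsub>V\<^esub> x" for y
    proof -
      from y obtain n where n: "n \<in> N" "y = n \<oplus>\<^bsub>V\<^esub> x" by (auto simp: a_r_coset_def')
      have nV: "n \<in> carrier V" using n ab.a_subset by auto
      have "c \<odot>\<^bsub>V\<^esub> y = c \<odot>\<^bsub>V\<^esub> n \<oplus>\<^bsub>V\<^esub> c \<odot>\<^bsub>V\<^esub> x" using n nV that \<open>c \<in> carrier K\<close> \<open>x \<in> carrier V\<close> by (simp add: smult_r_distr)
      hence "c \<odot>\<^bsub>V\<^esub> y \<in> N +>\<^bsub>V\<^esub> (c \<odot>\<^bsub>V\<^esub> x)"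
        using N.smult_closed[OF \<open>c \<in> carrier K\<close> n(1)] by (auto simp: a_r_coset_def')
      thus ?thesis using a_repr_independence[of "c \<odot>\<^bsub>V\<^esub> y" N "c \<odot>\<^bsub>V\<^esub> x"] ab.a_subgroup \<open>c \<in> carrier K\<close> \<open>x \<in> carrier V\<close>
        by (metis ab.a_repr_independence' smult_closed)
    qed
    moreover have "x \<in> N +>\<^bsub>V\<^esub> x" using that ab.a_rcos_self by auto
    ultimately have "(\<Union>y\<in>N +>\<^bsub>V\<^esub> x. N +>\<^bsub>V\<^esub> (c \<odot>\<^bsub>V\<^esub> y)) = N +>\<^bsub>V\<^esub> (c \<odot>\<^bsub>V\<^esub> x)" by blast
    thus ?thesis unfolding quotient_space_def by simp
  qed
  have ex: "\<exists>x\<in>carrier V. C = N +>\<^bsub>V\<^esub> x" if "C \<in> carrier (quotient_space V N)" for C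
    using that by (auto simp: quotient_space_def A_RCOSETS_def')
  have z: "\<zero>\<^bsub>quotient_space V N\<^esub> = N +>\<^bsub>V\<^esub> \<zero>\<^bsub>V\<^esub>"
    using ab.a_subset by (simp add: quotient_space_def)
  show "module K (quotient_space V N)"
  proof (rule moduleI)
    show "abelian_group (quotient_space V N)"
    proof (rule abelian_groupI)
      fix C assume "C \<in> carrier (quotient_space V N)"
      then obtain x where x: "x \<in> carrier V" "C = N +>\<^bsub>V\<^esub> x" using ex by blast
      hence "(N +>\<^bsub>V\<^esub> (\<ominus>\<^bsub>V\<^esub> x)) \<oplus>\<^bsub>quotient_space V N\<^esub> C = \<zero>\<^bsub>quotient_space V N\<^esub>"
        by (simp add: add z M.l_neg)
      thus "\<exists>y\<in>carrier (quotient_space V N). y \<oplus>\<^bsub>quotient_space V N\<^esub> C = \<zero>\<^bsub>quotient_space V N\<^esub>"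
        using closed x by blast
    qed (auto dest!: ex simp: add z closed M.a_ac)
  qed (auto dest!: ex simp: add z closed sm smult_l_distr smult_r_distr smult_assoc1 R.is_cring)
qed

lemma tensor_lift_bilinear:
  assumes "field K" "module K V" "module K W" "module K P"
   and b: "\<And>v w. v \<in> carrier V \<Longrightarrow> w \<in> carrier W \<Longrightarrow> \<beta> v w \<in> carrier P"
   and b1: "\<And>v v' w. v \<in> carrier V \<Longrightarrow> v' \<in> carrier V \<Longrightarrow> w \<in> carrier W \<Longrightarrow> \<beta> (v \<oplus>\<^bsub>V\<^esub> v') w = \<beta> v w \<oplus>\<^bsub>P\<^esub> \<beta> v' w"
   and b2: "\<And>v w w'. v \<in> carrier V \<Longrightarrow> w' \<in> carrier W \<Longrightarrow> w \<in> carrier W \<Longrightarrow> \<beta> v (w \<oplus>\<^bsub>W\<^esub> w') = \<beta> v w \<oplus>\<^bsub>P\<^esub> \<beta> v w'"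
   and b3: "\<And>c v w. c \<in> carrier K \<Longrightarrow> v \<in> carrier V \<Longrightarrow> w \<in> carrier W \<Longrightarrow> \<beta> (c \<odot>\<^bsub>V\<^esub> v) w = c \<odot>\<^bsub>P\<^esub> \<beta> v w"
   and b4: "\<And>c v w. c \<in> carrier K \<Longrightarrow> v \<in> carrier V \<Longrightarrow> w \<in> carrier W \<Longrightarrow> \<beta> v (c \<odot>\<^bsub>W\<^esub> w) = c \<odot>\<^bsub>P\<^esub> \<beta> v w"
 shows "v \<in> carrier V \<Longrightarrow> w \<in> carrier W \<Longrightarrow> tensor_lift K P \<beta> (pure_tensor K V W v w) = \<beta> v w"
   and "s \<in> carrier (tensor_space K V W) \<Longrightarrow> t \<in> carrier (tensor_space K V W) \<Longrightarrow>
     tensor_lift K P \<beta> (s \<oplus>\<^bsub>tensor_space K V W\<^esub> t) = tensor_lift K P \<beta> s \<oplus>\<^bsub>P\<^esub> tensor_lift K P \<beta> t"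
   and "s \<in> carrier (tensor_space K V W) \<Longrightarrow> c \<in> carrier K \<Longrightarrow>
     tensor_lift K P \<beta> (c \<odot>\<^bsub>tensor_space K V W\<^esub> s) = c \<odot>\<^bsub>P\<^esub> tensor_lift K P \<beta> s"
   and "module K (tensor_space K V W)"
   and "v \<in> carrier V \<Longrightarrow> w \<in> carrier W \<Longrightarrow> pure_tensor K V W v w \<in> carrier (tensor_space K V W)"
proof -
  interpret K: field K by fact
  interpret P: module K P by fact
  interpret V: module K V by fact
  interpret W: module K W by fact
  let ?X = "carrier V \<times> carrier W"
  let ?E = "free_space K ?X"
  let ?N = "tensor_null K V W"
  let ?psi = "bilin_eval K P \<beta>"
  interpret E: module K ?E by (rule free_space_module) fact
  have bp: "\<beta> (fst p) (snd p) \<in> carrier P" if "p \<in> ?X" for p using that b by auto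
  have supp: "p \<in> ?X" if "f \<in> carrier ?E" "f p \<noteq> \<zero>\<^bsub>K\<^esub>" for f p
    using that unfolding free_space_simps by blast
  have cK: "f p \<in> carrier K" if "f \<in> carrier ?E" for f p using that unfolding free_space_simps by blast
  have psi_ext: "?psi f = (\<Oplus>\<^bsub>P\<^esub>p\<in>B. f p \<odot>\<^bsub>P\<^esub> \<beta> (fst p) (snd p))"
    if f: "f \<in> carrier ?E" and B: "finite B" "B \<subseteq> ?X" "{p. f p \<noteq> \<zero>\<^bsub>K\<^esub>} \<subseteq> B" for f B
    unfolding bilin_eval_def
    apply (rule P.add.finprod_mono_neutral_cong_left[simplified])
    using B bp cK[OF f] by auto
  have fin: "finite {p. f p \<noteq> \<zero>\<^bsub>K\<^esub>}" if "f \<in> carrier ?E" for f using that unfolding free_space_simps by blast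
  have psi_c: "?psi f \<in> carrier P" if "f \<in> carrier ?E" for f
    unfolding bilin_eval_def by (rule P.finsum_closed) (use that supp bp cK in auto)
  have psi_add: "?psi (f \<oplus>\<^bsub>?E\<^esub> g) = ?psi f \<oplus>\<^bsub>P\<^esub> ?psi g" if f: "f \<in> carrier ?E" and g: "g \<in> carrier ?E" for f g
  proof -
    let ?B = "{p. f p \<noteq> \<zero>\<^bsub>K\<^esub>} \<union> {p. g p \<noteq> \<zero>\<^bsub>K\<^esub>}"
    have B: "finite ?B" "?B \<subseteq> ?X" using fin f g supp by blast+
    have fg: "f \<oplus>\<^bsub>?E\<^esub> g \<in> carrier ?E" using f g by simp
    have "?psi (f \<oplus>\<^bsub>?E\<^esub> g) = (\<Oplus>\<^bsub>P\<^esub>p\<in>?B. (f \<oplus>\<^bsub>?E\<^esub> g) p \<odot>\<^bsub>P\<^esub> \<beta> (fst p) (snd p))"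
      by (rule psi_ext[OF fg B]) (auto simp: free_space_simps)
    also have "\<dots> = (\<Oplus>\<^bsub>P\<^esub>p\<in>?B. f p \<odot>\<^bsub>P\<^esub> \<beta> (fst p) (snd p) \<oplus>\<^bsub>P\<^esub> g p \<odot>\<^bsub>P\<^esub> \<beta> (fst p) (snd p))"
      apply (rule P.add.finprod_cong')
      subgoal by simp
      subgoal by (intro Pi_I P.M.a_closed P.smult_closed cK f g bp subsetD[OF B(2)])
      subgoal for p unfolding free_space_simps(3) by (intro P.smult_l_distr cK f g bp subsetD[OF B(2)])
      done
    also have "\<dots> = ?psi f \<oplus>\<^bsub>P\<^esub> ?psi g"
      apply (subst P.finsum_addf)
      subgoal by (intro Pi_I P.smult_closed cK f g bp subsetD[OF B(2)])
      subgoal by (intro Pi_I P.smult_closed cK f g bp subsetD[OF B(2)])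
      using psi_ext[OF f B] psi_ext[OF g B] by auto
    finally show ?thesis .
  qed
  have psi_sm: "?psi (c \<odot>\<^bsub>?E\<^esub> f) = c \<odot>\<^bsub>P\<^esub> ?psi f" if f: "f \<in> carrier ?E" and c: "c \<in> carrier K" for f c
  proof -
    let ?B = "{p. f p \<noteq> \<zero>\<^bsub>K\<^esub>}"
    have B: "finite ?B" "?B \<subseteq> ?X" using fin f supp by blast+
    have fg: "c \<odot>\<^bsub>?E\<^esub> f \<in> carrier ?E" using f c by simp
    have "?psi (c \<odot>\<^bsub>?E\<^esub> f) = (\<Oplus>\<^bsub>P\<^esub>p\<in>?B. (c \<odot>\<^bsub>?E\<^esub> f) p \<odot>\<^bsub>P\<^esub> \<beta> (fst p) (snd p))"
      by (rule psi_ext[OF fg B]) (use c in \<open>auto simp: free_space_simps\<close>)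
    also have "\<dots> = (\<Oplus>\<^bsub>P\<^esub>p\<in>?B. c \<odot>\<^bsub>P\<^esub> (f p \<odot>\<^bsub>P\<^esub> \<beta> (fst p) (snd p)))"
      apply (rule P.add.finprod_cong')
      subgoal by simp
      subgoal by (intro Pi_I P.smult_closed c cK f bp subsetD[OF B(2)])
      subgoal for p unfolding free_space_simps(4) by (intro P.smult_assoc1 c cK f bp subsetD[OF B(2)])
      done
    also have "\<dots> = c \<odot>\<^bsub>P\<^esub> ?psi f"
      unfolding bilin_eval_def
      apply (rule P.finsum_smult_ldistr[symmetric])
      using B c by (auto intro!: P.smult_closed cK f bp subsetD[OF B(2)])
    finally show ?thesis .
  qed
  have psi_minus: "?psi (f \<ominus>\<^bsub>?E\<^esub> g) = ?psi f \<ominus>\<^bsub>P\<^esub> ?psi g" if f: "f \<in> carrier ?E" and g: "g \<in> carrier ?E" for f g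
  proof -
    have "?psi (f \<ominus>\<^bsub>?E\<^esub> g) \<oplus>\<^bsub>P\<^esub> ?psi g = ?psi f"
      using f g psi_add[of "f \<ominus>\<^bsub>?E\<^esub> g" g] by (simp add: E.M.minus_eq E.M.a_assoc E.M.l_neg)
    thus ?thesis using f g psi_c by (metis E.M.minus_closed P.M.add.inv_solve_right P.M.minus_eq)
  qed
  have eE: "basis_vec K (v,w) \<in> carrier ?E" if "v \<in> carrier V" "w \<in> carrier W" for v w
    using that by (auto simp: free_space_simps basis_vec_def)
  have psi_e: "?psi (basis_vec K (v,w)) = \<beta> v w" if "v \<in> carrier V" "w \<in> carrier W" for v w
  proof -
    have "{p. basis_vec K (v,w) p \<noteq> \<zero>\<^bsub>K\<^esub>} = {(v,w)}" by (auto simp: basis_vec_def)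
    thus ?thesis using that b unfolding bilin_eval_def by (simp add: basis_vec_def)
  qed
  have rels: "bilin_rels K V W \<subseteq> carrier ?E \<inter> {f. ?psi f = \<zero>\<^bsub>P\<^esub>}"
    unfolding bilin_rels_def Let_def
    by (auto simp: eE psi_e psi_minus psi_add psi_sm b b1 b2 b3 b4 P.M.minus_eq P.M.r_neg)
  have ker: "submodule {f\<in>carrier ?E. ?psi f = \<zero>\<^bsub>P\<^esub>} K ?E"
  proof (rule E.submoduleI)
    show "\<zero>\<^bsub>?E\<^esub> \<in> {f\<in>carrier ?E. ?psi f = \<zero>\<^bsub>P\<^esub>}"
      using psi_sm[of "\<zero>\<^bsub>?E\<^esub>" "\<zero>\<^bsub>K\<^esub>"] psi_c by auto
    then show "\<ominus>\<^bsub>?E\<^esub> a \<in> {f\<in>carrier ?E. ?psi f = \<zero>\<^bsub>P\<^esub>}" if "a \<in> {f\<in>carrier ?E. ?psi f = \<zero>\<^bsub>P\<^esub>}" for a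
      using psi_minus[of "\<zero>\<^bsub>?E\<^esub>" a] that by (auto simp: E.M.minus_eq P.M.minus_eq)
  qed (auto simp: psi_add psi_sm)
  have N: "submodule ?N K ?E" unfolding tensor_null_def
    by (rule k_span_submodule[OF E.module_axioms]) (use rels in auto)
  have Nker: "?psi n = \<zero>\<^bsub>P\<^esub> \<and> n \<in> carrier ?E" if "n \<in> ?N" for n
    using that ker rels unfolding tensor_null_def k_span_def by blast
  note Q = quotient_space_module[OF E.module_axioms N, folded tensor_space_def]
  have lift: "tensor_lift K P \<beta> (?N +>\<^bsub>?E\<^esub> f) = ?psi f" if f: "f \<in> carrier ?E" for f
  proof -
    have z: "\<zero>\<^bsub>?E\<^esub> \<in> ?N" using submodule.axioms(1)[OF N] subgroup.one_closed by fastforce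
    hence "f \<in> ?N +>\<^bsub>?E\<^esub> f" using f unfolding a_r_coset_def' by (metis (no_types, lifting) E.M.l_zero UN_iff insertI1)
    hence "(SOME g. g \<in> ?N +>\<^bsub>?E\<^esub> f) \<in> ?N +>\<^bsub>?E\<^esub> f" by (rule someI[of "\<lambda>g. g \<in> ?N +>\<^bsub>?E\<^esub> f" f])
    then obtain n where n: "n \<in> ?N" "(SOME g. g \<in> ?N +>\<^bsub>?E\<^esub> f) = n \<oplus>\<^bsub>?E\<^esub> f" unfolding a_r_coset_def' by blast
    have "tensor_lift K P \<beta> (?N +>\<^bsub>?E\<^esub> f) = ?psi (n \<oplus>\<^bsub>?E\<^esub> f)" unfolding tensor_lift_def bilin_eval_def n(2) Let_def ..
    thus ?thesis using Nker[OF n(1)] f psi_add psi_c by simp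
  qed
  have ex: "\<exists>x\<in>carrier ?E. C = ?N +>\<^bsub>?E\<^esub> x" if "C \<in> carrier (tensor_space K V W)" for C
    using that by (auto simp: tensor_space_def quotient_space_def A_RCOSETS_def')
  show "v \<in> carrier V \<Longrightarrow> w \<in> carrier W \<Longrightarrow> tensor_lift K P \<beta> (pure_tensor K V W v w) = \<beta> v w"
    unfolding pure_tensor_def by (simp add: lift eE psi_e)
  show "s \<in> carrier (tensor_space K V W) \<Longrightarrow> t \<in> carrier (tensor_space K V W) \<Longrightarrow>
     tensor_lift K P \<beta> (s \<oplus>\<^bsub>tensor_space K V W\<^esub> t) = tensor_lift K P \<beta> s \<oplus>\<^bsub>P\<^esub> tensor_lift K P \<beta> t"
    by (auto dest!: ex simp: Q lift psi_add)
  show "s \<in> carrier (tensor_space K V W) \<Longrightarrow> c \<in> carrier K \<Longrightarrow>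
     tensor_lift K P \<beta> (c \<odot>\<^bsub>tensor_space K V W\<^esub> s) = c \<odot>\<^bsub>P\<^esub> tensor_lift K P \<beta> s"
    by (auto dest!: ex simp: Q lift psi_sm)
  show "module K (tensor_space K V W)" by (rule Q)
  show "v \<in> carrier V \<Longrightarrow> w \<in> carrier W \<Longrightarrow> pure_tensor K V W v w \<in> carrier (tensor_space K V W)"
    unfolding pure_tensor_def by (rule Q) (rule eE)
qed


section \<open>Hopf algebras, coideal subalgebras and module algebras\<close>

locale hopf_algebra = k_algebra K Ht
  for K :: "'k ring" and Ht :: "('k, 'h) module" +
  fixes \<Delta> :: "'h \<Rightarrow> ('h \<times> 'h \<Rightarrow> 'k) set" and \<epsilon> :: "'h \<Rightarrow> 'k" and antipode :: "'h \<Rightarrow> 'h"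
  assumes comult_hom: "k_alg_hom K Ht (tensor K Ht Ht) \<Delta>"
    and counit_hom: "k_alg_hom K Ht (ground K) \<epsilon>"
    and coassoc: "x \<in> carrier Ht \<Longrightarrow>
      tensor_lift K (tensor K Ht (tensor K Ht Ht))
        (\<lambda>u v. tensor_lift K (tensor K Ht (tensor K Ht Ht))
           (\<lambda>p q. pure_tensor K Ht (tensor K Ht Ht) p (pure_tensor K Ht Ht q v)) (\<Delta> u)) (\<Delta> x)
      = tensor_lift K (tensor K Ht (tensor K Ht Ht))
          (\<lambda>u v. pure_tensor K Ht (tensor K Ht Ht) u (\<Delta> v)) (\<Delta> x)"
    and counit_left: "x \<in> carrier Ht \<Longrightarrow> tensor_lift K Ht (\<lambda>u v. \<epsilon> u \<odot>\<^bsub>Ht\<^esub> v) (\<Delta> x) = x"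
    and counit_right: "x \<in> carrier Ht \<Longrightarrow> tensor_lift K Ht (\<lambda>u v. \<epsilon> v \<odot>\<^bsub>Ht\<^esub> u) (\<Delta> x) = x"
    and antipode_linear: "k_linear K Ht Ht antipode"
    and antipode_left: "x \<in> carrier Ht \<Longrightarrow>
      tensor_lift K Ht (\<lambda>u v. antipode u \<otimes>\<^bsub>Ht\<^esub> v) (\<Delta> x) = \<epsilon> x \<odot>\<^bsub>Ht\<^esub> \<one>\<^bsub>Ht\<^esub>"
    and antipode_right: "x \<in> carrier Ht \<Longrightarrow>
      tensor_lift K Ht (\<lambda>u v. u \<otimes>\<^bsub>Ht\<^esub> antipode v) (\<Delta> x) = \<epsilon> x \<odot>\<^bsub>Ht\<^esub> \<one>\<^bsub>Ht\<^esub>"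

text \<open>The condition \<open>\<Delta>(H) \<subseteq> Ht \<otimes> H\<close>, with \<open>Ht \<otimes> H\<close> regarded as a subspace of \<open>Ht \<otimes> Ht\<close>.\<close>

definition left_coideal_subalgebra ::
  "'k ring \<Rightarrow> ('k, 'h) module \<Rightarrow> ('h \<Rightarrow> ('h \<times> 'h \<Rightarrow> 'k) set) \<Rightarrow> 'h set \<Rightarrow> bool" where
  "left_coideal_subalgebra K Ht \<Delta> H \<longleftrightarrow>
     k_subalgebra K H Ht \<and>
     \<Delta> ` H \<subseteq> k_span K (tensor K Ht Ht) {pure_tensor K Ht Ht u v | u v. u \<in> carrier Ht \<and> v \<in> H}"

locale module_algebra = k_algebra K A
  for K :: "'k ring" and A :: "('k, 'a) module" +
  fixes Ht :: "('k, 'h) module" and \<Delta> :: "'h \<Rightarrow> ('h \<times> 'h \<Rightarrow> 'k) set" and \<epsilon> :: "'h \<Rightarrow> 'k"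
    and act :: "'h \<Rightarrow> 'a \<Rightarrow> 'a"
  assumes act_linear: "x \<in> carrier Ht \<Longrightarrow> k_linear K A A (act x)"
    and act_linear_left: "a \<in> carrier A \<Longrightarrow> k_linear K Ht A (\<lambda>x. act x a)"
    and act_one: "a \<in> carrier A \<Longrightarrow> act \<one>\<^bsub>Ht\<^esub> a = a"
    and act_mult: "\<lbrakk>x \<in> carrier Ht; y \<in> carrier Ht; a \<in> carrier A\<rbrakk> \<Longrightarrow>
      act (x \<otimes>\<^bsub>Ht\<^esub> y) a = act x (act y a)"
    and act_on_mult: "\<lbrakk>x \<in> carrier Ht; a \<in> carrier A; b \<in> carrier A\<rbrakk> \<Longrightarrow>
      act x (a \<otimes>\<^bsub>A\<^esub> b) = tensor_lift K A (\<lambda>u v. act u a \<otimes>\<^bsub>A\<^esub> act v b) (\<Delta> x)"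
    and act_on_one: "x \<in> carrier Ht \<Longrightarrow> act x \<one>\<^bsub>A\<^esub> = \<epsilon> x \<odot>\<^bsub>A\<^esub> \<one>\<^bsub>A\<^esub>"

text \<open>The endomorphism of \<open>A\<close> given by an element of \<open>A # Ht\<close>, the latter identified as a vector
  space with \<open>A \<otimes> Ht\<close>: the element \<open>a \<otimes> x\<close> acts by \<open>g \<mapsto> a (x \<triangleright> g)\<close>.\<close>

definition tensor_act ::
  "'k ring \<Rightarrow> ('k, 'a) module \<Rightarrow> ('h \<Rightarrow> 'a \<Rightarrow> 'a) \<Rightarrow> ('a \<times> 'h \<Rightarrow> 'k) set \<Rightarrow> 'a \<Rightarrow> 'a" where
  "tensor_act K A act t g = tensor_lift K A (\<lambda>a x. a \<otimes>\<^bsub>A\<^esub> act x g) t"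


section \<open>Hopf Galois order settings and Galois orders\<close>

definition is_fraction_field :: "('l, 'n) ring_scheme \<Rightarrow> 'l set \<Rightarrow> bool" where
  "is_fraction_field L D \<longleftrightarrow>
     field L \<and> subdomain D L \<and>
     (\<forall>f\<in>carrier L. \<exists>a\<in>D. \<exists>b\<in>D - {\<zero>\<^bsub>L\<^esub>}. f = a \<otimes>\<^bsub>L\<^esub> inv\<^bsub>L\<^esub> b)"

text \<open>\<open>Lam\<close> is a subring of its field of fractions \<open>L\<close>. The action of \<open>Ht\<close> on \<open>Lam\<close> and its
  extension to \<open>L\<close> are the single map \<open>act\<close>, so \<open>lam_module_algebra\<close> contains the closure of
  \<open>Lam\<close> under \<open>act\<close>. Faithfulness is stated on \<open>Lam \<otimes> H\<close>, the vector space underlying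
  \<open>Lam # H\<close>.\<close>

locale hopf_galois_order_setting = hopf_algebra K Ht \<Delta> \<epsilon> antipode
  for K :: "'k ring" and Ht :: "('k, 'h) module" and \<Delta> :: "'h \<Rightarrow> ('h \<times> 'h \<Rightarrow> 'k) set"
    and \<epsilon> :: "'h \<Rightarrow> 'k" and antipode :: "'h \<Rightarrow> 'h" +
  fixes H :: "'h set" and L :: "('k, 'l) module" and Lam :: "'l set"
    and act :: "'h \<Rightarrow> 'l \<Rightarrow> 'l"
  assumes antipode_invertible: "bij_betw antipode (carrier Ht) (carrier Ht)"
    and coideal: "left_coideal_subalgebra K Ht \<Delta> H"
    and lam_subalgebra: "k_subalgebra K Lam L"
    and lam_noetherian: "noetherian_domain (L\<lparr>carrier := Lam\<rparr>)"
    and lam_fractions: "is_fraction_field L Lam"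
    and lam_module_algebra: "module_algebra K (L\<lparr>carrier := Lam\<rparr>) Ht \<Delta> \<epsilon> act"
    and act_extends: "module_algebra K L Ht \<Delta> \<epsilon> act"
    and faithful: "\<lbrakk>t \<in> carrier (tensor K (L\<lparr>carrier := Lam\<rparr>) (Ht\<lparr>carrier := H\<rparr>));
        \<And>g. g \<in> Lam \<Longrightarrow> tensor_act K (L\<lparr>carrier := Lam\<rparr>) act t g = \<zero>\<^bsub>L\<^esub>\<rbrakk> \<Longrightarrow>
        t = \<zero>\<^bsub>tensor K (L\<lparr>carrier := Lam\<rparr>) (Ht\<lparr>carrier := H\<rparr>)\<^esub>"

definition smash_map ::
  "'k ring \<Rightarrow> ('k, 's) module \<Rightarrow> ('a \<Rightarrow> 's) \<Rightarrow> ('h \<Rightarrow> 's) \<Rightarrow> ('a \<times> 'h \<Rightarrow> 'k) set \<Rightarrow> 's" where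
  "smash_map K S iA iH = tensor_lift K S (\<lambda>a x. iA a \<otimes>\<^bsub>S\<^esub> iH x)"

text \<open>\<open>S\<close>, with the inclusions \<open>iA\<close> and \<open>iH\<close> of \<open>A\<close> and \<open>Ht\<close>, is the smash product \<open>A # Ht\<close>.\<close>

locale smash_product = k_algebra K S
  for K :: "'k ring" and S :: "('k, 's) module" +
  fixes A :: "('k, 'a) module" and Ht :: "('k, 'h) module"
    and \<Delta> :: "'h \<Rightarrow> ('h \<times> 'h \<Rightarrow> 'k) set" and act :: "'h \<Rightarrow> 'a \<Rightarrow> 'a"
    and iA :: "'a \<Rightarrow> 's" and iH :: "'h \<Rightarrow> 's"
  assumes iA_hom: "k_alg_hom K A S iA" and iA_inj: "inj_on iA (carrier A)"
    and iH_hom: "k_alg_hom K Ht S iH" and iH_inj: "inj_on iH (carrier Ht)"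
    and smash_bij: "bij_betw (smash_map K S iA iH) (carrier (tensor K A Ht)) (carrier S)"
    and smash_comm: "\<lbrakk>x \<in> carrier Ht; a \<in> carrier A\<rbrakk> \<Longrightarrow>
      iH x \<otimes>\<^bsub>S\<^esub> iA a = tensor_lift K S (\<lambda>u v. iA (act u a) \<otimes>\<^bsub>S\<^esub> iH v) (\<Delta> x)"

text \<open>The subalgebra \<open>A # H\<close> of \<open>A # Ht\<close> for a left coideal subalgebra \<open>H\<close> of \<open>Ht\<close>.\<close>

definition smash_sub ::
  "'k ring \<Rightarrow> ('k, 's) module \<Rightarrow> ('k, 'a) module \<Rightarrow> ('a \<Rightarrow> 's) \<Rightarrow> ('h \<Rightarrow> 's) \<Rightarrow> 'h set \<Rightarrow> 's set" where
  "smash_sub K S A iA iH H = k_span K S {iA a \<otimes>\<^bsub>S\<^esub> iH x | a x. a \<in> carrier A \<and> x \<in> H}"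

text \<open>The endomorphism of \<open>A\<close> corresponding to \<open>X \<in> A # Ht\<close>.\<close>

definition hat ::
  "'k ring \<Rightarrow> ('k, 's) module \<Rightarrow> ('k, 'a) module \<Rightarrow> ('k, 'h) module \<Rightarrow> ('h \<Rightarrow> 'a \<Rightarrow> 'a) \<Rightarrow>
   ('a \<Rightarrow> 's) \<Rightarrow> ('h \<Rightarrow> 's) \<Rightarrow> 's \<Rightarrow> 'a \<Rightarrow> 'a" where
  "hat K S A Ht act iA iH X =
     tensor_act K A act (inv_into (carrier (tensor K A Ht)) (smash_map K S iA iH) X)"

definition galois_order ::
  "'k ring \<Rightarrow> ('k, 'h) module \<Rightarrow> 'h set \<Rightarrow> ('k, 'l) module \<Rightarrow> 'l set \<Rightarrow> ('h \<Rightarrow> 'l \<Rightarrow> 'l) \<Rightarrow>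
   ('k, 's) module \<Rightarrow> ('l \<Rightarrow> 's) \<Rightarrow> ('h \<Rightarrow> 's) \<Rightarrow> 's set \<Rightarrow> bool" where
  "galois_order K Ht H L Lam act S iL iH F \<longleftrightarrow>
     k_subalgebra K F S \<and>
     F \<subseteq> smash_sub K S L iL iH H \<and>
     iL ` Lam \<subseteq> F \<and>
     k_span K S {iL f \<otimes>\<^bsub>S\<^esub> X | f X. f \<in> carrier L \<and> X \<in> F} = smash_sub K S L iL iH H \<and>
     (\<forall>X\<in>F. \<forall>g\<in>Lam. hat K S L Ht act iL iH X g \<in> Lam)"


section \<open>Modules over noncommutative rings\<close>

text \<open>The library locale \<open>module\<close> requires a commutative ring of scalars.\<close>

locale left_module = A: ring A + abelian_group V
  for A :: "('a, 'n) ring_scheme" and V :: "('a, 'v) module" +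
  assumes smult_closed: "\<lbrakk>a \<in> carrier A; v \<in> carrier V\<rbrakk> \<Longrightarrow> a \<odot>\<^bsub>V\<^esub> v \<in> carrier V"
    and smult_l_distr: "\<lbrakk>a \<in> carrier A; b \<in> carrier A; v \<in> carrier V\<rbrakk> \<Longrightarrow>
      (a \<oplus>\<^bsub>A\<^esub> b) \<odot>\<^bsub>V\<^esub> v = a \<odot>\<^bsub>V\<^esub> v \<oplus>\<^bsub>V\<^esub> b \<odot>\<^bsub>V\<^esub> v"
    and smult_r_distr: "\<lbrakk>a \<in> carrier A; v \<in> carrier V; w \<in> carrier V\<rbrakk> \<Longrightarrow>
      a \<odot>\<^bsub>V\<^esub> (v \<oplus>\<^bsub>V\<^esub> w) = a \<odot>\<^bsub>V\<^esub> v \<oplus>\<^bsub>V\<^esub> a \<odot>\<^bsub>V\<^esub> w"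
    and smult_assoc: "\<lbrakk>a \<in> carrier A; b \<in> carrier A; v \<in> carrier V\<rbrakk> \<Longrightarrow>
      (a \<otimes>\<^bsub>A\<^esub> b) \<odot>\<^bsub>V\<^esub> v = a \<odot>\<^bsub>V\<^esub> (b \<odot>\<^bsub>V\<^esub> v)"
    and smult_one: "v \<in> carrier V \<Longrightarrow> \<one>\<^bsub>A\<^esub> \<odot>\<^bsub>V\<^esub> v = v"

definition simple_module :: "('a, 'n) ring_scheme \<Rightarrow> ('a, 'v) module \<Rightarrow> bool" where
  "simple_module A V \<longleftrightarrow>
     left_module A V \<and> carrier V \<noteq> {\<zero>\<^bsub>V\<^esub>} \<and>
     (\<forall>N. submodule N A V \<longrightarrow> N = {\<zero>\<^bsub>V\<^esub>} \<or> N = carrier V)"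

definition module_iso :: "('a, 'n) ring_scheme \<Rightarrow> ('a, 'v) module \<Rightarrow> ('a, 'w) module \<Rightarrow> bool" where
  "module_iso A V W \<longleftrightarrow>
     (\<exists>f. bij_betw f (carrier V) (carrier W) \<and>
       (\<forall>x\<in>carrier V. \<forall>y\<in>carrier V. f (x \<oplus>\<^bsub>V\<^esub> y) = f x \<oplus>\<^bsub>W\<^esub> f y) \<and>
       (\<forall>a\<in>carrier A. \<forall>x\<in>carrier V. f (a \<odot>\<^bsub>V\<^esub> x) = a \<odot>\<^bsub>W\<^esub> f x))"

definition opposite :: "('k, 'a) module \<Rightarrow> ('k, 'a) module" where
  "opposite A = A\<lparr>mult := (\<lambda>x y. y \<otimes>\<^bsub>A\<^esub> x)\<rparr>"

definition right_ideal :: "'a set \<Rightarrow> ('a, 'n) ring_scheme \<Rightarrow> bool" where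
  "right_ideal J A \<longleftrightarrow>
     additive_subgroup J A \<and> (\<forall>x\<in>J. \<forall>a\<in>carrier A. x \<otimes>\<^bsub>A\<^esub> a \<in> J)"

definition maximal_right_ideal :: "'a set \<Rightarrow> ('a, 'n) ring_scheme \<Rightarrow> bool" where
  "maximal_right_ideal J A \<longleftrightarrow>
     right_ideal J A \<and> J \<noteq> carrier A \<and>
     (\<forall>I. right_ideal I A \<and> J \<subseteq> I \<longrightarrow> I = J \<or> I = carrier A)"


section \<open>Harish-Chandra modules\<close>

primrec ideal_pow :: "('a, 'n) ring_scheme \<Rightarrow> 'a set \<Rightarrow> nat \<Rightarrow> 'a set" where
  "ideal_pow R I 0 = carrier R"
| "ideal_pow R I (Suc n) = ideal_prod R I (ideal_pow R I n)"

text \<open>In this section \<open>i\<close> is the inclusion of the commutative algebra \<open>R\<close> (that is, \<open>\<Lambda>\<close>) into the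
  algebra \<open>A\<close> acting on \<open>V\<close>.\<close>

definition weight_space ::
  "('k, 'r) module \<Rightarrow> ('r \<Rightarrow> 'a) \<Rightarrow> ('a, 'v) module \<Rightarrow> 'r set \<Rightarrow> 'v set" where
  "weight_space R i V m =
     {v \<in> carrier V. \<exists>N0. \<forall>N\<ge>N0. \<forall>r\<in>ideal_pow R m N. i r \<odot>\<^bsub>V\<^esub> v = \<zero>\<^bsub>V\<^esub>}"

text \<open>\<open>R / I\<close> is finite-dimensional: finitely many elements span \<open>R\<close> modulo \<open>I\<close>.\<close>

definition finite_codim :: "'k ring \<Rightarrow> ('k, 'r) module \<Rightarrow> 'r set \<Rightarrow> bool" where
  "finite_codim K R I \<longleftrightarrow>
     (\<exists>B. finite B \<and> B \<subseteq> carrier R \<and> k_span K R (B \<union> I) = carrier R)"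

definition cofinite_maximal_ideals :: "'k ring \<Rightarrow> ('k, 'r) module \<Rightarrow> 'r set set" where
  "cofinite_maximal_ideals K R = {m. maximalideal m R \<and> finite_codim K R m}"

definition internal_direct_sum :: "('a, 'v) module \<Rightarrow> 'i set \<Rightarrow> ('i \<Rightarrow> 'v set) \<Rightarrow> bool" where
  "internal_direct_sum V I W \<longleftrightarrow>
     (\<forall>v\<in>carrier V. \<exists>J w. finite J \<and> J \<subseteq> I \<and> w \<in> Pi J W \<and> v = (\<Oplus>\<^bsub>V\<^esub>j\<in>J. w j)) \<and>
     (\<forall>J w. finite J \<and> J \<subseteq> I \<and> w \<in> Pi J W \<and> (\<Oplus>\<^bsub>V\<^esub>j\<in>J. w j) = \<zero>\<^bsub>V\<^esub> \<longrightarrow>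
        (\<forall>j\<in>J. w j = \<zero>\<^bsub>V\<^esub>))"

definition harish_chandra_module ::
  "'k ring \<Rightarrow> ('k, 'r) module \<Rightarrow> ('r \<Rightarrow> 'a) \<Rightarrow> ('k, 'a) module \<Rightarrow> ('a, 'v) module \<Rightarrow> bool" where
  "harish_chandra_module K R i A V \<longleftrightarrow>
     left_module A V \<and>
     internal_direct_sum V (cofinite_maximal_ideals K R) (weight_space R i V)"

text \<open>Modules are taken with carrier in \<open>'a set\<close>, where \<open>'a\<close> is the type of the elements of \<open>A\<close>.
  Every isomorphism class of simple \<open>A\<close>-modules has a representative of this kind, namely the
  quotient of \<open>A\<close> by the annihilator of a nonzero element.\<close>

definition Irr ::
  "'k ring \<Rightarrow> ('k, 'r) module \<Rightarrow> ('r \<Rightarrow> 'a) \<Rightarrow> ('k, 'a) module \<Rightarrow> 'r set \<Rightarrow>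
   ('a, 'a set) module set set" where
  "Irr K R i A m =
     (let X = {V. simple_module A V \<and> harish_chandra_module K R i A V \<and>
                  weight_space R i V m \<noteq> {\<zero>\<^bsub>V\<^esub>}}
      in X // {(V, W). V \<in> X \<and> W \<in> X \<and> module_iso A V W})"

end

theory Submission
  imports Defs
begin

text \<open>For \<open>X \<in> F\<close> the endomorphism of \<open>L\<close> given by \<open>X\<close> preserves \<open>\<Lambda>\<close> and is left
  \<open>\<Lambda>\<close>-linear in \<open>X\<close>. Hence the right ideal of all \<open>X \<in> F\<close> such that the endomorphism of \<open>X Y\<close> sends \<open>1\<close> into \<open>m\<close> for every \<open>Y \<in> F\<close> contains
  \<open>m\<close> but not \<open>1\<close>, and Zorn's lemma yields a maximal right ideal \<open>J\<close>. The module is \<open>F / J\<close>, where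
  the class of \<open>1\<close> is killed by \<open>m\<close>.

  For the Harish-Chandra property, the commutation rule of the smash product puts \<open>X \<Lambda>\<close> into a
  finitely generated left \<open>\<Lambda>\<close>-module. As \<open>\<Lambda>\<close> is noetherian, \<open>\<Lambda> X \<Lambda>\<close> is finitely generated on the
  left, so if \<open>\<Lambda> / m\<close> is finite-dimensional, then so is the image of \<open>X \<Lambda>\<close> in \<open>F / J\<close>. Thus every
  element of \<open>F / J\<close> generates a finite-dimensional \<open>\<Lambda>\<close>-module, and such modules split into their
  generalised weight spaces.\<close>

section \<open>Submodules and noetherian rings\<close>

text \<open>\<open>\<Lambda>\<close> acts on \<open>F / J\<close> by right multiplication, whereas
  \<open>m \<subseteq> J\<close> gives information on the left: \<open>m F \<subseteq> J\<close>,
  since \<open>J\<close> is a right ideal. Generators of the left module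
  \<open>\<Lambda> X \<Lambda>\<close> therefore help only if they lie in \<open>F\<close>. The
  commutation rule produces generators with coefficients in \<open>L\<close>, which may lie outside
  \<open>F\<close>; noetherianity of \<open>\<Lambda>\<close> replaces them by elements
  \<open>g\<close> of \<open>\<Lambda> X \<Lambda> \<subseteq> F\<close>. If the elements
  \<open>b\<close> span \<open>\<Lambda>\<close> modulo \<open>m\<close>, then the products
  \<open>b g\<close> span \<open>\<Lambda> X \<Lambda>\<close> modulo \<open>J\<close> over
  \<open>K\<close>. Dimension counts are replaced by one finiteness statement on submodules between
  \<open>A\<close> and the span of \<open>E \<union> A\<close>, applied over
  \<open>\<Lambda>\<close> and over the field \<open>K\<close>. The submodule \<open>A\<close> is
  the part to be factored out, so that finite codimension is handled without forming quotients. The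
  splitting into weight spaces uses elements congruent to 1 modulo a maximal ideal in place of
  idempotents of a finite-dimensional quotient of \<open>\<Lambda>\<close>.\<close>

text \<open>\<open>k_span\<close> for scalars in an arbitrary record extension, such as \<open>\<Lambda>\<close>, which is itself a
  \<open>K\<close>-algebra.\<close>

definition mspan :: "('a, 'n) ring_scheme \<Rightarrow> ('a, 'v, 'm) module_scheme \<Rightarrow> 'v set \<Rightarrow> 'v set" where
  "mspan R M X = \<Inter> {N. submodule N R M \<and> X \<subseteq> N}"

lemma k_span_eq_mspan: "k_span K V X = mspan K V X"
  by (simp add: k_span_def mspan_def)

context module
begin

lemma mspan_superset: "X \<subseteq> mspan R M X"
  unfolding mspan_def by blast

lemma mspan_least: "submodule N R M \<Longrightarrow> X \<subseteq> N \<Longrightarrow> mspan R M X \<subseteq> N"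
  unfolding mspan_def by blast

lemma mspan_submodule:
  assumes "X \<subseteq> carrier M" shows "submodule (mspan R M X) R M"
proof (rule submoduleI)
  show "mspan R M X \<subseteq> carrier M"
    by (rule mspan_least[OF carrier_is_submodule assms])
qed (auto simp: mspan_def submoduleE submodule.smult_closed
     intro: subgroup.one_closed[OF submodule.axioms(1), simplified])

lemma submodule_zero: "submodule N R M \<Longrightarrow> \<zero>\<^bsub>M\<^esub> \<in> N"
  using subgroup.one_closed[OF submodule.axioms(1)] by fastforce

lemma submodule_diff:
  assumes "submodule N R M" "x \<in> N" "y \<in> N" shows "x \<ominus>\<^bsub>M\<^esub> y \<in> N"
  using submoduleE(3,5)[OF assms(1)] assms by (simp add: M.minus_eq)

lemma zero_submodule: "submodule {\<zero>\<^bsub>M\<^esub>} R M"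
  by (rule submoduleI) auto

lemma inter_submodule: "submodule N R M \<Longrightarrow> submodule N' R M \<Longrightarrow> submodule (N \<inter> N') R M"
  by (rule submoduleI) (auto simp: submoduleE submodule_zero dest: subsetD[OF submoduleE(1)])

lemma insert_submodule:
  assumes e: "e \<in> carrier M" and N: "submodule N R M"
  shows "submodule {r \<odot>\<^bsub>M\<^esub> e \<oplus>\<^bsub>M\<^esub> y | r y. r \<in> carrier R \<and> y \<in> N} R M"
proof (rule submoduleI)
  note [simp] = subsetD[OF submoduleE(1)[OF N]] submodule_zero[OF N] e
  show "{r \<odot>\<^bsub>M\<^esub> e \<oplus>\<^bsub>M\<^esub> y | r y. r \<in> carrier R \<and> y \<in> N} \<subseteq> carrier M" by auto
  show "\<zero>\<^bsub>M\<^esub> \<in> {r \<odot>\<^bsub>M\<^esub> e \<oplus>\<^bsub>M\<^esub> y | r y. r \<in> carrier R \<and> y \<in> N}"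
    by (auto intro!: exI[of _ \<zero>] exI[of _ "\<zero>\<^bsub>M\<^esub>"])
next
  note [simp] = subsetD[OF submoduleE(1)[OF N]] submodule_zero[OF N] e
  fix x assume "x \<in> {r \<odot>\<^bsub>M\<^esub> e \<oplus>\<^bsub>M\<^esub> y | r y. r \<in> carrier R \<and> y \<in> N}"
  then obtain r y where x: "r \<in> carrier R" "y \<in> N" "x = r \<odot>\<^bsub>M\<^esub> e \<oplus>\<^bsub>M\<^esub> y" by blast
  have "\<ominus>\<^bsub>M\<^esub> x = (\<ominus> r) \<odot>\<^bsub>M\<^esub> e \<oplus>\<^bsub>M\<^esub> \<ominus>\<^bsub>M\<^esub> y" using x by (simp add: M.minus_add smult_l_minus)
  with x show "\<ominus>\<^bsub>M\<^esub> x \<in> {r \<odot>\<^bsub>M\<^esub> e \<oplus>\<^bsub>M\<^esub> y | r y. r \<in> carrier R \<and> y \<in> N}"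
    using submoduleE(3)[OF N] by blast
  { fix x' assume "x' \<in> {r \<odot>\<^bsub>M\<^esub> e \<oplus>\<^bsub>M\<^esub> y | r y. r \<in> carrier R \<and> y \<in> N}"
    then obtain r' y' where x': "r' \<in> carrier R" "y' \<in> N" "x' = r' \<odot>\<^bsub>M\<^esub> e \<oplus>\<^bsub>M\<^esub> y'" by blast
    have "x \<oplus>\<^bsub>M\<^esub> x' = (r \<oplus> r') \<odot>\<^bsub>M\<^esub> e \<oplus>\<^bsub>M\<^esub> (y \<oplus>\<^bsub>M\<^esub> y')"
      using x x' by (simp add: smult_l_distr M.a_ac)
    with x x' show "x \<oplus>\<^bsub>M\<^esub> x' \<in> {r \<odot>\<^bsub>M\<^esub> e \<oplus>\<^bsub>M\<^esub> y | r y. r \<in> carrier R \<and> y \<in> N}"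
      using submoduleE(5)[OF N] by blast }
  fix a assume a: "a \<in> carrier R"
  have "a \<odot>\<^bsub>M\<^esub> x = (a \<otimes> r) \<odot>\<^bsub>M\<^esub> e \<oplus>\<^bsub>M\<^esub> (a \<odot>\<^bsub>M\<^esub> y)"
    using x a by (simp add: smult_r_distr smult_assoc1)
  with x a show "a \<odot>\<^bsub>M\<^esub> x \<in> {r \<odot>\<^bsub>M\<^esub> e \<oplus>\<^bsub>M\<^esub> y | r y. r \<in> carrier R \<and> y \<in> N}"
    using submoduleE(4)[OF N] by blast
qed

text \<open>Splitting off one generator at a time allows induction over generating sets without
  writing out linear combinations.\<close>

lemma mspan_insertD:
  assumes "e \<in> carrier M" "Y \<subseteq> carrier M" "x \<in> mspan R M (insert e Y)"
  obtains r y where "r \<in> carrier R" "y \<in> mspan R M Y" "x = r \<odot>\<^bsub>M\<^esub> e \<oplus>\<^bsub>M\<^esub> y"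
proof -
  let ?N = "{r \<odot>\<^bsub>M\<^esub> e \<oplus>\<^bsub>M\<^esub> y | r y. r \<in> carrier R \<and> y \<in> mspan R M Y}"
  note Y = mspan_submodule[OF assms(2)]
  have "mspan R M (insert e Y) \<subseteq> ?N"
  proof (rule mspan_least[OF insert_submodule[OF assms(1) Y]], safe)
    show "\<exists>r y. e = r \<odot>\<^bsub>M\<^esub> e \<oplus>\<^bsub>M\<^esub> y \<and> r \<in> carrier R \<and> y \<in> mspan R M Y"
      using assms(1) submodule_zero[OF Y] by (intro exI[of _ \<one>] exI[of _ "\<zero>\<^bsub>M\<^esub>"]) (auto simp: smult_one)
    fix x assume "x \<in> Y"
    then show "\<exists>r y. x = r \<odot>\<^bsub>M\<^esub> e \<oplus>\<^bsub>M\<^esub> y \<and> r \<in> carrier R \<and> y \<in> mspan R M Y"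
      using assms(1,2) mspan_superset[of Y] by (intro exI[of _ \<zero>] exI[of _ x]) auto
  qed
  with assms(3) show thesis using that by blast
qed

lemma mspan_mono: "X \<subseteq> Y \<Longrightarrow> mspan R M X \<subseteq> mspan R M Y"
  unfolding mspan_def by blast

text \<open>The ideal of leading coefficients from Hilbert's basis theorem: \<open>e\<close> plays
  the part of the leading monomial and \<open>Y\<close> that of the lower terms. For
  \<open>Y = 0\<close> it becomes the colon ideal of \<open>W\<close> and \<open>e\<close>.\<close>

lemma coefficient_ideal:
  assumes e: "e \<in> carrier M" and W: "submodule W R M" and Y: "submodule Y R M"
  shows "ideal {r \<in> carrier R. \<exists>y\<in>Y. r \<odot>\<^bsub>M\<^esub> e \<oplus>\<^bsub>M\<^esub> y \<in> W} R" (is "ideal ?I R")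
proof -
  note [simp] = e subsetD[OF submoduleE(1)[OF Y]]
  have add: "r \<oplus> r' \<in> ?I" if rr: "r \<in> ?I" "r' \<in> ?I" for r r'
  proof -
    from rr obtain y y' where y: "y \<in> Y" "r \<odot>\<^bsub>M\<^esub> e \<oplus>\<^bsub>M\<^esub> y \<in> W" "y' \<in> Y" "r' \<odot>\<^bsub>M\<^esub> e \<oplus>\<^bsub>M\<^esub> y' \<in> W" by blast
    have "(r \<oplus> r') \<odot>\<^bsub>M\<^esub> e \<oplus>\<^bsub>M\<^esub> (y \<oplus>\<^bsub>M\<^esub> y') = (r \<odot>\<^bsub>M\<^esub> e \<oplus>\<^bsub>M\<^esub> y) \<oplus>\<^bsub>M\<^esub> (r' \<odot>\<^bsub>M\<^esub> e \<oplus>\<^bsub>M\<^esub> y')"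
      using rr y by (simp add: smult_l_distr M.a_ac)
    then have "(r \<oplus> r') \<odot>\<^bsub>M\<^esub> e \<oplus>\<^bsub>M\<^esub> (y \<oplus>\<^bsub>M\<^esub> y') \<in> W" "y \<oplus>\<^bsub>M\<^esub> y' \<in> Y"
      using y submoduleE(5)[OF W] submoduleE(5)[OF Y] by simp_all
    then show ?thesis using rr by blast
  qed
  have mult: "a \<otimes> r \<in> ?I" if ar: "a \<in> carrier R" "r \<in> ?I" for a r
  proof -
    from ar obtain y where y: "y \<in> Y" "r \<odot>\<^bsub>M\<^esub> e \<oplus>\<^bsub>M\<^esub> y \<in> W" by blast
    have "(a \<otimes> r) \<odot>\<^bsub>M\<^esub> e \<oplus>\<^bsub>M\<^esub> (a \<odot>\<^bsub>M\<^esub> y) = a \<odot>\<^bsub>M\<^esub> (r \<odot>\<^bsub>M\<^esub> e \<oplus>\<^bsub>M\<^esub> y)"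
      using ar y by (simp add: smult_r_distr smult_assoc1)
    then have "(a \<otimes> r) \<odot>\<^bsub>M\<^esub> e \<oplus>\<^bsub>M\<^esub> (a \<odot>\<^bsub>M\<^esub> y) \<in> W" "a \<odot>\<^bsub>M\<^esub> y \<in> Y"
      using y ar submoduleE(4)[OF W] submoduleE(4)[OF Y] by simp_all
    then show ?thesis using ar by blast
  qed
  have z: "\<zero> \<in> ?I" using submodule_zero[OF W] submodule_zero[OF Y] by force
  show ?thesis
  proof (rule idealI[OF R.ring_axioms])
    show "subgroup ?I (add_monoid R)"
    proof (rule R.add.subgroupI)
      fix a assume a: "a \<in> ?I"
      have "\<ominus> a = (\<ominus> \<one>) \<otimes> a" using a by (simp add: R.l_minus)
      thus "\<ominus> a \<in> ?I" using mult[OF _ a] by simp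
    next
      show "?I \<noteq> {}" using z by blast
    qed (use add in auto)
    fix a x assume a: "a \<in> ?I" "x \<in> carrier R"
    show "x \<otimes> a \<in> ?I" by (rule mult[OF a(2,1)])
    moreover have "a \<otimes> x = x \<otimes> a" using a R.m_comm by blast
    ultimately show "a \<otimes> x \<in> ?I" by (simp only:)
  qed
qed

text \<open>Hilbert's argument on the ideal of leading coefficients, relative to a submodule \<open>A\<close>.\<close>

lemma noetherian_finitely_generated:
  assumes R: "noetherian_ring R" and A: "submodule A R M"
    and "finite E" "E \<subseteq> carrier M" "submodule W R M" "A \<subseteq> W" "W \<subseteq> mspan R M (E \<union> A)"
  shows "\<exists>G. finite G \<and> G \<subseteq> W \<and> W = mspan R M (G \<union> A)"
  using assms(3-)
proof (induction E arbitrary: W rule: finite_induct)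
  case empty
  have "mspan R M A \<subseteq> A" by (rule mspan_least[OF A]) simp
  with empty show ?case using mspan_superset[of A] by (intro exI[of _ "{}"]) auto
next
  case (insert e E)
  have AM: "A \<subseteq> carrier M" by (rule submoduleE(1)[OF A])
  have eM: "e \<in> carrier M" and EM: "E \<union> A \<subseteq> carrier M" using insert AM by auto
  let ?Y = "mspan R M (E \<union> A)"
  have Y: "submodule ?Y R M" by (rule mspan_submodule[OF EM])
  let ?I = "\<lambda>W. {r \<in> carrier R. \<exists>y\<in>?Y. r \<odot>\<^bsub>M\<^esub> e \<oplus>\<^bsub>M\<^esub> y \<in> W}"
  have W: "submodule W R M" using insert by blast
  obtain B where B: "finite B" "B \<subseteq> carrier R" "?I W = Idl B"
    using noetherian_ring.finetely_gen[OF R coefficient_ideal[OF eM W Y]] by blast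
  have "B \<subseteq> ?I W" using R.genideal_self[OF B(2)] B(3) by simp
  then have "\<forall>b\<in>B. \<exists>y. y \<in> ?Y \<and> b \<odot>\<^bsub>M\<^esub> e \<oplus>\<^bsub>M\<^esub> y \<in> W" by blast
  then obtain y where y: "\<And>b. b \<in> B \<Longrightarrow> y b \<in> ?Y \<and> b \<odot>\<^bsub>M\<^esub> e \<oplus>\<^bsub>M\<^esub> y b \<in> W" by metis
  \<comment> \<open>The induction hypothesis covers the elements of \<open>W\<close> that can be
    written without \<open>e\<close>.\<close>
  have "\<exists>G. finite G \<and> G \<subseteq> W \<inter> ?Y \<and> W \<inter> ?Y = mspan R M (G \<union> A)"
    by (rule insert.IH) (use insert EM inter_submodule[OF W Y] mspan_superset[of "E \<union> A"] in auto)
  then obtain G0 where G0: "finite G0" "G0 \<subseteq> W \<inter> ?Y" "W \<inter> ?Y = mspan R M (G0 \<union> A)" by blast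
  define G where "G = G0 \<union> (\<lambda>b. b \<odot>\<^bsub>M\<^esub> e \<oplus>\<^bsub>M\<^esub> y b) ` B"
  have GW: "G \<subseteq> W" using G0 y by (auto simp: G_def)
  then have GM: "G \<union> A \<subseteq> carrier M" using submoduleE(1)[OF W] AM by blast
  have Q: "submodule (mspan R M (G \<union> A)) R M" by (rule mspan_submodule[OF GM])
  have QW: "mspan R M (G \<union> A) \<subseteq> W" by (rule mspan_least[OF W]) (use GW insert in auto)
  have "B \<subseteq> ?I (mspan R M (G \<union> A))"
    using y B(2) mspan_superset[of "G \<union> A"] unfolding G_def by fastforce
  \<comment> \<open>Both coefficient sets are ideals, so it is enough that the generators
    \<open>B\<close> are leading coefficients of elements of \<open>G\<close>.\<close>
  then have I: "?I W \<subseteq> ?I (mspan R M (G \<union> A))"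
    unfolding B(3) by (rule R.genideal_minimal[OF coefficient_ideal[OF eM Q Y]])
  have "w \<in> mspan R M (G \<union> A)" if w: "w \<in> W" for w
  proof -
    have "w \<in> mspan R M (insert e (E \<union> A))" using w insert by auto
    then obtain r z where z: "r \<in> carrier R" "z \<in> ?Y" "w = r \<odot>\<^bsub>M\<^esub> e \<oplus>\<^bsub>M\<^esub> z"
      using mspan_insertD[OF eM EM] by blast
    with w have "r \<in> ?I W" by blast
    then obtain z' where z': "z' \<in> ?Y" "r \<odot>\<^bsub>M\<^esub> e \<oplus>\<^bsub>M\<^esub> z' \<in> mspan R M (G \<union> A)" using I by blast
    have c: "z \<in> carrier M" "z' \<in> carrier M" using z z' submoduleE(1)[OF Y] by auto
    \<comment> \<open>\<open>w\<close> and the element found in the span of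
      \<open>G \<union> A\<close> share the coefficient \<open>r\<close>, so \<open>e\<close>
      cancels in their difference, which lies in \<open>W\<close> and in \<open>?Y\<close> and is
      thus covered by \<open>G0\<close>. This does not presuppose that \<open>r\<close> is
      determined by \<open>w\<close>.\<close>
    have e2: "z \<ominus>\<^bsub>M\<^esub> z' = w \<ominus>\<^bsub>M\<^esub> (r \<odot>\<^bsub>M\<^esub> e \<oplus>\<^bsub>M\<^esub> z')"
    proof -
      have "w \<ominus>\<^bsub>M\<^esub> (r \<odot>\<^bsub>M\<^esub> e \<oplus>\<^bsub>M\<^esub> z') = (r \<odot>\<^bsub>M\<^esub> e \<oplus>\<^bsub>M\<^esub> \<ominus>\<^bsub>M\<^esub> (r \<odot>\<^bsub>M\<^esub> e)) \<oplus>\<^bsub>M\<^esub> (z \<oplus>\<^bsub>M\<^esub> \<ominus>\<^bsub>M\<^esub> z')"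
        using z c eM by (simp only: M.minus_eq M.minus_add M.a_ac smult_closed M.a_closed M.a_inv_closed)
      then show ?thesis using z c eM by (simp add: M.r_neg M.minus_eq)
    qed
    have "z \<ominus>\<^bsub>M\<^esub> z' \<in> W" unfolding e2 using submodule_diff[OF W w] z' QW by blast
    moreover have "z \<ominus>\<^bsub>M\<^esub> z' \<in> ?Y" using submodule_diff[OF Y] z z' by blast
    ultimately have "z \<ominus>\<^bsub>M\<^esub> z' \<in> mspan R M (G0 \<union> A)" using G0 by blast
    moreover have "mspan R M (G0 \<union> A) \<subseteq> mspan R M (G \<union> A)" by (rule mspan_mono) (auto simp: G_def)
    ultimately have 1: "z \<ominus>\<^bsub>M\<^esub> z' \<in> mspan R M (G \<union> A)" by blast
    have "w = (z \<ominus>\<^bsub>M\<^esub> z') \<oplus>\<^bsub>M\<^esub> (r \<odot>\<^bsub>M\<^esub> e \<oplus>\<^bsub>M\<^esub> z')"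
      unfolding e2 using z c eM z'(2) submoduleE(1)[OF Q] w submoduleE(1)[OF W]
      by (auto simp: M.minus_eq M.a_assoc M.l_neg)
    then show ?thesis using submoduleE(5)[OF Q 1 z'(2)] by simp
  qed
  with QW have "W = mspan R M (G \<union> A)" by blast
  moreover have "finite G" using G0 B by (simp add: G_def)
  ultimately show ?case using GW by blast
qed

end

section \<open>Ideals of finite codimension\<close>

lemma (in k_algebra) ideal_submodule:
  assumes "ideal I A" shows "submodule I K A"
proof (rule submoduleI)
  interpret I: ideal I A by fact
  fix c x assume cx: "c \<in> carrier K" "x \<in> I"
  then have "c \<odot>\<^bsub>A\<^esub> x = (c \<odot>\<^bsub>A\<^esub> \<one>\<^bsub>A\<^esub>) \<otimes>\<^bsub>A\<^esub> x"
    using I.a_subset by (simp add: smult_mult_left subsetD)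
  then show "c \<odot>\<^bsub>A\<^esub> x \<in> I" using cx I.I_l_closed by simp
qed (use assms in \<open>auto simp: ideal.Icarr additive_subgroup.zero_closed ideal.axioms(1)
       additive_subgroup.a_closed additive_subgroup.a_inv_closed\<close>)

lemma (in k_algebra) finite_codim_mono:
  assumes "finite_codim K A I" "I \<subseteq> I'" "I' \<subseteq> carrier A"
  shows "finite_codim K A I'"
proof -
  obtain B where B: "finite B" "B \<subseteq> carrier A" "k_span K A (B \<union> I) = carrier A"
    using assms(1) unfolding finite_codim_def by blast
  have "mspan K A (B \<union> I') \<subseteq> carrier A"
    using mspan_submodule[of "B \<union> I'"] B assms(3) submoduleE(1) by blast
  moreover have "mspan K A (B \<union> I) \<subseteq> mspan K A (B \<union> I')" using assms(2) by (intro mspan_mono) auto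
  ultimately show ?thesis using B unfolding finite_codim_def k_span_eq_mspan by blast
qed

text \<open>By maximality \<open>n\<close> and \<open>x\<close> together generate the unit ideal;
  \<open>y\<close> represents the inverse of \<open>x\<close> in the residue field.\<close>

lemma (in cring) maximalideal_inverse_mod:
  assumes "maximalideal n R" "x \<in> carrier R" "x \<notin> n"
  obtains y where "y \<in> carrier R" "y \<otimes> x \<ominus> \<one> \<in> n"
proof -
  interpret n: maximalideal n R by fact
  have I: "ideal (n <+> PIdl x) R" using add_ideals[OF n.is_ideal cgenideal_ideal[OF assms(2)]] .
  have sub: "n \<subseteq> n <+> PIdl x"
  proof
    fix a assume "a \<in> n"
    then have "a \<oplus> \<zero> \<in> n <+> PIdl x"
      using additive_subgroup.zero_closed[OF ideal.axioms(1)[OF cgenideal_ideal[OF assms(2)]]]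
      unfolding set_add_def' by blast
    with \<open>a \<in> n\<close> show "a \<in> n <+> PIdl x" using n.Icarr by simp
  qed
  have x: "x \<in> n <+> PIdl x"
  proof -
    have "\<zero> \<oplus> x \<in> n <+> PIdl x" using cgenideal_self[OF assms(2)] n.zero_closed
      unfolding set_add_def' by blast
    then show ?thesis using assms(2) by simp
  qed
  have "n <+> PIdl x = carrier R"
    using n.I_maximal[OF I sub] x assms(3) ideal.Icarr[OF I] by blast
  then obtain a y where y: "a \<in> n" "y \<in> carrier R" "\<one> = a \<oplus> y \<otimes> x"
    using one_closed unfolding set_add_def' cgenideal_def by blast
  have "y \<otimes> x \<ominus> \<one> = \<ominus> a"
    using y assms n.Icarr by (simp add: minus_eq minus_add a_ac r_neg1 r_neg)
  then show thesis using y that n.a_inv_closed by simp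
qed

text \<open>Multiplication by an element outside the prime \<open>p\<close> is injective on the finite-dimensional
  space \<open>A / p\<close>; instead of a dimension count, the span of the powers of the element stabilises.\<close>

lemma (in k_algebra) finite_codim_prime_maximal:
  assumes p: "primeideal p A" and fc: "finite_codim K A p"
  shows "maximalideal p A"
proof (rule maximalidealI)
  interpret p: primeideal p A by fact
  show "ideal p A" by (rule p.is_ideal)
  show "carrier A \<noteq> p" by (rule p.I_notcarr)
  fix J assume J: "ideal J A" "p \<subseteq> J" "J \<subseteq> carrier A"
  interpret J: ideal J A by fact
  have pK: "submodule p K A" by (rule ideal_submodule[OF p.is_ideal])
  have pA: "p \<subseteq> carrier A" using p.Icarr by blast
  have "J = carrier A" if "J \<noteq> p"
  proof -
    obtain b where b: "b \<in> J" "b \<notin> p" using J \<open>J \<noteq> p\<close> by blast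
    then have bA: "b \<in> carrier A" using J.Icarr by blast
    \<comment> \<open>\<open>Q n\<close> is spanned modulo \<open>p\<close> by the powers of
      \<open>b\<close> with exponent below \<open>n\<close>, so \<open>Q 0\<close> is
      \<open>p\<close> itself.\<close>
    define X where "X n = (\<lambda>i::nat. b [^]\<^bsub>A\<^esub> i) ` {..<n} \<union> p" for n
    define Q where "Q n = mspan K A (X n)" for n
    have XA: "X n \<subseteq> carrier A" for n using bA pA by (auto simp: X_def)
    have Q: "submodule (Q n) K A" for n unfolding Q_def by (rule mspan_submodule[OF XA])
    have mono: "i \<le> j \<Longrightarrow> Q i \<subseteq> Q j" for i j unfolding Q_def by (rule mspan_mono) (auto simp: X_def)
    have pQ: "p \<subseteq> Q n" for n using mspan_superset[of "X n"] by (auto simp: Q_def X_def)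
    have Q0: "Q 0 \<subseteq> p" unfolding Q_def by (rule mspan_least[OF pK]) (simp add: X_def)
    have XSuc: "X (Suc n) = insert (b [^]\<^bsub>A\<^esub> n) (X n)" for n by (auto simp: X_def lessThan_Suc)
    have QSuc: "\<exists>r\<in>carrier K. \<exists>y\<in>Q n. x = r \<odot>\<^bsub>A\<^esub> b [^]\<^bsub>A\<^esub> n \<oplus>\<^bsub>A\<^esub> y" if "x \<in> Q (Suc n)" for x n
      using that mspan_insertD[OF _ XA[of n], of "b [^]\<^bsub>A\<^esub> n" x] bA unfolding Q_def XSuc by blast
    have QI: "b [^]\<^bsub>A\<^esub> n \<in> Q (Suc n)" for n
      using mspan_superset[of "X (Suc n)"] unfolding Q_def XSuc by blast
    have QA: "Q n \<subseteq> carrier A" for n using submoduleE(1)[OF Q] .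
    let ?W = "\<Union>n. Q n"
    have W: "submodule ?W K A"
    proof (rule submoduleI)
      show "\<zero>\<^bsub>A\<^esub> \<in> ?W" using submodule_zero[OF Q] by blast
      fix x y assume "x \<in> ?W" "y \<in> ?W"
      then obtain i j where "x \<in> Q i" "y \<in> Q j" by blast
      then have "x \<in> Q (max i j)" "y \<in> Q (max i j)" using mono[of i "max i j"] mono[of j "max i j"] by auto
      then show "x \<oplus>\<^bsub>A\<^esub> y \<in> ?W" using submoduleE(5)[OF Q] by blast
    next
      show "?W \<subseteq> carrier A" using QA by blast
      show "\<ominus>\<^bsub>A\<^esub> x \<in> ?W" if "x \<in> ?W" for x using that submoduleE(3)[OF Q] by blast
      show "c \<odot>\<^bsub>A\<^esub> x \<in> ?W" if "c \<in> carrier K" "x \<in> ?W" for c x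
        using that submoduleE(4)[OF Q] by blast
    qed
    obtain B where B: "finite B" "B \<subseteq> carrier A" "mspan K A (B \<union> p) = carrier A"
      using fc unfolding finite_codim_def k_span_eq_mspan by blast
    have "noetherian_ring K" using K.noetherian_ring_axioms .
    moreover have "p \<subseteq> ?W" using pQ by blast
    moreover have "?W \<subseteq> mspan K A (B \<union> p)" using B(3) submoduleE(1)[OF W] by simp
    ultimately obtain G where G: "finite G" "G \<subseteq> ?W" "?W = mspan K A (G \<union> p)"
      using noetherian_finitely_generated[OF _ pK B(1,2) W] by blast
    \<comment> \<open>The chain \<open>Q\<close> is increasing, so the finitely many generators of
      its union lie in one member. There the chain stops, and that member contains the next power of
      \<open>b\<close>.\<close>
    have "\<exists>n. G \<subseteq> Q n" using G(1,2)
    proof (induction G rule: finite_induct)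
      case (insert g G)
      then obtain i j where "g \<in> Q i" "G \<subseteq> Q j" by auto
      then show ?case using mono[of i "max i j"] mono[of j "max i j"] by (intro exI[of _ "max i j"]) auto
    qed simp
    then obtain n where "G \<subseteq> Q n" by blast
    then have "?W \<subseteq> Q n" using mspan_least[OF Q[of n], of "G \<union> p"] pQ G(3) by auto
    then have ex: "\<exists>n. b [^]\<^bsub>A\<^esub> n \<in> Q n" using QI by blast
    \<comment> \<open>The least such exponent is positive because \<open>1\<close> is not in
      \<open>Q 0 = p\<close>. Minimality is what makes the constant term \<open>c\<close> below
      nonzero.\<close>
    define n where "n = (LEAST n. b [^]\<^bsub>A\<^esub> n \<in> Q n)"
    have n: "b [^]\<^bsub>A\<^esub> n \<in> Q n" unfolding n_def by (rule LeastI_ex[OF ex])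
    have "\<one>\<^bsub>A\<^esub> \<notin> p" using p.I_notcarr p.one_imp_carrier by blast
    then have "n \<noteq> 0" using n Q0 by (metis A.nat_pow_0 subsetD)
    then obtain k where k: "n = Suc k" by (cases n) auto
    then have nk: "b [^]\<^bsub>A\<^esub> k \<notin> Q k" using not_less_Least[of k "\<lambda>n. b [^]\<^bsub>A\<^esub> n \<in> Q n"] n_def by simp
    \<comment> \<open>Separating the constant term leaves a common factor \<open>b\<close>, and
      taking it out lowers the index of \<open>Q\<close> by one.\<close>
    have split: "\<exists>c\<in>carrier K. \<exists>y\<in>Q i. \<exists>z\<in>p. x = c \<odot>\<^bsub>A\<^esub> \<one>\<^bsub>A\<^esub> \<oplus>\<^bsub>A\<^esub> (b \<otimes>\<^bsub>A\<^esub> y \<oplus>\<^bsub>A\<^esub> z)"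
      if "x \<in> Q (Suc i)" for x i using that
    proof (induction i arbitrary: x)
      case 0
      then obtain r y where ry: "r \<in> carrier K" "y \<in> Q 0" "x = r \<odot>\<^bsub>A\<^esub> b [^]\<^bsub>A\<^esub> (0::nat) \<oplus>\<^bsub>A\<^esub> y" using QSuc by blast
      show ?case
        by (rule bexI[of _ r], rule bexI[of _ "\<zero>\<^bsub>A\<^esub>"], rule bexI[of _ y])
          (use ry Q0 submodule_zero[OF Q] bA QA in auto)
    next
      case (Suc i)
      then obtain r x' where ry: "r \<in> carrier K" "x' \<in> Q (Suc i)" "x = r \<odot>\<^bsub>A\<^esub> b [^]\<^bsub>A\<^esub> Suc i \<oplus>\<^bsub>A\<^esub> x'"
        using QSuc by blast
      obtain c y z where c: "c \<in> carrier K" "y \<in> Q i" "z \<in> p" "x' = c \<odot>\<^bsub>A\<^esub> \<one>\<^bsub>A\<^esub> \<oplus>\<^bsub>A\<^esub> (b \<otimes>\<^bsub>A\<^esub> y \<oplus>\<^bsub>A\<^esub> z)"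
        using Suc.IH[OF ry(2)] by blast
      let ?y = "r \<odot>\<^bsub>A\<^esub> b [^]\<^bsub>A\<^esub> i \<oplus>\<^bsub>A\<^esub> y"
      have y: "?y \<in> Q (Suc i)"
        using submoduleE(5)[OF Q submoduleE(4)[OF Q ry(1) QI]] c(2) mono[of i "Suc i"] by auto
      have cl: "y \<in> carrier A" "z \<in> carrier A" using c QA pA by auto
      have pw: "r \<odot>\<^bsub>A\<^esub> b [^]\<^bsub>A\<^esub> Suc i = b \<otimes>\<^bsub>A\<^esub> (r \<odot>\<^bsub>A\<^esub> b [^]\<^bsub>A\<^esub> i)"
        using ry(1) bA A.nat_pow_Suc2[OF bA, of i] by (simp add: smult_mult_right)
      have "x = c \<odot>\<^bsub>A\<^esub> \<one>\<^bsub>A\<^esub> \<oplus>\<^bsub>A\<^esub> (b \<otimes>\<^bsub>A\<^esub> ?y \<oplus>\<^bsub>A\<^esub> z)"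
        unfolding ry(3) c(4) pw using cl c(1) ry(1) bA by (simp add: A.r_distr M.a_ac)
      with c y show ?case by blast
    qed
    obtain c y z where c: "c \<in> carrier K" "y \<in> Q k" "z \<in> p"
      "b [^]\<^bsub>A\<^esub> Suc k = c \<odot>\<^bsub>A\<^esub> \<one>\<^bsub>A\<^esub> \<oplus>\<^bsub>A\<^esub> (b \<otimes>\<^bsub>A\<^esub> y \<oplus>\<^bsub>A\<^esub> z)" using split n unfolding k by blast
    have cl: "y \<in> carrier A" "z \<in> carrier A" using c QA pA by auto
    have bk: "b [^]\<^bsub>A\<^esub> Suc k = b \<otimes>\<^bsub>A\<^esub> b [^]\<^bsub>A\<^esub> k" by (rule A.nat_pow_Suc2[OF bA])
    \<comment> \<open>Without a constant term, \<open>b\<close> could be cancelled modulo the prime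
      \<open>p\<close>, which would put the \<open>k\<close>-th power of \<open>b\<close> into
      \<open>Q k\<close>, against minimality.\<close>
    have c0: "c \<noteq> \<zero>\<^bsub>K\<^esub>"
    proof
      assume "c = \<zero>\<^bsub>K\<^esub>"
      then have "b \<otimes>\<^bsub>A\<^esub> b [^]\<^bsub>A\<^esub> k = b \<otimes>\<^bsub>A\<^esub> y \<oplus>\<^bsub>A\<^esub> z" using c cl bk bA by simp
      then have "b \<otimes>\<^bsub>A\<^esub> (b [^]\<^bsub>A\<^esub> k \<ominus>\<^bsub>A\<^esub> y) = z"
        using cl bA by (simp add: M.minus_eq A.r_distr A.r_minus M.a_ac M.r_neg M.r_neg1 M.r_neg2)
      then have "b [^]\<^bsub>A\<^esub> k \<ominus>\<^bsub>A\<^esub> y \<in> p"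
        using p.I_prime[OF bA, of "b [^]\<^bsub>A\<^esub> k \<ominus>\<^bsub>A\<^esub> y"] c b cl bA by auto
      then have "(b [^]\<^bsub>A\<^esub> k \<ominus>\<^bsub>A\<^esub> y) \<oplus>\<^bsub>A\<^esub> y \<in> Q k" using submoduleE(5)[OF Q] c pQ by blast
      then show False using nk cl bA by (simp add: M.minus_eq M.a_assoc M.l_neg)
    qed
    \<comment> \<open>Every term other than the constant one is a multiple of
      \<open>b \<in> J\<close> or lies in \<open>p \<subseteq> J\<close>; so \<open>J\<close>
      contains a nonzero scalar, which is a unit.\<close>
    have "c \<odot>\<^bsub>A\<^esub> \<one>\<^bsub>A\<^esub> = b \<otimes>\<^bsub>A\<^esub> b [^]\<^bsub>A\<^esub> k \<ominus>\<^bsub>A\<^esub> (b \<otimes>\<^bsub>A\<^esub> y \<oplus>\<^bsub>A\<^esub> z)"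
      using c(4) unfolding bk using c(1) cl bA by (simp add: M.minus_eq M.a_assoc M.r_neg)
    also have "\<dots> \<in> J"
      using b J(2) c(3) cl bA unfolding M.minus_eq
      by (intro J.a_closed J.a_inv_closed J.I_r_closed) auto
    finally have cJ: "c \<odot>\<^bsub>A\<^esub> \<one>\<^bsub>A\<^esub> \<in> J" .
    have "inv\<^bsub>K\<^esub> c \<odot>\<^bsub>A\<^esub> (c \<odot>\<^bsub>A\<^esub> \<one>\<^bsub>A\<^esub>) \<in> J"
      using submoduleE(4)[OF ideal_submodule[OF J(1)] _ cJ] c c0 K.field_Units by auto
    moreover have "inv\<^bsub>K\<^esub> c \<odot>\<^bsub>A\<^esub> (c \<odot>\<^bsub>A\<^esub> \<one>\<^bsub>A\<^esub>) = \<one>\<^bsub>A\<^esub>"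
      using c c0 K.field_Units by (simp add: smult_assoc1[symmetric] smult_one)
    ultimately show "J = carrier A" using J.one_imp_carrier by simp
  qed
  then show "J = p \<or> J = carrier A" by blast
qed

section \<open>Weight spaces over a commutative ring\<close>

lemma (in cring) ideal_pow_ideal: "ideal I R \<Longrightarrow> ideal (ideal_pow R I N) R"
  by (induction N) (auto simp: oneideal ideal_prod_is_ideal)

lemma (in cring) ideal_pow_antimono:
  assumes "ideal I R" "i \<le> j" shows "ideal_pow R I j \<subseteq> ideal_pow R I i"
  using assms(2)
proof (rule lift_Suc_antimono_le[rotated])
  fix n show "ideal_pow R I (Suc n) \<subseteq> ideal_pow R I n"
    using ideal_prod_inter[OF assms(1) ideal_pow_ideal[OF assms(1), of n]] by auto
qed

lemma (in cring) ideal_pow_Suc_subset: "ideal I R \<Longrightarrow> ideal_pow R I (Suc N) \<subseteq> I"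
  using ideal_prod_inter[of I "ideal_pow R I N"] ideal_pow_ideal[of I N] by auto

lemma (in cring) pow_in_ideal_pow:
  assumes "ideal I R" "x \<in> I" shows "x [^] N \<in> ideal_pow R I (N::nat)"
proof (induction N)
  case (Suc N)
  have "x \<otimes> x [^] N \<in> ideal_prod R I (ideal_pow R I N)" by (rule ideal_prod.prod[OF assms(2) Suc])
  then show ?case using nat_pow_Suc2[of x N] ideal.Icarr[OF assms] by simp
qed simp

text \<open>The maximum condition: in a noetherian ring the union of a chain of ideals is a member
  of the chain, so Zorn's lemma applies to any family.\<close>

lemma (in noetherian_ring) ideal_family_maximal:
  assumes "\<S> \<noteq> {}" "\<And>I. I \<in> \<S> \<Longrightarrow> ideal I R"
  shows "\<exists>P\<in>\<S>. \<forall>I\<in>\<S>. P \<subseteq> I \<longrightarrow> I = P"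
proof (rule subset_Zorn_nonempty[OF assms(1)])
  fix C assume C: "C \<noteq> {}" "subset.chain \<S> C"
  then have "C \<subseteq> \<S>" by (simp add: subset_chain_def)
  then have "subset.chain {I. ideal I R} C" using C(2) assms(2) by (simp add: subset_chain_def subset_iff)
  then have "\<Union>C \<in> C" by (rule ideal_chain_is_trivial[OF C(1)])
  then show "\<Union>C \<in> \<S>" using \<open>C \<subseteq> \<S>\<close> by (rule subsetD[rotated])
qed

section \<open>Generalised weight spaces and their separation\<close>

context module
begin

lemma colon_ideal:
  assumes N: "submodule N R M" and u: "u \<in> carrier M"
  shows "ideal {r \<in> carrier R. r \<odot>\<^bsub>M\<^esub> u \<in> N} R"
proof -
  have "{r \<in> carrier R. r \<odot>\<^bsub>M\<^esub> u \<in> N} = {r \<in> carrier R. \<exists>y\<in>{\<zero>\<^bsub>M\<^esub>}. r \<odot>\<^bsub>M\<^esub> u \<oplus>\<^bsub>M\<^esub> y \<in> N}"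
    using u by auto
  then show ?thesis using coefficient_ideal[OF u N zero_submodule] by simp
qed

definition killed_by :: "'a set \<Rightarrow> 'c set" where
  "killed_by I = {v \<in> carrier M. \<forall>r\<in>I. r \<odot>\<^bsub>M\<^esub> v = \<zero>\<^bsub>M\<^esub>}"

lemma killed_by_submodule: "I \<subseteq> carrier R \<Longrightarrow> submodule (killed_by I) R M"
  unfolding killed_by_def
proof (rule submoduleI)
  fix a x assume I: "I \<subseteq> carrier R"
    and a: "a \<in> carrier R" and x: "x \<in> {v \<in> carrier M. \<forall>r\<in>I. r \<odot>\<^bsub>M\<^esub> v = \<zero>\<^bsub>M\<^esub>}"
  have "r \<odot>\<^bsub>M\<^esub> (a \<odot>\<^bsub>M\<^esub> x) = \<zero>\<^bsub>M\<^esub>" if "r \<in> I" for r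
  proof -
    have "r \<odot>\<^bsub>M\<^esub> (a \<odot>\<^bsub>M\<^esub> x) = a \<odot>\<^bsub>M\<^esub> (r \<odot>\<^bsub>M\<^esub> x)"
      using smult_assoc1[of r a x] smult_assoc1[of a r x] R.m_comm[of r a] that I a x by auto
    then show ?thesis using x a that by simp
  qed
  then show "a \<odot>\<^bsub>M\<^esub> x \<in> {v \<in> carrier M. \<forall>r\<in>I. r \<odot>\<^bsub>M\<^esub> v = \<zero>\<^bsub>M\<^esub>}" using a x by simp
qed (auto simp: smult_r_distr smult_r_minus subsetD)

text \<open>Powers of an ideal decrease, so being killed by one power is the same as being killed by
  all higher ones. The union is thus the eventual condition of \<open>weight_space\<close>, in a
  form that is easier to handle.\<close>

definition weight :: "'a set \<Rightarrow> 'c set" where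
  "weight n = (\<Union>N. killed_by (ideal_pow R n N))"

lemma killed_by_pow_mono:
  "ideal n R \<Longrightarrow> i \<le> j \<Longrightarrow> killed_by (ideal_pow R n i) \<subseteq> killed_by (ideal_pow R n j)"
  using R.ideal_pow_antimono[of n i j] unfolding killed_by_def by auto

lemma killed_by_pow_submodule: "ideal n R \<Longrightarrow> submodule (killed_by (ideal_pow R n N)) R M"
  by (rule killed_by_submodule[OF additive_subgroup.a_subset[OF ideal.axioms(1)[OF R.ideal_pow_ideal]]])

lemma weight_submodule:
  assumes n: "ideal n R" shows "submodule (weight n) R M"
proof (rule submoduleI)
  note sub = killed_by_pow_submodule[OF n]
  show "weight n \<subseteq> carrier M" using submoduleE(1)[OF sub] unfolding weight_def by blast
  show "\<zero>\<^bsub>M\<^esub> \<in> weight n" using submodule_zero[OF sub] unfolding weight_def by blast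
  show "\<ominus>\<^bsub>M\<^esub> a \<in> weight n" if "a \<in> weight n" for a
    using submoduleE(3)[OF sub] that unfolding weight_def by blast
  show "r \<odot>\<^bsub>M\<^esub> a \<in> weight n" if "r \<in> carrier R" "a \<in> weight n" for r a
    using submoduleE(4)[OF sub] that unfolding weight_def by blast
  fix a b assume "a \<in> weight n" "b \<in> weight n"
  then obtain i j where "a \<in> killed_by (ideal_pow R n i)" "b \<in> killed_by (ideal_pow R n j)"
    unfolding weight_def by blast
  then have "a \<in> killed_by (ideal_pow R n (max i j))" "b \<in> killed_by (ideal_pow R n (max i j))"
    using killed_by_pow_mono[OF n, of i "max i j"] killed_by_pow_mono[OF n, of j "max i j"] by auto
  then show "a \<oplus>\<^bsub>M\<^esub> b \<in> weight n" using submoduleE(5)[OF sub] unfolding weight_def by blast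
qed

text \<open>Elements of \<open>n\<close> act nilpotently on each vector of the weight space, because
  \<open>x [^] N\<close> lies in the \<open>N\<close>-th power of \<open>n\<close>. It serves for
  \<open>x = 1 - e\<close> with \<open>e\<close> congruent to 1 modulo \<open>n\<close>.\<close>

lemma weight_fixed_zero:
  assumes n: "ideal n R" and v: "v \<in> weight n" and x: "x \<in> n" "x \<odot>\<^bsub>M\<^esub> v = v"
  shows "v = \<zero>\<^bsub>M\<^esub>"
proof -
  obtain N where N: "v \<in> killed_by (ideal_pow R n N)" using v unfolding weight_def by blast
  have xR: "x \<in> carrier R" and vM: "v \<in> carrier M" using ideal.Icarr[OF n x(1)] N by (auto simp: killed_by_def)
  have "x [^] i \<odot>\<^bsub>M\<^esub> v = v" for i :: nat
    by (induction i) (use xR vM x in \<open>simp_all add: smult_one smult_assoc1\<close>)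
  then show ?thesis using N R.pow_in_ideal_pow[OF n x(1), of N] unfolding killed_by_def by force
qed

text \<open>Take \<open>x\<close> in \<open>n'\<close> but not in \<open>n\<close>. A high power of
  \<open>x\<close> kills \<open>v\<close>; it stays outside the prime ideal \<open>n\<close> and so
  has an inverse \<open>y\<close> modulo \<open>n\<close>. Then \<open>e\<close> is the product of
  \<open>y\<close> and that power. This plays the part of the Chinese remainder theorem.\<close>

lemma weight_separate:
  assumes n: "maximalideal n R" and n': "maximalideal n' R" "n' \<noteq> n" and v: "v \<in> weight n'"
  obtains e where "e \<in> carrier R" "e \<ominus> \<one> \<in> n" "e \<odot>\<^bsub>M\<^esub> v = \<zero>\<^bsub>M\<^esub>"
proof -
  interpret n: maximalideal n R by fact
  interpret n': maximalideal n' R by fact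
  interpret np: primeideal n R by (rule R.maximalideal_prime[OF n])
  have "\<not> n' \<subseteq> n"
    using n'.I_maximal[OF n.is_ideal] n.I_notcarr n' n.Icarr by blast
  then obtain x where x: "x \<in> n'" "x \<notin> n" by blast
  then have xR: "x \<in> carrier R" using n'.Icarr by blast
  obtain N where N: "v \<in> killed_by (ideal_pow R n' N)" using v unfolding weight_def by blast
  have "x [^] i \<notin> n" for i :: nat
  proof (induction i)
    case 0 then show ?case using n.I_notcarr n.one_imp_carrier by auto
  next
    case (Suc i) then show ?case using np.I_prime[of "x [^] i" x] x xR by auto
  qed
  then obtain y where y: "y \<in> carrier R" "y \<otimes> x [^] N \<ominus> \<one> \<in> n"
    using R.maximalideal_inverse_mod[OF n, of "x [^] N"] xR by blast
  have "x [^] N \<odot>\<^bsub>M\<^esub> v = \<zero>\<^bsub>M\<^esub>"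
    using N R.pow_in_ideal_pow[OF n'.is_ideal x(1), of N] unfolding killed_by_def by blast
  then have "(y \<otimes> x [^] N) \<odot>\<^bsub>M\<^esub> v = \<zero>\<^bsub>M\<^esub>" using y xR N by (simp add: smult_assoc1 killed_by_def)
  with y xR show thesis by (intro that[of "y \<otimes> x [^] N"]) auto
qed

lemma one_mod_mult:
  assumes "ideal n R" "e \<in> carrier R" "e' \<in> carrier R" "e \<ominus> \<one> \<in> n" "e' \<ominus> \<one> \<in> n"
  shows "e \<otimes> e' \<ominus> \<one> \<in> n"
proof -
  interpret n: ideal n R by fact
  have "e \<otimes> e' \<ominus> \<one> = e \<otimes> (e' \<ominus> \<one>) \<oplus> (e \<ominus> \<one>)"
    using assms by (simp add: R.minus_eq R.r_distr R.r_minus R.a_assoc R.r_neg2 R.l_neg R.r_neg1)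
  then show ?thesis using assms n.I_l_closed n.a_closed by simp
qed

text \<open>The vectors moved into \<open>weight n\<close> by some \<open>e\<close> congruent to 1
  modulo \<open>n\<close> form a submodule, since the elements belonging to two vectors can be
  multiplied. It contains \<open>weight n\<close>, with \<open>e = 1\<close>, and every other weight
  space by \<open>weight_separate\<close>.\<close>

lemma weight_sum_separate:
  assumes n: "maximalideal n R" and C: "\<And>i. i \<in> C \<Longrightarrow> maximalideal i R"
    and u: "u \<in> mspan R M (\<Union>i\<in>C. weight i)"
  obtains e where "e \<in> carrier R" "e \<ominus> \<one> \<in> n" "e \<odot>\<^bsub>M\<^esub> u \<in> weight n"
proof -
  interpret n: maximalideal n R by fact
  note W = weight_submodule[OF n.is_ideal]
  have Wi: "weight i \<subseteq> carrier M" if "i \<in> C" for i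
    using submoduleE(1)[OF weight_submodule[OF maximalideal.axioms(1)[OF C[OF that]]]] .
  let ?T = "{u \<in> carrier M. \<exists>e\<in>carrier R. e \<ominus> \<one> \<in> n \<and> e \<odot>\<^bsub>M\<^esub> u \<in> weight n}"
  have one: "\<one> \<ominus> \<one> \<in> n" by (simp add: R.minus_eq R.r_neg)
  have "submodule ?T R M"
  proof (rule submoduleI)
    fix x y assume "x \<in> ?T" "y \<in> ?T"
    then obtain e e' where e: "x \<in> carrier M" "y \<in> carrier M" "e \<in> carrier R" "e' \<in> carrier R"
      "e \<ominus> \<one> \<in> n" "e' \<ominus> \<one> \<in> n" "e \<odot>\<^bsub>M\<^esub> x \<in> weight n" "e' \<odot>\<^bsub>M\<^esub> y \<in> weight n" by blast
    have "(e \<otimes> e') \<odot>\<^bsub>M\<^esub> (x \<oplus>\<^bsub>M\<^esub> y) = e' \<odot>\<^bsub>M\<^esub> (e \<odot>\<^bsub>M\<^esub> x) \<oplus>\<^bsub>M\<^esub> e \<odot>\<^bsub>M\<^esub> (e' \<odot>\<^bsub>M\<^esub> y)"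
      using e by (simp add: smult_r_distr smult_assoc1[symmetric] R.m_comm)
    also have "\<dots> \<in> weight n" using e submoduleE(4,5)[OF W] by simp
    finally show "x \<oplus>\<^bsub>M\<^esub> y \<in> ?T"
      using one_mod_mult[OF n.is_ideal e(3-6)] e by auto
  next
    fix x assume "x \<in> ?T"
    then obtain e where e: "x \<in> carrier M" "e \<in> carrier R" "e \<ominus> \<one> \<in> n" "e \<odot>\<^bsub>M\<^esub> x \<in> weight n" by blast
    have "e \<odot>\<^bsub>M\<^esub> (\<ominus>\<^bsub>M\<^esub> x) \<in> weight n" using e submoduleE(3)[OF W e(4)] by (simp add: smult_r_minus)
    with e show "\<ominus>\<^bsub>M\<^esub> x \<in> ?T" by auto
    fix a assume a: "a \<in> carrier R"
    have "e \<odot>\<^bsub>M\<^esub> (a \<odot>\<^bsub>M\<^esub> x) = a \<odot>\<^bsub>M\<^esub> (e \<odot>\<^bsub>M\<^esub> x)"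
      using e a by (simp add: smult_assoc1[symmetric] R.m_comm)
    then have "e \<odot>\<^bsub>M\<^esub> (a \<odot>\<^bsub>M\<^esub> x) \<in> weight n" using e a submoduleE(4)[OF W a e(4)] by simp
    with e a show "a \<odot>\<^bsub>M\<^esub> x \<in> ?T" by auto
  next
    show "\<zero>\<^bsub>M\<^esub> \<in> ?T" using submodule_zero[OF W] one by (auto intro!: bexI[of _ \<one>])
  qed auto
  moreover have "weight i \<subseteq> ?T" if i: "i \<in> C" for i
  proof
    fix v assume v: "v \<in> weight i"
    show "v \<in> ?T"
    proof (cases "i = n")
      case True then show ?thesis using v Wi[OF i] one by (auto intro!: bexI[of _ \<one>] simp: smult_one subsetD)
    next
      case False
      then obtain e where "e \<in> carrier R" "e \<ominus> \<one> \<in> n" "e \<odot>\<^bsub>M\<^esub> v = \<zero>\<^bsub>M\<^esub>"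
        using weight_separate[OF n C[OF i] _ v] by blast
      then show ?thesis using v Wi[OF i] submodule_zero[OF W] by auto
    qed
  qed
  ultimately have "mspan R M (\<Union>i\<in>C. weight i) \<subseteq> ?T" by (intro mspan_least) auto
  with u that show thesis by blast
qed

text \<open>A product \<open>e\<close> of separating elements kills every summand except possibly
  \<open>w n\<close>, so applying it to the relation gives \<open>e w n = 0\<close>. Then
  \<open>1 - e \<in> n\<close> fixes \<open>w n\<close>, which must vanish.\<close>

lemma weight_sum_independent:
  assumes J: "finite J" "\<And>i. i \<in> J \<Longrightarrow> maximalideal i R" "\<And>i. i \<in> J \<Longrightarrow> w i \<in> weight i"
    and z: "(\<Oplus>\<^bsub>M\<^esub>i\<in>J. w i) = \<zero>\<^bsub>M\<^esub>" and n: "n \<in> J"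
  shows "w n = \<zero>\<^bsub>M\<^esub>"
proof -
  interpret n: maximalideal n R using J n by blast
  have wM: "w i \<in> carrier M" if "i \<in> J" for i
    using submoduleE(1)[OF weight_submodule[OF maximalideal.axioms(1)[OF J(2)[OF that]]]] J(3)[OF that] by blast
  have "\<exists>e\<in>carrier R. e \<ominus> \<one> \<in> n \<and> (\<forall>i\<in>J'. e \<odot>\<^bsub>M\<^esub> w i = \<zero>\<^bsub>M\<^esub>)" if "finite J'" "J' \<subseteq> J - {n}" for J'
    using that
  proof (induction J' rule: finite_induct)
    case empty
    have "\<one> \<ominus> \<one> \<in> n" by (simp add: R.minus_eq R.r_neg)
    then show ?case by auto
  next
    case (insert i J')
    then obtain e where e: "e \<in> carrier R" "e \<ominus> \<one> \<in> n" "\<forall>i\<in>J'. e \<odot>\<^bsub>M\<^esub> w i = \<zero>\<^bsub>M\<^esub>" by auto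
    obtain e' where e': "e' \<in> carrier R" "e' \<ominus> \<one> \<in> n" "e' \<odot>\<^bsub>M\<^esub> w i = \<zero>\<^bsub>M\<^esub>"
      using weight_separate[OF n.is_maximalideal J(2) _ J(3)] insert by blast
    have "(e \<otimes> e') \<odot>\<^bsub>M\<^esub> w j = \<zero>\<^bsub>M\<^esub>" if j: "j \<in> insert i J'" for j
    proof (cases "j = i")
      case True then show ?thesis using e e' wM insert by (simp add: smult_assoc1)
    next
      case False
      then have "(e' \<otimes> e) \<odot>\<^bsub>M\<^esub> w j = \<zero>\<^bsub>M\<^esub>" using j e e' wM[of j] insert by (auto simp: smult_assoc1)
      then show ?thesis using R.m_comm[OF e(1) e'(1)] by simp
    qed
    then show ?case using one_mod_mult[OF n.is_ideal e(1) e'(1) e(2) e'(2)] e e' by blast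
  qed
  from this[of "J - {n}"] J(1) obtain e
    where e: "e \<in> carrier R" "e \<ominus> \<one> \<in> n" "\<And>i. i \<in> J - {n} \<Longrightarrow> e \<odot>\<^bsub>M\<^esub> w i = \<zero>\<^bsub>M\<^esub>" by auto
  have "(\<Oplus>\<^bsub>M\<^esub>i\<in>J. e \<odot>\<^bsub>M\<^esub> w i) = \<zero>\<^bsub>M\<^esub>"
    using finsum_smult_ldistr[OF J(1) e(1), of w] wM z e(1) by auto
  moreover have "(\<Oplus>\<^bsub>M\<^esub>i\<in>J. e \<odot>\<^bsub>M\<^esub> w i) = e \<odot>\<^bsub>M\<^esub> w n \<oplus>\<^bsub>M\<^esub> (\<Oplus>\<^bsub>M\<^esub>i\<in>J-{n}. e \<odot>\<^bsub>M\<^esub> w i)"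
  proof -
    have "(\<Oplus>\<^bsub>M\<^esub>i\<in>insert n (J-{n}). e \<odot>\<^bsub>M\<^esub> w i) = e \<odot>\<^bsub>M\<^esub> w n \<oplus>\<^bsub>M\<^esub> (\<Oplus>\<^bsub>M\<^esub>i\<in>J-{n}. e \<odot>\<^bsub>M\<^esub> w i)"
      by (rule M.finsum_insert) (use J(1) n wM e in auto)
    then show ?thesis using n by (simp add: insert_absorb)
  qed
  moreover have "(\<Oplus>\<^bsub>M\<^esub>i\<in>J-{n}. e \<odot>\<^bsub>M\<^esub> w i) = \<zero>\<^bsub>M\<^esub>"
    using e(3) by (intro M.add.finprod_one_eqI) auto
  ultimately have ez: "e \<odot>\<^bsub>M\<^esub> w n = \<zero>\<^bsub>M\<^esub>" using e(1) wM[OF n] by simp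
  have "\<ominus> (e \<ominus> \<one>) \<odot>\<^bsub>M\<^esub> w n = w n"
    using ez e(1) wM[OF n] by (simp add: R.minus_eq smult_l_minus smult_l_distr smult_one)
  with weight_fixed_zero[OF n.is_ideal J(3)[OF n]] n.a_inv_closed[OF e(2)] show ?thesis by blast
qed

end

section \<open>The sum of all generalised weight spaces\<close>

lemma (in module) finsum_sets_submodule:
  assumes C: "\<And>i. i \<in> C \<Longrightarrow> submodule (W i) R M"
  shows "submodule {v. \<exists>J w. finite J \<and> J \<subseteq> C \<and> w \<in> Pi J W \<and> v = (\<Oplus>\<^bsub>M\<^esub>j\<in>J. w j)} R M"
    (is "submodule ?T R M")
proof (rule submoduleI)
  have WM: "W i \<subseteq> carrier M" if "i \<in> C" for i using submoduleE(1)[OF C[OF that]] .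
  have PiM: "w \<in> J \<rightarrow> carrier M" if "J \<subseteq> C" "w \<in> Pi J W" for w J using that WM by blast
  show "?T \<subseteq> carrier M" using PiM by auto
  show "\<zero>\<^bsub>M\<^esub> \<in> ?T" by (auto intro!: exI[of _ "{}"])
  fix x assume "x \<in> ?T"
  then obtain J w where x: "finite J" "J \<subseteq> C" "w \<in> Pi J W" "x = (\<Oplus>\<^bsub>M\<^esub>j\<in>J. w j)" by blast
  have smult: "a \<odot>\<^bsub>M\<^esub> x \<in> ?T" if a: "a \<in> carrier R" for a
  proof -
    have "a \<odot>\<^bsub>M\<^esub> x = (\<Oplus>\<^bsub>M\<^esub>j\<in>J. a \<odot>\<^bsub>M\<^esub> w j)" unfolding x(4)
      by (rule finsum_smult_ldistr[OF x(1) a PiM[OF x(2,3)]])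
    moreover have "(\<lambda>j. a \<odot>\<^bsub>M\<^esub> w j) \<in> Pi J W" using x submoduleE(4)[OF C] a by blast
    ultimately show ?thesis using x by blast
  qed
  then show "a \<odot>\<^bsub>M\<^esub> x \<in> ?T" if "a \<in> carrier R" for a using that .
  have "x \<in> carrier M" using x PiM by auto
  then show "\<ominus>\<^bsub>M\<^esub> x \<in> ?T" using smult[of "\<ominus> \<one>"] by (simp add: smult_l_minus smult_one)
  fix y assume "y \<in> ?T"
  then obtain J' w' where y: "finite J'" "J' \<subseteq> C" "w' \<in> Pi J' W" "y = (\<Oplus>\<^bsub>M\<^esub>j\<in>J'. w' j)" by blast
  \<comment> \<open>Both families are padded with zeros to the common index set
    \<open>J \<union> J'\<close>, so that they can be added term by term.\<close>
  let ?v = "\<lambda>j. if j \<in> J then w j else \<zero>\<^bsub>M\<^esub>" and ?v' = "\<lambda>j. if j \<in> J' then w' j else \<zero>\<^bsub>M\<^esub>"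
  have v: "?v j \<in> W j" "?v' j \<in> W j" if "j \<in> J \<union> J'" for j
    using that x y submodule_zero[OF C] by auto
  have vM: "?v \<in> J \<union> J' \<rightarrow> carrier M" "?v' \<in> J \<union> J' \<rightarrow> carrier M"
    using PiM[OF x(2,3)] PiM[OF y(2,3)] by auto
  have "x = (\<Oplus>\<^bsub>M\<^esub>j\<in>J \<union> J'. ?v j)" unfolding x(4)
    by (rule M.add.finprod_mono_neutral_cong_left[simplified]) (use x y PiM[OF x(2,3)] in auto)
  moreover have "y = (\<Oplus>\<^bsub>M\<^esub>j\<in>J \<union> J'. ?v' j)" unfolding y(4)
    by (rule M.add.finprod_mono_neutral_cong_left[simplified]) (use x y PiM[OF y(2,3)] in auto)
  ultimately have "x \<oplus>\<^bsub>M\<^esub> y = (\<Oplus>\<^bsub>M\<^esub>j\<in>J \<union> J'. ?v j \<oplus>\<^bsub>M\<^esub> ?v' j)"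
    using M.finsum_addf[OF vM] by simp
  moreover have "(\<lambda>j. ?v j \<oplus>\<^bsub>M\<^esub> ?v' j) \<in> Pi (J \<union> J') W"
  proof
    fix j assume j: "j \<in> J \<union> J'"
    then have "j \<in> C" using x y by blast
    then show "?v j \<oplus>\<^bsub>M\<^esub> ?v' j \<in> W j" by (rule submoduleE(5)[OF C v(1)[OF j] v(2)[OF j]])
  qed
  ultimately show "x \<oplus>\<^bsub>M\<^esub> y \<in> ?T" using x(1,2) y(1,2)
    by (intro CollectI exI[of _ "J \<union> J'"] exI[of _ "\<lambda>j. ?v j \<oplus>\<^bsub>M\<^esub> ?v' j"]) auto
qed

text \<open>If \<open>u\<close> were outside the sum \<open>T\<close> of the weight spaces with \<open>(T : u)\<close> maximal, then
  \<open>n = (T : u)\<close> is prime, hence maximal, and some \<open>e \<equiv> 1\<close> modulo \<open>n\<close> moves \<open>n u\<close>, and therefore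
  \<open>u\<close>, into the weight space of \<open>n\<close>; but \<open>(1 - e) u \<in> T\<close>.\<close>

lemma (in module) weight_spaces_span:
  assumes R: "noetherian_ring R"
    and C: "\<And>i. i \<in> C \<Longrightarrow> maximalideal i R"
    and max: "\<And>u p. u \<in> carrier M \<Longrightarrow> primeideal p R \<Longrightarrow>
      {r \<in> carrier R. r \<odot>\<^bsub>M\<^esub> u = \<zero>\<^bsub>M\<^esub>} \<subseteq> p \<Longrightarrow> p \<in> C"
  shows "carrier M \<subseteq> mspan R M (\<Union>i\<in>C. weight i)"
proof (rule ccontr)
  let ?T = "mspan R M (\<Union>i\<in>C. weight i)"
  assume neg: "\<not> carrier M \<subseteq> ?T"
  have W: "submodule (weight i) R M" if "i \<in> C" for i
    by (rule weight_submodule[OF maximalideal.axioms(1)[OF C[OF that]]])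
  have T: "submodule ?T R M" using submoduleE(1)[OF W] by (intro mspan_submodule) blast
  define colon where "colon u = {r \<in> carrier R. r \<odot>\<^bsub>M\<^esub> u \<in> ?T}" for u
  have colonI: "ideal (colon u) R" if "u \<in> carrier M" for u
    unfolding colon_def by (rule colon_ideal[OF T that])
  have ne: "colon ` (carrier M - ?T) \<noteq> {}" using neg by blast
  have idl: "ideal I R" if "I \<in> colon ` (carrier M - ?T)" for I using that colonI by blast
  have "\<exists>n\<in>colon ` (carrier M - ?T). \<forall>I\<in>colon ` (carrier M - ?T). n \<subseteq> I \<longrightarrow> I = n"
    by (rule noetherian_ring.ideal_family_maximal[OF R ne idl])
  then obtain n where n: "n \<in> colon ` (carrier M - ?T)"
    and nmax: "\<forall>I\<in>colon ` (carrier M - ?T). n \<subseteq> I \<longrightarrow> I = n" by (rule bexE)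
  from n obtain u where "n = colon u" "u \<in> carrier M - ?T" by (rule imageE)
  then have u: "u \<in> carrier M" "u \<notin> ?T" "n = colon u" by simp_all
  interpret n: ideal n R unfolding u(3) by (rule colonI[OF u(1)])
  have "primeideal n R"
  proof (rule primeidealI[OF n.is_ideal R.is_cring])
    have "\<one> \<notin> n" unfolding u(3) colon_def using u(1,2) by simp
    then show "carrier R \<noteq> n" by blast
    fix a b assume ab: "a \<in> carrier R" "b \<in> carrier R" "a \<otimes> b \<in> n"
    show "a \<in> n \<or> b \<in> n"
    proof (rule disjCI)
      assume "b \<notin> n"
      then have "b \<odot>\<^bsub>M\<^esub> u \<in> carrier M - ?T" unfolding u(3) colon_def using ab(2) u(1) by simp
      then have "colon (b \<odot>\<^bsub>M\<^esub> u) \<in> colon ` (carrier M - ?T)" by blast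
      \<comment> \<open>Maximality of \<open>n\<close> turns this inclusion into an equality, and
        \<open>a\<close> lies in the colon ideal of \<open>b u\<close> because
        \<open>a b \<in> n\<close>.\<close>
      moreover have "n \<subseteq> colon (b \<odot>\<^bsub>M\<^esub> u)"
      proof
        fix r assume r: "r \<in> n"
        then have rR: "r \<in> carrier R" "r \<odot>\<^bsub>M\<^esub> u \<in> ?T" unfolding u(3) colon_def by auto
        have "r \<odot>\<^bsub>M\<^esub> (b \<odot>\<^bsub>M\<^esub> u) = b \<odot>\<^bsub>M\<^esub> (r \<odot>\<^bsub>M\<^esub> u)"
          using smult_assoc1[of r b u] smult_assoc1[of b r u] R.m_comm[of r b] rR ab u by auto
        then show "r \<in> colon (b \<odot>\<^bsub>M\<^esub> u)" using rR submoduleE(4)[OF T ab(2) rR(2)] by (simp add: colon_def)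
      qed
      ultimately have "colon (b \<odot>\<^bsub>M\<^esub> u) = n" by (rule nmax[rule_format])
      moreover have "a \<odot>\<^bsub>M\<^esub> (b \<odot>\<^bsub>M\<^esub> u) \<in> ?T"
        using ab(3) smult_assoc1[OF ab(1,2) u(1)] unfolding u(3) colon_def by simp
      ultimately show "a \<in> n" using ab(1) unfolding colon_def by blast
    qed
  qed
  moreover have "{r \<in> carrier R. r \<odot>\<^bsub>M\<^esub> u = \<zero>\<^bsub>M\<^esub>} \<subseteq> n"
    unfolding u(3) colon_def using submodule_zero[OF T] by auto
  ultimately have nC: "n \<in> C" using max u by blast
  then interpret n: maximalideal n R using C by blast
  obtain B where B: "B \<subseteq> carrier R" "finite B" "n = Idl B"
    using noetherian_ring.finetely_gen[OF R n.is_ideal] by blast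
  have Bn: "B \<subseteq> n" using R.genideal_self[OF B(1)] B(3) by simp
  have kill: "submodule (killed_by (ideal_pow R n N)) R M" for N
    by (rule killed_by_pow_submodule[OF n.is_ideal])
  have comm: "r \<odot>\<^bsub>M\<^esub> (s \<odot>\<^bsub>M\<^esub> v) = s \<odot>\<^bsub>M\<^esub> (r \<odot>\<^bsub>M\<^esub> v)"
    if "r \<in> carrier R" "s \<in> carrier R" "v \<in> carrier M" for r s v
    using smult_assoc1[of r s v] smult_assoc1[of s r v] R.m_comm[of r s] that by auto
  \<comment> \<open>Each \<open>b u\<close> with \<open>b \<in> n\<close> lies in the span of the
    weight spaces and is moved into \<open>weight n\<close> by some element congruent to 1. As
    \<open>n\<close> is finitely generated, a product of these elements and a maximum of the
    exponents work for all generators at once.\<close>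
  have "\<exists>e\<in>carrier R. e \<ominus> \<one> \<in> n \<and> (\<exists>N. \<forall>b\<in>B. b \<odot>\<^bsub>M\<^esub> (e \<odot>\<^bsub>M\<^esub> u) \<in> killed_by (ideal_pow R n N))"
    using B(2) Bn
  proof (induction B rule: finite_induct)
    case empty
    have "\<one> \<ominus> \<one> \<in> n" by (simp add: R.minus_eq R.r_neg)
    then show ?case by (intro bexI[of _ \<one>]) auto
  next
    case (insert b B)
    then obtain e N where e: "e \<in> carrier R" "e \<ominus> \<one> \<in> n"
      "\<And>b. b \<in> B \<Longrightarrow> b \<odot>\<^bsub>M\<^esub> (e \<odot>\<^bsub>M\<^esub> u) \<in> killed_by (ideal_pow R n N)" by auto
    have b: "b \<in> carrier R" "b \<odot>\<^bsub>M\<^esub> u \<in> ?T" using insert(4) unfolding u(3) colon_def by auto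
    have BR: "B \<subseteq> carrier R" using insert n.Icarr by blast
    obtain e' where e': "e' \<in> carrier R" "e' \<ominus> \<one> \<in> n" "e' \<odot>\<^bsub>M\<^esub> (b \<odot>\<^bsub>M\<^esub> u) \<in> weight n"
      using weight_sum_separate[OF n.is_maximalideal C b(2)] by blast
    then obtain N' where N': "e' \<odot>\<^bsub>M\<^esub> (b \<odot>\<^bsub>M\<^esub> u) \<in> killed_by (ideal_pow R n N')"
      unfolding weight_def by blast
    let ?k = "killed_by (ideal_pow R n (max N N'))"
    have sub: "killed_by (ideal_pow R n N) \<subseteq> ?k" "killed_by (ideal_pow R n N') \<subseteq> ?k"
      by (intro killed_by_pow_mono[OF n.is_ideal]; simp)+
    have "c \<odot>\<^bsub>M\<^esub> ((e \<otimes> e') \<odot>\<^bsub>M\<^esub> u) \<in> ?k" if c: "c \<in> insert b B" for c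
    proof (cases "c = b")
      case True
      have "c \<odot>\<^bsub>M\<^esub> ((e \<otimes> e') \<odot>\<^bsub>M\<^esub> u) = e \<odot>\<^bsub>M\<^esub> (e' \<odot>\<^bsub>M\<^esub> (b \<odot>\<^bsub>M\<^esub> u))"
        using comm[of b "e \<otimes> e'" u] b(1) e(1) e'(1) u(1) True by (simp add: smult_assoc1)
      then show ?thesis using submoduleE(4)[OF kill e(1)] N' sub by auto
    next
      case False
      then have c: "c \<in> B" "c \<in> carrier R" using that BR by auto
      have "c \<odot>\<^bsub>M\<^esub> ((e \<otimes> e') \<odot>\<^bsub>M\<^esub> u) = c \<odot>\<^bsub>M\<^esub> (e' \<odot>\<^bsub>M\<^esub> (e \<odot>\<^bsub>M\<^esub> u))"
        using comm[of e e' u] e(1) e'(1) u(1) by (simp add: smult_assoc1)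
      also have "\<dots> = e' \<odot>\<^bsub>M\<^esub> (c \<odot>\<^bsub>M\<^esub> (e \<odot>\<^bsub>M\<^esub> u))" using comm c e(1) e'(1) u(1) by simp
      finally show ?thesis using submoduleE(4)[OF kill e'(1) e(3)[OF c(1)]] sub by auto
    qed
    then show ?case using one_mod_mult[OF n.is_ideal e(1) e'(1) e(2) e'(2)] e(1) e'(1) by blast
  qed
  then obtain e N where e: "e \<in> carrier R" "e \<ominus> \<one> \<in> n"
    "\<And>b. b \<in> B \<Longrightarrow> b \<odot>\<^bsub>M\<^esub> (e \<odot>\<^bsub>M\<^esub> u) \<in> killed_by (ideal_pow R n N)" by blast
  let ?u = "e \<odot>\<^bsub>M\<^esub> u"
  have uM: "?u \<in> carrier M" using e u by simp
  \<comment> \<open>The scalars sending \<open>?u\<close> into a fixed submodule form an ideal, so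
    the property passes from the generators \<open>B\<close> to all of \<open>n\<close>. One further
    factor from \<open>n\<close> then kills \<open>?u\<close>, whence the exponent
    \<open>Suc N\<close>.\<close>
  have nu: "r \<odot>\<^bsub>M\<^esub> ?u \<in> killed_by (ideal_pow R n N)" if "r \<in> n" for r
    using R.genideal_minimal[OF colon_ideal[OF kill uM], of B N] e(3) B that by blast
  have "s \<odot>\<^bsub>M\<^esub> ?u = \<zero>\<^bsub>M\<^esub>" if "s \<in> ideal_prod R n (ideal_pow R n N)" for s
    using that
  proof induction
    case (prod i j)
    then have "j \<in> carrier R" "i \<in> carrier R"
      using ideal.Icarr[OF R.ideal_pow_ideal[OF n.is_ideal]] n.Icarr by auto
    then show ?case using nu[OF prod(1)] prod(2) comm[of i j ?u] uM
      by (simp add: smult_assoc1 killed_by_def)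
  next
    case (sum s t)
    have "s \<in> carrier R" "t \<in> carrier R"
      using sum ideal.Icarr[OF R.ideal_prod_is_ideal[OF n.is_ideal R.ideal_pow_ideal[OF n.is_ideal]]] by auto
    then show ?case using sum.IH uM by (simp add: smult_l_distr)
  qed
  then have "?u \<in> killed_by (ideal_pow R n (Suc N))" using uM by (simp add: killed_by_def)
  then have "?u \<in> ?T" using mspan_superset[of "\<Union>i\<in>C. weight i"] nC unfolding weight_def by blast
  moreover have "(e \<ominus> \<one>) \<odot>\<^bsub>M\<^esub> u \<in> ?T" using e(2) unfolding u(3) colon_def by blast
  ultimately have "?u \<ominus>\<^bsub>M\<^esub> (e \<ominus> \<one>) \<odot>\<^bsub>M\<^esub> u \<in> ?T" by (rule submodule_diff[OF T])
  moreover have "?u \<ominus>\<^bsub>M\<^esub> (e \<ominus> \<one>) \<odot>\<^bsub>M\<^esub> u = u"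
  proof -
    have "(e \<ominus> \<one>) \<odot>\<^bsub>M\<^esub> u = ?u \<ominus>\<^bsub>M\<^esub> u"
      using e(1) u by (simp add: R.minus_eq M.minus_eq smult_l_distr smult_l_minus smult_one)
    then show ?thesis using u uM by (simp add: M.minus_eq M.minus_add M.r_neg1 M.r_neg2)
  qed
  ultimately show False using u by simp
qed

text \<open>The assumption \<open>fc\<close> says that every cyclic submodule is finite-dimensional.
  A prime ideal above the annihilator of a vector then has finite codimension and is maximal, which
  is the condition under which the weight spaces span.\<close>

lemma finite_dimensional_weight_decomposition:
  fixes R :: "('k, 'r) module" and V :: "('r, 'v) module"
  assumes "k_algebra K R" and "module R V" and "noetherian_ring R"
    and fc: "\<And>u. u \<in> carrier V \<Longrightarrow> finite_codim K R {r \<in> carrier R. r \<odot>\<^bsub>V\<^esub> u = \<zero>\<^bsub>V\<^esub>}"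
  shows "internal_direct_sum V (cofinite_maximal_ideals K R) (weight_space R (\<lambda>r. r) V)"
proof -
  interpret K: k_algebra K R by fact
  interpret V: module R V by fact
  let ?C = "cofinite_maximal_ideals K R"
  have C: "maximalideal n R" if "n \<in> ?C" for n using that by (simp add: cofinite_maximal_ideals_def)
  have W: "weight_space R (\<lambda>r. r) V n = V.weight n" if n: "n \<in> ?C" for n
  proof -
    have "ideal n R" by (rule maximalideal.axioms(1)[OF C[OF n]])
    then have mono: "v \<in> V.killed_by (ideal_pow R n N')"
      if "v \<in> V.killed_by (ideal_pow R n N)" "N \<le> N'" for v N N'
      using V.killed_by_pow_mono that by blast
    have iff: "v \<in> weight_space R (\<lambda>r. r) V n \<longleftrightarrow>
        (\<exists>N. \<forall>N'\<ge>N. v \<in> V.killed_by (ideal_pow R n N'))" for v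
      unfolding weight_space_def V.killed_by_def by auto
    show ?thesis
    proof (intro equalityI subsetI)
      fix v assume "v \<in> weight_space R (\<lambda>r. r) V n"
      then obtain N where "\<forall>N'\<ge>N. v \<in> V.killed_by (ideal_pow R n N')" unfolding iff by (rule exE)
      then have "v \<in> V.killed_by (ideal_pow R n N)" by simp
      then show "v \<in> V.weight n" unfolding V.weight_def by (rule UN_I[OF UNIV_I])
    next
      fix v assume "v \<in> V.weight n"
      then obtain N where "v \<in> V.killed_by (ideal_pow R n N)" unfolding V.weight_def by (rule UN_E)
      then have "\<forall>N'\<ge>N. v \<in> V.killed_by (ideal_pow R n N')" using mono by simp
      then show "v \<in> weight_space R (\<lambda>r. r) V n" unfolding iff by (rule exI)
    qed
  qed
  have sub: "submodule (V.weight n) R V" if "n \<in> ?C" for n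
    by (rule V.weight_submodule[OF maximalideal.axioms(1)[OF C[OF that]]])
  have "p \<in> ?C" if "u \<in> carrier V" "primeideal p R" "{r \<in> carrier R. r \<odot>\<^bsub>V\<^esub> u = \<zero>\<^bsub>V\<^esub>} \<subseteq> p" for u p
  proof -
    have "p \<subseteq> carrier R" using that(2) by (auto simp: primeideal_def intro: ideal.Icarr)
    then have "finite_codim K R p" using K.finite_codim_mono[OF fc[OF that(1)] that(3)] by blast
    then show ?thesis using K.finite_codim_prime_maximal[OF that(2)] by (simp add: cofinite_maximal_ideals_def)
  qed
  then have span: "carrier V \<subseteq> mspan R V (\<Union>i\<in>?C. V.weight i)"
    using V.weight_spaces_span[OF assms(3), of ?C] C by blast
  let ?S = "{v. \<exists>J w. finite J \<and> J \<subseteq> ?C \<and> w \<in> Pi J V.weight \<and> v = (\<Oplus>\<^bsub>V\<^esub>j\<in>J. w j)}"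
  have "V.weight i \<subseteq> ?S" if i: "i \<in> ?C" for i
  proof
    fix v assume v: "v \<in> V.weight i"
    then have "v \<in> carrier V" using V.submoduleE(1)[OF sub[OF i]] by blast
    then show "v \<in> ?S" using v i by (intro CollectI exI[of _ "{i}"] exI[of _ "\<lambda>_. v"]) auto
  qed
  then have "mspan R V (\<Union>i\<in>?C. V.weight i) \<subseteq> ?S"
    by (intro V.mspan_least V.finsum_sets_submodule sub) auto
  then have 1: "v \<in> ?S" if "v \<in> carrier V" for v using span that by blast
  have PiW: "Pi J (weight_space R (\<lambda>r. r) V) = Pi J V.weight" if "J \<subseteq> ?C" for J
    using that W by (auto simp: Pi_def)
  show ?thesis unfolding internal_direct_sum_def
  proof (intro conjI ballI allI impI)
    fix v assume "v \<in> carrier V"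
    then obtain J w where "finite J" "J \<subseteq> ?C" "w \<in> Pi J V.weight" "v = (\<Oplus>\<^bsub>V\<^esub>j\<in>J. w j)"
      using 1[of v] by auto
    then show "\<exists>J w. finite J \<and> J \<subseteq> ?C \<and> w \<in> Pi J (weight_space R (\<lambda>r. r) V) \<and> v = (\<Oplus>\<^bsub>V\<^esub>j\<in>J. w j)"
      using PiW[of J] by (intro exI[of _ J] exI[of _ w]) simp
  next
    fix J w j assume a: "finite J \<and> J \<subseteq> ?C \<and> w \<in> Pi J (weight_space R (\<lambda>r. r) V) \<and> (\<Oplus>\<^bsub>V\<^esub>j\<in>J. w j) = \<zero>\<^bsub>V\<^esub>"
      and j: "j \<in> J"
    show "w j = \<zero>\<^bsub>V\<^esub>"
      by (rule V.weight_sum_independent[of J]) (use a j C PiW[of J] in auto)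
  qed
qed

section \<open>Maximal right ideals and simple quotients\<close>

lemma right_idealD:
  assumes "ring R" "right_ideal J R"
  shows "J \<subseteq> carrier R" "\<zero>\<^bsub>R\<^esub> \<in> J"
    and "\<And>x y. x \<in> J \<Longrightarrow> y \<in> J \<Longrightarrow> x \<oplus>\<^bsub>R\<^esub> y \<in> J"
    and "\<And>x. x \<in> J \<Longrightarrow> \<ominus>\<^bsub>R\<^esub> x \<in> J"
    and "\<And>x a. x \<in> J \<Longrightarrow> a \<in> carrier R \<Longrightarrow> x \<otimes>\<^bsub>R\<^esub> a \<in> J"
proof -
  interpret ring R by fact
  interpret J: additive_subgroup J R using assms(2) by (simp add: right_ideal_def)
  show "J \<subseteq> carrier R" "\<zero>\<^bsub>R\<^esub> \<in> J" by (rule J.a_subset, rule J.zero_closed)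
  show "x \<oplus>\<^bsub>R\<^esub> y \<in> J" if "x \<in> J" "y \<in> J" for x y using that by simp
  show "\<ominus>\<^bsub>R\<^esub> x \<in> J" if "x \<in> J" for x using that by simp
  show "x \<otimes>\<^bsub>R\<^esub> a \<in> J" if "x \<in> J" "a \<in> carrier R" for x a using assms(2) that by (simp add: right_ideal_def)
qed

lemma (in ring) right_idealI:
  assumes sub: "J \<subseteq> carrier R" and zero: "\<zero> \<in> J"
    and add: "\<And>x y. x \<in> J \<Longrightarrow> y \<in> J \<Longrightarrow> x \<oplus> y \<in> J"
    and mult: "\<And>x a. x \<in> J \<Longrightarrow> a \<in> carrier R \<Longrightarrow> x \<otimes> a \<in> J"
  shows "right_ideal J R"
proof -
  have "subgroup J (add_monoid R)"
  proof (rule add.subgroupI)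
    fix x assume x: "x \<in> J"
    then have "\<ominus> x = x \<otimes> (\<ominus> \<one>)" using sub by (simp add: r_minus subsetD)
    then show "\<ominus> x \<in> J" using mult[OF x, of "\<ominus> \<one>"] by simp
  qed (use sub zero add in auto)
  then show ?thesis using mult by (simp add: right_ideal_def additive_subgroup_def)
qed

text \<open>Properness is expressed as avoiding \<open>1\<close>, a condition inherited by unions of
  chains; Zorn's lemma is applied to such right ideals above \<open>I\<close>.\<close>

lemma (in ring) maximal_right_ideal_exists:
  assumes I: "right_ideal I R" and one: "\<one> \<notin> I"
  shows "\<exists>J. maximal_right_ideal J R \<and> I \<subseteq> J"
proof -
  let ?S = "{J. right_ideal J R \<and> I \<subseteq> J \<and> \<one> \<notin> J}"
  note D = right_idealD[OF ring_axioms]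
  have "\<exists>J\<in>?S. \<forall>X\<in>?S. J \<subseteq> X \<longrightarrow> X = J"
  proof (rule subset_Zorn_nonempty)
    show "?S \<noteq> {}" using I one by blast
    fix C assume C: "C \<noteq> {}" "subset.chain ?S C"
    then have CS: "right_ideal X R" "I \<subseteq> X" "\<one> \<notin> X" if "X \<in> C" for X
      using that by (auto simp: subset_chain_def)
    have "right_ideal (\<Union>C) R"
    proof (rule right_idealI)
      show "\<Union>C \<subseteq> carrier R" using D(1)[OF CS(1)] by blast
      show "\<zero> \<in> \<Union>C" using D(2)[OF CS(1)] C(1) by blast
      show "x \<otimes> a \<in> \<Union>C" if "x \<in> \<Union>C" "a \<in> carrier R" for x a using D(5)[OF CS(1)] that by blast
      fix x y assume "x \<in> \<Union>C" "y \<in> \<Union>C"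
      then obtain X Y where XY: "X \<in> C" "Y \<in> C" "x \<in> X" "y \<in> Y" by blast
      then have "X \<subseteq> Y \<or> Y \<subseteq> X" using C(2) by (simp add: subset_chain_def)
      then obtain Z where "Z \<in> C" "x \<in> Z" "y \<in> Z" using XY by blast
      then show "x \<oplus> y \<in> \<Union>C" using D(3)[OF CS(1)] by blast
    qed
    moreover have "I \<subseteq> \<Union>C" using CS(2) C(1) by blast
    ultimately show "\<Union>C \<in> ?S" using CS(3) by auto
  qed
  then obtain J where J: "right_ideal J R" "I \<subseteq> J" "\<one> \<notin> J"
    and max: "\<And>X. right_ideal X R \<Longrightarrow> I \<subseteq> X \<Longrightarrow> \<one> \<notin> X \<Longrightarrow> J \<subseteq> X \<Longrightarrow> X = J" by auto
  have "X = J \<or> X = carrier R" if X: "right_ideal X R" "J \<subseteq> X" for X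
  proof (cases "\<one> \<in> X")
    case True
    have "a \<in> X" if "a \<in> carrier R" for a using D(5)[OF X(1) True that] that by simp
    then show ?thesis using D(1)[OF X(1)] by blast
  next
    case False then show ?thesis using max[OF X(1)] X(2) J(2) by simp
  qed
  then have "maximal_right_ideal J R" using J one_closed unfolding maximal_right_ideal_def by auto
  then show ?thesis using J(2) by blast
qed

section \<open>Opposite rings and quotients by right ideals\<close>

lemma opposite_simps [simp]:
  "carrier (opposite A) = carrier A" "zero (opposite A) = zero A" "add (opposite A) = add A"
  "one (opposite A) = one A" "x \<otimes>\<^bsub>opposite A\<^esub> y = y \<otimes>\<^bsub>A\<^esub> x"
  by (simp_all add: opposite_def)

lemma opposite_ring:
  assumes "ring A" shows "ring (opposite A)"
proof -
  interpret A: ring A by fact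
  show ?thesis
  proof (rule ringI)
    show "abelian_group (opposite A)"
    proof (rule abelian_groupI)
      fix x assume "x \<in> carrier (opposite A)"
      then show "\<exists>y\<in>carrier (opposite A). y \<oplus>\<^bsub>opposite A\<^esub> x = \<zero>\<^bsub>opposite A\<^esub>"
        by (intro bexI[of _ "\<ominus>\<^bsub>A\<^esub> x"]) (auto simp: A.l_neg)
    qed (auto simp: A.a_ac)
    show "monoid (opposite A)" by (rule monoidI) (auto simp: A.m_assoc)
  qed (auto simp: A.l_distr A.r_distr)
qed

text \<open>\<open>A / J\<close> for a right ideal \<open>J\<close>, as a left module over the opposite ring; \<open>mult\<close> and \<open>one\<close>
  are dummies required by the record type.\<close>

definition right_quotient :: "('a, 'n) ring_scheme \<Rightarrow> 'a set \<Rightarrow> ('a, 'a set) module" where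
  "right_quotient A J =
     \<lparr>carrier = a_rcosets\<^bsub>A\<^esub> J, mult = (\<lambda>C D. J), one = J, zero = J, add = set_add A,
      smult = (\<lambda>a C. \<Union>x\<in>C. J +>\<^bsub>A\<^esub> (x \<otimes>\<^bsub>A\<^esub> a))\<rparr>"

lemma (in ring) right_quotient_simps:
  assumes J: "right_ideal J R"
  shows "carrier (right_quotient R J) = {J +> x | x. x \<in> carrier R}"
    and "\<zero>\<^bsub>right_quotient R J\<^esub> = J"
    and "\<And>x y. x \<in> carrier R \<Longrightarrow> y \<in> carrier R \<Longrightarrow>
      (J +> x) \<oplus>\<^bsub>right_quotient R J\<^esub> (J +> y) = J +> (x \<oplus> y)"
    and "\<And>a x. a \<in> carrier R \<Longrightarrow> x \<in> carrier R \<Longrightarrow>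
      a \<odot>\<^bsub>right_quotient R J\<^esub> (J +> x) = J +> (x \<otimes> a)"
    and "\<And>x. x \<in> carrier R \<Longrightarrow> J +> x = J \<longleftrightarrow> x \<in> J"
proof -
  note D = right_idealD[OF ring_axioms J]
  interpret J: abelian_subgroup J R
    using J by (intro abelian_subgroupI3 is_abelian_group) (simp add: right_ideal_def)
  show "carrier (right_quotient R J) = {J +> x | x. x \<in> carrier R}"
    by (auto simp: right_quotient_def A_RCOSETS_def')
  show "\<zero>\<^bsub>right_quotient R J\<^esub> = J" by (simp add: right_quotient_def)
  show "(J +> x) \<oplus>\<^bsub>right_quotient R J\<^esub> (J +> y) = J +> (x \<oplus> y)"
    if "x \<in> carrier R" "y \<in> carrier R" for x y
    using that by (simp add: right_quotient_def J.a_rcos_sum)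
  show eqJ: "J +> x = J \<longleftrightarrow> x \<in> J" if "x \<in> carrier R" for x
    using that a_coset_join1[of J x] a_coset_join2[of x J] J.a_subgroup by blast
  show "a \<odot>\<^bsub>right_quotient R J\<^esub> (J +> x) = J +> (x \<otimes> a)"
    if a: "a \<in> carrier R" and x: "x \<in> carrier R" for a x
  proof -
    \<comment> \<open>Independence of the representative is where \<open>J\<close> must absorb
      multiplication from the right.\<close>
    have "J +> (y \<otimes> a) = J +> (x \<otimes> a)" if y: "y \<in> J +> x" for y
    proof -
      obtain j where j: "j \<in> J" "y = j \<oplus> x" using y by (auto simp: a_r_coset_def')
      have jR: "j \<in> carrier R" using j D(1) by blast
      have "y \<otimes> a = j \<otimes> a \<oplus> x \<otimes> a" using j jR x a by (simp add: l_distr)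
      then have "y \<otimes> a \<in> J +> (x \<otimes> a)" using D(5)[OF j(1) a] by (auto simp: a_r_coset_def')
      then show ?thesis using a_repr_independence[of "y \<otimes> a" J "x \<otimes> a"] J.a_subgroup x a by simp
    qed
    moreover have "x \<in> J +> x" by (rule J.a_rcos_self[OF x])
    ultimately have "(\<Union>y\<in>J +> x. J +> (y \<otimes> a)) = J +> (x \<otimes> a)" by blast
    then show ?thesis by (simp add: right_quotient_def)
  qed
qed

lemma right_quotient_left_module:
  fixes A :: "('k, 'a) module"
  assumes "ring A" and J: "right_ideal J A"
  shows "left_module (opposite A) (right_quotient A J)"
proof -
  interpret A: ring A by fact
  interpret op: ring "opposite A" by (rule opposite_ring[OF assms(1)])
  note Q = A.right_quotient_simps[OF J]
  note D = right_idealD[OF assms(1) J]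
  have J0: "J +>\<^bsub>A\<^esub> \<zero>\<^bsub>A\<^esub> = J" using Q(5)[OF A.zero_closed] D(2) by simp
  have "abelian_group (right_quotient A J)"
  proof (rule abelian_groupI)
    show "\<zero>\<^bsub>right_quotient A J\<^esub> \<in> carrier (right_quotient A J)" using J0[symmetric] A.zero_closed unfolding Q(1,2) by blast
    fix C assume C: "C \<in> carrier (right_quotient A J)"
    then obtain x where x: "x \<in> carrier A" "C = J +>\<^bsub>A\<^esub> x" unfolding Q(1) by blast
    have "(J +>\<^bsub>A\<^esub> \<zero>\<^bsub>A\<^esub>) \<oplus>\<^bsub>right_quotient A J\<^esub> C = C" using x by (simp add: Q(3))
    then show "\<zero>\<^bsub>right_quotient A J\<^esub> \<oplus>\<^bsub>right_quotient A J\<^esub> C = C" unfolding Q(2) J0 .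
    have "(J +>\<^bsub>A\<^esub> (\<ominus>\<^bsub>A\<^esub> x)) \<oplus>\<^bsub>right_quotient A J\<^esub> C = \<zero>\<^bsub>right_quotient A J\<^esub>"
      using x by (simp add: Q(2,3) A.l_neg J0)
    then show "\<exists>y\<in>carrier (right_quotient A J). y \<oplus>\<^bsub>right_quotient A J\<^esub> C = \<zero>\<^bsub>right_quotient A J\<^esub>"
      using x A.a_inv_closed unfolding Q(1) by blast
  qed (auto simp: Q(1,3) A.a_ac)
  then show ?thesis unfolding left_module_def left_module_axioms_def
    using op.ring_axioms by (auto simp: Q(1,3,4) A.l_distr A.r_distr A.m_assoc)
qed

text \<open>The preimage in \<open>A\<close> of a submodule is a right ideal above \<open>J\<close>,
  hence \<open>J\<close> or \<open>A\<close>; it determines the submodule.\<close>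

lemma right_quotient_simple:
  fixes A :: "('k, 'a) module"
  assumes "ring A" and J: "maximal_right_ideal J A"
  shows "simple_module (opposite A) (right_quotient A J)"
proof -
  interpret A: ring A by fact
  have Jr: "right_ideal J A" and ne: "J \<noteq> carrier A"
    and max: "\<And>I. right_ideal I A \<Longrightarrow> J \<subseteq> I \<Longrightarrow> I = J \<or> I = carrier A"
    using J unfolding maximal_right_ideal_def by auto
  note Q = A.right_quotient_simps[OF Jr]
  note D = right_idealD[OF assms(1) Jr]
  have lm: "left_module (opposite A) (right_quotient A J)" by (rule right_quotient_left_module[OF assms(1) Jr])
  obtain x where x: "x \<in> carrier A" "x \<notin> J" using ne D(1) by blast
  then have "J +>\<^bsub>A\<^esub> x \<in> carrier (right_quotient A J)" "J +>\<^bsub>A\<^esub> x \<noteq> J" unfolding Q(1) Q(5)[OF x(1)] by auto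
  then have nz: "carrier (right_quotient A J) \<noteq> {\<zero>\<^bsub>right_quotient A J\<^esub>}" unfolding Q(2) by auto
  have "N = {\<zero>\<^bsub>right_quotient A J\<^esub>} \<or> N = carrier (right_quotient A J)"
    if N: "submodule N (opposite A) (right_quotient A J)" for N
  proof -
    interpret N: submodule N "opposite A" "right_quotient A J" by fact
    have NQ: "N \<subseteq> carrier (right_quotient A J)" using N.subset by simp
    have Nz: "J \<in> N" using N.one_closed by (simp add: Q(2))
    have Na: "(J +>\<^bsub>A\<^esub> x) \<in> N \<Longrightarrow> (J +>\<^bsub>A\<^esub> y) \<in> N \<Longrightarrow> J +>\<^bsub>A\<^esub> (x \<oplus>\<^bsub>A\<^esub> y) \<in> N"
      if "x \<in> carrier A" "y \<in> carrier A" for x y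
      using N.m_closed[of "J +>\<^bsub>A\<^esub> x" "J +>\<^bsub>A\<^esub> y"] Q(3)[OF that] by simp
    have Ns: "(J +>\<^bsub>A\<^esub> x) \<in> N \<Longrightarrow> J +>\<^bsub>A\<^esub> (x \<otimes>\<^bsub>A\<^esub> a) \<in> N" if "a \<in> carrier A" "x \<in> carrier A" for a x
      using N.smult_closed[of a "J +>\<^bsub>A\<^esub> x"] Q(4)[OF that] that by simp
    let ?I = "{x \<in> carrier A. J +>\<^bsub>A\<^esub> x \<in> N}"
    have JN: "J +>\<^bsub>A\<^esub> x \<in> N" if "x \<in> J" for x
    proof -
      have "J +>\<^bsub>A\<^esub> x = J" using Q(5)[of x] D(1) that by blast
      then show ?thesis using Nz by simp
    qed
    have "right_ideal ?I A"
      by (rule A.right_idealI) (use Na Ns JN D(2) in auto)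
    moreover have "J \<subseteq> ?I" using D(1) JN by auto
    ultimately consider "?I = J" | "?I = carrier A" using max by blast
    then show ?thesis
    proof cases
      case 1
      have "N \<subseteq> {J}"
      proof
        fix C assume C: "C \<in> N"
        obtain x where x: "x \<in> carrier A" "C = J +>\<^bsub>A\<^esub> x" using C NQ unfolding Q(1) by blast
        then have "x \<in> ?I" using C by simp
        then show "C \<in> {J}" using 1 Q(5)[OF x(1)] x by simp
      qed
      then have "N = {J}" using Nz by blast
      then show ?thesis unfolding Q(2) by (rule disjI1)
    next
      case 2
      then have "carrier (right_quotient A J) \<subseteq> N" unfolding Q(1) by auto
      then have "N = carrier (right_quotient A J)" by (rule equalityI[OF NQ])
      then show ?thesis by (rule disjI2)
    qed
  qed
  with lm nz show ?thesis unfolding simple_module_def by blast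
qed

section \<open>Tensor products and finite codimension\<close>

lemma tensor_simps:
  "carrier (tensor K A B) = carrier (tensor_space K A B)" "zero (tensor K A B) = zero (tensor_space K A B)"
  "add (tensor K A B) = add (tensor_space K A B)" "smult (tensor K A B) = smult (tensor_space K A B)"
  by (simp_all add: tensor_def Let_def)

text \<open>Each tensor is the class of a finitely supported function, and the induction removes one
  point of the support at a time.\<close>

lemma tensor_space_induct [consumes 4, case_names pure add smult]:
  assumes K: "field K" and V: "module K V" and W: "module K W" and t: "t \<in> carrier (tensor_space K V W)"
    and pure: "\<And>v w. v \<in> carrier V \<Longrightarrow> w \<in> carrier W \<Longrightarrow> P (pure_tensor K V W v w)"
    and add: "\<And>s t. s \<in> carrier (tensor_space K V W) \<Longrightarrow> t \<in> carrier (tensor_space K V W) \<Longrightarrow>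
      P s \<Longrightarrow> P t \<Longrightarrow> P (s \<oplus>\<^bsub>tensor_space K V W\<^esub> t)"
    and smult: "\<And>c s. c \<in> carrier K \<Longrightarrow> s \<in> carrier (tensor_space K V W) \<Longrightarrow>
      P s \<Longrightarrow> P (c \<odot>\<^bsub>tensor_space K V W\<^esub> s)"
  shows "P t"
proof -
  interpret K: field K by fact
  interpret V: module K V by fact
  interpret W: module K W by fact
  let ?X = "carrier V \<times> carrier W"
  let ?E = "free_space K ?X"
  let ?N = "tensor_null K V W"
  interpret E: module K ?E by (rule free_space_module[OF K])
  have e: "basis_vec K (v, w) \<in> carrier ?E" if "v \<in> carrier V" "w \<in> carrier W" for v w
    using that by (auto simp: free_space_simps basis_vec_def)
  have rels: "bilin_rels K V W \<subseteq> carrier ?E"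
    unfolding bilin_rels_def Let_def by (auto intro!: E.M.minus_closed E.M.a_closed E.smult_closed e)
  have N: "submodule ?N K ?E"
    unfolding tensor_null_def by (rule k_span_submodule[OF E.module_axioms rels])
  note Q = quotient_space_module[OF E.module_axioms N, folded tensor_space_def]
  interpret T: module K "tensor_space K V W" by (rule Q(1))
  have pT: "pure_tensor K V W v w \<in> carrier (tensor_space K V W)" if "v \<in> carrier V" "w \<in> carrier W" for v w
    unfolding pure_tensor_def by (rule Q(2)[OF e[OF that]])
  \<comment> \<open>The zero tensor is a scalar multiple of a pure one, so the induction rule has no
    separate case for it.\<close>
  have zero: "?N +>\<^bsub>?E\<^esub> \<zero>\<^bsub>?E\<^esub> = \<zero>\<^bsub>K\<^esub> \<odot>\<^bsub>tensor_space K V W\<^esub> pure_tensor K V W \<zero>\<^bsub>V\<^esub> \<zero>\<^bsub>W\<^esub>"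
    unfolding pure_tensor_def using Q(4)[of "\<zero>\<^bsub>K\<^esub>" "basis_vec K (\<zero>\<^bsub>V\<^esub>, \<zero>\<^bsub>W\<^esub>)"] e by simp
  have Pz: "P (?N +>\<^bsub>?E\<^esub> \<zero>\<^bsub>?E\<^esub>)"
    unfolding zero by (intro smult pure pT K.zero_closed V.M.zero_closed W.M.zero_closed)
  have step: "P (?N +>\<^bsub>?E\<^esub> f)" if "finite B" "f \<in> carrier ?E" "{p. f p \<noteq> \<zero>\<^bsub>K\<^esub>} \<subseteq> B" for B f
    using that
  proof (induction B arbitrary: f rule: finite_induct)
    case empty
    then have "f = \<zero>\<^bsub>?E\<^esub>" by (auto simp: free_space_simps)
    then show ?case using Pz by (simp only:)
  next
    case (insert p B)
    show ?case
    proof (cases "f p = \<zero>\<^bsub>K\<^esub>")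
      case True
      then have "{p. f p \<noteq> \<zero>\<^bsub>K\<^esub>} \<subseteq> B" using insert.prems by auto
      then show ?thesis using insert by simp
    next
      case False
      have f: "\<And>x. f x \<in> carrier K" "\<And>x. x \<notin> ?X \<Longrightarrow> f x = \<zero>\<^bsub>K\<^esub>" "finite {x. f x \<noteq> \<zero>\<^bsub>K\<^esub>}"
        using insert.prems(1) unfolding free_space_simps by blast+
      obtain v w where p: "p = (v, w)" "v \<in> carrier V" "w \<in> carrier W" using f(2)[of p] False by auto
      let ?f = "f(p := \<zero>\<^bsub>K\<^esub>)"
      have f': "?f \<in> carrier ?E"
        using f(1,2) finite_subset[OF _ f(3), of "{x. ?f x \<noteq> \<zero>\<^bsub>K\<^esub>}"]
        unfolding free_space_simps by (simp add: subset_iff)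
      have "f = f p \<odot>\<^bsub>?E\<^esub> basis_vec K p \<oplus>\<^bsub>?E\<^esub> ?f"
        using f(1) by (intro ext) (simp add: free_space_simps basis_vec_def)
      then have "?N +>\<^bsub>?E\<^esub> f = ?N +>\<^bsub>?E\<^esub> (f p \<odot>\<^bsub>?E\<^esub> basis_vec K p \<oplus>\<^bsub>?E\<^esub> ?f)" by (rule arg_cong)
      also have "\<dots> = f p \<odot>\<^bsub>tensor_space K V W\<^esub> pure_tensor K V W v w \<oplus>\<^bsub>tensor_space K V W\<^esub> (?N +>\<^bsub>?E\<^esub> ?f)"
        unfolding pure_tensor_def p(1)[symmetric]
        using Q(3)[of "f p \<odot>\<^bsub>?E\<^esub> basis_vec K p" ?f] Q(4)[of "f p" "basis_vec K p"] f(1)[of p] f' e p by simp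
      finally have eq: "?N +>\<^bsub>?E\<^esub> f =
        f p \<odot>\<^bsub>tensor_space K V W\<^esub> pure_tensor K V W v w \<oplus>\<^bsub>tensor_space K V W\<^esub> (?N +>\<^bsub>?E\<^esub> ?f)" .
      have "P (?N +>\<^bsub>?E\<^esub> ?f)"
        by (rule insert.IH[OF f']) (use insert.prems(2) in auto)
      then show ?thesis unfolding eq
        using add smult pure pT[OF p(2,3)] f(1)[of p] p Q(2)[OF f'] by simp
    qed
  qed
  obtain f where f: "f \<in> carrier ?E" "t = ?N +>\<^bsub>?E\<^esub> f"
    using t by (auto simp: tensor_space_def quotient_space_def A_RCOSETS_def')
  then have "finite {p. f p \<noteq> \<zero>\<^bsub>K\<^esub>}" unfolding free_space_simps by blast
  then show ?thesis unfolding f(2) by (rule step[OF _ f(1) subset_refl])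
qed

text \<open>\<open>V\<close> modulo the preimage of \<open>J\<close> embeds into
  \<open>W / J\<close>, with image inside the finite-dimensional space spanned by \<open>E\<close>.
  A field is noetherian, so this image is finitely generated, and its generators are lifted back to
  \<open>V\<close>.\<close>

lemma finite_codim_preimage:
  fixes V :: "('k, 'v) module" and W :: "('k, 'w) module"
  assumes K: "field K" and V: "module K V" and W: "module K W" and \<phi>: "k_linear K V W \<phi>"
    and J: "submodule J K W" and E: "finite E" "E \<subseteq> carrier W"
    and sub: "\<And>v. v \<in> carrier V \<Longrightarrow> \<phi> v \<in> mspan K W (E \<union> J)"
  shows "finite_codim K V {v \<in> carrier V. \<phi> v \<in> J}"
proof -
  interpret K: field K by fact
  interpret V: module K V by fact
  interpret W: module K W by fact
  have c: "\<phi> v \<in> carrier W" if "v \<in> carrier V" for v using \<phi> that by (auto simp: k_linear_def)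
  have lin: "\<phi> (v \<oplus>\<^bsub>V\<^esub> v') = \<phi> v \<oplus>\<^bsub>W\<^esub> \<phi> v'" "a \<in> carrier K \<Longrightarrow> \<phi> (a \<odot>\<^bsub>V\<^esub> v) = a \<odot>\<^bsub>W\<^esub> \<phi> v"
    if "v \<in> carrier V" "v' \<in> carrier V" for v v' a using \<phi> that by (auto simp: k_linear_def)
  have z: "\<phi> \<zero>\<^bsub>V\<^esub> = \<zero>\<^bsub>W\<^esub>" using lin(2)[of "\<zero>\<^bsub>V\<^esub>" "\<zero>\<^bsub>V\<^esub>" "\<zero>\<^bsub>K\<^esub>"] c[of "\<zero>\<^bsub>V\<^esub>"] by simp
  have neg: "\<phi> (\<ominus>\<^bsub>V\<^esub> v) = \<ominus>\<^bsub>W\<^esub> \<phi> v" if "v \<in> carrier V" for v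
    using lin(2)[OF that that, of "\<ominus>\<^bsub>K\<^esub> \<one>\<^bsub>K\<^esub>"] that c[OF that]
    by (simp add: V.smult_l_minus W.smult_l_minus V.smult_one W.smult_one)
  have JW: "J \<subseteq> carrier W" by (rule W.submoduleE(1)[OF J])
  \<comment> \<open>\<open>I N\<close> is the image of \<open>N\<close> enlarged by
    \<open>J\<close>; it represents the image in \<open>W / J\<close>.\<close>
  define I where "I N = {\<phi> v \<oplus>\<^bsub>W\<^esub> j | v j. v \<in> N \<and> j \<in> J}" for N
  have I: "submodule (I N) K W" if N: "submodule N K V" for N
  proof (rule W.submoduleI)
    have NV: "N \<subseteq> carrier V" by (rule V.submoduleE(1)[OF N])
    show "I N \<subseteq> carrier W" unfolding I_def using NV JW c by auto
    have "\<zero>\<^bsub>W\<^esub> = \<phi> \<zero>\<^bsub>V\<^esub> \<oplus>\<^bsub>W\<^esub> \<zero>\<^bsub>W\<^esub>" using z by simp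
    then show "\<zero>\<^bsub>W\<^esub> \<in> I N" unfolding I_def using V.submodule_zero[OF N] W.submodule_zero[OF J] by blast
    fix x assume "x \<in> I N"
    then obtain v j where x: "v \<in> N" "j \<in> J" "x = \<phi> v \<oplus>\<^bsub>W\<^esub> j" unfolding I_def by blast
    then have xc: "v \<in> carrier V" "j \<in> carrier W" using NV JW by auto
    have "\<ominus>\<^bsub>W\<^esub> x = \<phi> (\<ominus>\<^bsub>V\<^esub> v) \<oplus>\<^bsub>W\<^esub> \<ominus>\<^bsub>W\<^esub> j" using x xc c neg by (simp add: W.M.minus_add)
    then show "\<ominus>\<^bsub>W\<^esub> x \<in> I N"
      unfolding I_def using V.submoduleE(3)[OF N x(1)] W.submoduleE(3)[OF J x(2)] by blast
    { fix a assume a: "a \<in> carrier K"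
      have "a \<odot>\<^bsub>W\<^esub> x = \<phi> (a \<odot>\<^bsub>V\<^esub> v) \<oplus>\<^bsub>W\<^esub> a \<odot>\<^bsub>W\<^esub> j" using x xc c lin a by (simp add: W.smult_r_distr)
      then show "a \<odot>\<^bsub>W\<^esub> x \<in> I N"
        unfolding I_def using V.submoduleE(4)[OF N a x(1)] W.submoduleE(4)[OF J a x(2)] by blast }
    fix y assume "y \<in> I N"
    then obtain v' j' where y: "v' \<in> N" "j' \<in> J" "y = \<phi> v' \<oplus>\<^bsub>W\<^esub> j'" unfolding I_def by blast
    then have yc: "v' \<in> carrier V" "j' \<in> carrier W" using NV JW by auto
    have "x \<oplus>\<^bsub>W\<^esub> y = \<phi> (v \<oplus>\<^bsub>V\<^esub> v') \<oplus>\<^bsub>W\<^esub> (j \<oplus>\<^bsub>W\<^esub> j')" using x y xc yc c lin by (simp add: W.M.a_ac)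
    then show "x \<oplus>\<^bsub>W\<^esub> y \<in> I N"
      unfolding I_def using V.submoduleE(5)[OF N x(1) y(1)] W.submoduleE(5)[OF J x(2) y(2)] by blast
  qed
  have JI: "J \<subseteq> I N" if N: "submodule N K V" for N
  proof
    fix j assume j: "j \<in> J"
    then have "j = \<phi> \<zero>\<^bsub>V\<^esub> \<oplus>\<^bsub>W\<^esub> j" using z JW by (simp add: subsetD)
    then show "j \<in> I N" unfolding I_def using V.submodule_zero[OF N] j by blast
  qed
  have \<phi>I: "\<phi> v \<in> I N" if "v \<in> N" "submodule N K V" for v N
  proof -
    have "\<phi> v = \<phi> v \<oplus>\<^bsub>W\<^esub> \<zero>\<^bsub>W\<^esub>" using c V.submoduleE(1)[OF that(2)] that(1) by auto
    then show ?thesis unfolding I_def using W.submodule_zero[OF J] that(1) by blast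
  qed
  let ?a = "{v \<in> carrier V. \<phi> v \<in> J}"
  note cV = V.carrier_is_submodule
  have EJ: "E \<union> J \<subseteq> carrier W" using E JW by blast
  have Z: "submodule (mspan K W (E \<union> J)) K W" by (rule W.mspan_submodule[OF EJ])
  have "I (carrier V) \<subseteq> mspan K W (E \<union> J)"
  proof
    fix x assume "x \<in> I (carrier V)"
    then obtain v j where x: "v \<in> carrier V" "j \<in> J" "x = \<phi> v \<oplus>\<^bsub>W\<^esub> j" unfolding I_def by blast
    have "j \<in> mspan K W (E \<union> J)" using x(2) W.mspan_superset[of "E \<union> J"] by blast
    then show "x \<in> mspan K W (E \<union> J)" using W.submoduleE(5)[OF Z sub[OF x(1)]] x(3) by simp
  qed
  then obtain G where G: "finite G" "G \<subseteq> I (carrier V)" "I (carrier V) = mspan K W (G \<union> J)"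
    using W.noetherian_finitely_generated[OF K.noetherian_ring_axioms J E I[OF cV] JI[OF cV]] by blast
  \<comment> \<open>The lifts \<open>v g\<close> together with the preimage of \<open>J\<close> span
    \<open>V\<close>: a vector with the same image modulo \<open>J\<close> as a combination of lifts
    differs from it by an element of that preimage.\<close>
  have "\<forall>g\<in>G. \<exists>v. v \<in> carrier V \<and> (\<exists>j\<in>J. g = \<phi> v \<oplus>\<^bsub>W\<^esub> j)" using G(2) unfolding I_def by blast
  then obtain v where v: "\<And>g. g \<in> G \<Longrightarrow> v g \<in> carrier V \<and> (\<exists>j\<in>J. g = \<phi> (v g) \<oplus>\<^bsub>W\<^esub> j)" by metis
  have BV: "v ` G \<union> ?a \<subseteq> carrier V" using v by auto
  define N where "N = mspan K V (v ` G \<union> ?a)"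
  have N: "submodule N K V" unfolding N_def by (rule V.mspan_submodule[OF BV])
  have supN: "v ` G \<union> ?a \<subseteq> N" unfolding N_def by (rule V.mspan_superset)
  have "G \<union> J \<subseteq> I N" using JI[OF N] v supN unfolding I_def by blast
  then have IN: "I (carrier V) \<subseteq> I N" unfolding G(3) by (rule W.mspan_least[OF I[OF N]])
  have "carrier V \<subseteq> N"
  proof
    fix x assume x: "x \<in> carrier V"
    then have "\<phi> x \<in> I N" using \<phi>I[OF x cV] IN by blast
    then obtain q j where q: "q \<in> N" "j \<in> J" "\<phi> x = \<phi> q \<oplus>\<^bsub>W\<^esub> j" unfolding I_def by blast
    then have qV: "q \<in> carrier V" "j \<in> carrier W" using V.submoduleE(1)[OF N] JW by auto
    have "\<phi> (x \<ominus>\<^bsub>V\<^esub> q) = j"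
      using x qV c neg q(3) by (simp add: V.M.minus_eq lin W.M.a_ac W.M.r_neg1 W.M.r_neg2 W.M.r_neg)
    then have "x \<ominus>\<^bsub>V\<^esub> q \<in> N" using supN q(2) x qV by auto
    then have "x \<ominus>\<^bsub>V\<^esub> q \<oplus>\<^bsub>V\<^esub> q \<in> N" using V.submoduleE(5)[OF N _ q(1)] by blast
    then show "x \<in> N" using x qV by (simp add: V.M.minus_eq V.M.a_assoc V.M.l_neg)
  qed
  then have "k_span K V (v ` G \<union> ?a) = carrier V"
    using V.submoduleE(1)[OF N] unfolding k_span_eq_mspan N_def by blast
  then show ?thesis unfolding finite_codim_def using G(1) v by (intro exI[of _ "v ` G"]) auto
qed

section \<open>Smash products\<close>

locale smash_action = SP: smash_product K S A Ht \<Delta> act iA iH + MA: module_algebra K A Ht \<Delta> \<epsilon> act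
    + HT: k_algebra K Ht
  for K :: "'k ring" and S :: "('k, 's) module" and A :: "('k, 'a) module" and Ht :: "('k, 'h) module"
    and \<Delta> :: "'h \<Rightarrow> ('h \<times> 'h \<Rightarrow> 'k) set" and \<epsilon> :: "'h \<Rightarrow> 'k" and act :: "'h \<Rightarrow> 'a \<Rightarrow> 'a"
    and iA :: "'a \<Rightarrow> 's" and iH :: "'h \<Rightarrow> 's" +
  assumes comult_closed: "x \<in> carrier Ht \<Longrightarrow> \<Delta> x \<in> carrier (tensor_space K Ht Ht)"
    and comm: "a \<in> carrier A \<Longrightarrow> b \<in> carrier A \<Longrightarrow> a \<otimes>\<^bsub>A\<^esub> b = b \<otimes>\<^bsub>A\<^esub> a"
begin

lemma iA_simps [simp]:
  "a \<in> carrier A \<Longrightarrow> iA a \<in> carrier S"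
  "a \<in> carrier A \<Longrightarrow> b \<in> carrier A \<Longrightarrow> iA (a \<oplus>\<^bsub>A\<^esub> b) = iA a \<oplus>\<^bsub>S\<^esub> iA b"
  "a \<in> carrier A \<Longrightarrow> b \<in> carrier A \<Longrightarrow> iA (a \<otimes>\<^bsub>A\<^esub> b) = iA a \<otimes>\<^bsub>S\<^esub> iA b"
  "c \<in> carrier K \<Longrightarrow> a \<in> carrier A \<Longrightarrow> iA (c \<odot>\<^bsub>A\<^esub> a) = c \<odot>\<^bsub>S\<^esub> iA a"
  "iA \<one>\<^bsub>A\<^esub> = \<one>\<^bsub>S\<^esub>"
  using SP.iA_hom by (auto simp: k_alg_hom_def k_linear_def ring_hom_def)

lemma iH_simps [simp]:
  "x \<in> carrier Ht \<Longrightarrow> iH x \<in> carrier S"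
  "x \<in> carrier Ht \<Longrightarrow> y \<in> carrier Ht \<Longrightarrow> iH (x \<oplus>\<^bsub>Ht\<^esub> y) = iH x \<oplus>\<^bsub>S\<^esub> iH y"
  "c \<in> carrier K \<Longrightarrow> x \<in> carrier Ht \<Longrightarrow> iH (c \<odot>\<^bsub>Ht\<^esub> x) = c \<odot>\<^bsub>S\<^esub> iH x"
  "iH \<one>\<^bsub>Ht\<^esub> = \<one>\<^bsub>S\<^esub>"
  using SP.iH_hom by (auto simp: k_alg_hom_def k_linear_def ring_hom_def)

lemma act_simps [simp]:
  "x \<in> carrier Ht \<Longrightarrow> a \<in> carrier A \<Longrightarrow> act x a \<in> carrier A"
  "x \<in> carrier Ht \<Longrightarrow> y \<in> carrier Ht \<Longrightarrow> a \<in> carrier A \<Longrightarrow> act (x \<oplus>\<^bsub>Ht\<^esub> y) a = act x a \<oplus>\<^bsub>A\<^esub> act y a"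
  "c \<in> carrier K \<Longrightarrow> x \<in> carrier Ht \<Longrightarrow> a \<in> carrier A \<Longrightarrow> act (c \<odot>\<^bsub>Ht\<^esub> x) a = c \<odot>\<^bsub>A\<^esub> act x a"
  using MA.act_linear_left unfolding k_linear_def by blast+

lemmas algebra_simps_SA = SP.smult_mult_left SP.smult_mult_right MA.smult_mult_left MA.smult_mult_right
  SP.A.l_distr SP.A.r_distr MA.A.l_distr MA.A.r_distr

lemma smash_map_simps:
  "a \<in> carrier A \<Longrightarrow> x \<in> carrier Ht \<Longrightarrow> smash_map K S iA iH (pure_tensor K A Ht a x) = iA a \<otimes>\<^bsub>S\<^esub> iH x"
  "s \<in> carrier (tensor_space K A Ht) \<Longrightarrow> t \<in> carrier (tensor_space K A Ht) \<Longrightarrow>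
    smash_map K S iA iH (s \<oplus>\<^bsub>tensor_space K A Ht\<^esub> t) = smash_map K S iA iH s \<oplus>\<^bsub>S\<^esub> smash_map K S iA iH t"
  "s \<in> carrier (tensor_space K A Ht) \<Longrightarrow> c \<in> carrier K \<Longrightarrow>
    smash_map K S iA iH (c \<odot>\<^bsub>tensor_space K A Ht\<^esub> s) = c \<odot>\<^bsub>S\<^esub> smash_map K S iA iH s"
  and tensor_module: "module K (tensor_space K A Ht)"
  and pure_tensor_closed: "a \<in> carrier A \<Longrightarrow> x \<in> carrier Ht \<Longrightarrow> pure_tensor K A Ht a x \<in> carrier (tensor_space K A Ht)"
  unfolding smash_map_def
  by (rule tensor_lift_bilinear[OF SP.K.field_axioms MA.module_axioms HT.module_axioms SP.module_axioms,
        where \<beta> = "\<lambda>a x. iA a \<otimes>\<^bsub>S\<^esub> iH x"]; simp add: algebra_simps_SA)+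

lemma tensor_act_simps:
  assumes g: "g \<in> carrier A"
  shows "a \<in> carrier A \<Longrightarrow> x \<in> carrier Ht \<Longrightarrow> tensor_act K A act (pure_tensor K A Ht a x) g = a \<otimes>\<^bsub>A\<^esub> act x g"
  and "s \<in> carrier (tensor_space K A Ht) \<Longrightarrow> t \<in> carrier (tensor_space K A Ht) \<Longrightarrow>
    tensor_act K A act (s \<oplus>\<^bsub>tensor_space K A Ht\<^esub> t) g = tensor_act K A act s g \<oplus>\<^bsub>A\<^esub> tensor_act K A act t g"
  and "s \<in> carrier (tensor_space K A Ht) \<Longrightarrow> c \<in> carrier K \<Longrightarrow>
    tensor_act K A act (c \<odot>\<^bsub>tensor_space K A Ht\<^esub> s) g = c \<odot>\<^bsub>A\<^esub> tensor_act K A act s g"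
  unfolding tensor_act_def
  by (rule tensor_lift_bilinear[OF SP.K.field_axioms MA.module_axioms HT.module_axioms MA.module_axioms];
      simp add: algebra_simps_SA g)+

lemma smash_surj:
  assumes "X \<in> carrier S" obtains t where "t \<in> carrier (tensor_space K A Ht)" "X = smash_map K S iA iH t"
  using SP.smash_bij assms unfolding bij_betw_def tensor_simps by blast

lemma smash_map_closed: "t \<in> carrier (tensor_space K A Ht) \<Longrightarrow> smash_map K S iA iH t \<in> carrier S"
  using SP.smash_bij unfolding bij_betw_def tensor_simps by blast

text \<open>Surjectivity of \<open>smash_map\<close> transfers tensor induction to the smash
  product.\<close>

lemma smash_induct [consumes 1, case_names gen add smult]:
  assumes "X \<in> carrier S"
    and gen: "\<And>a x. a \<in> carrier A \<Longrightarrow> x \<in> carrier Ht \<Longrightarrow> P (iA a \<otimes>\<^bsub>S\<^esub> iH x)"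
    and add: "\<And>X Y. X \<in> carrier S \<Longrightarrow> Y \<in> carrier S \<Longrightarrow> P X \<Longrightarrow> P Y \<Longrightarrow> P (X \<oplus>\<^bsub>S\<^esub> Y)"
    and smult: "\<And>c X. c \<in> carrier K \<Longrightarrow> X \<in> carrier S \<Longrightarrow> P X \<Longrightarrow> P (c \<odot>\<^bsub>S\<^esub> X)"
  shows "P X"
proof -
  obtain t where t: "t \<in> carrier (tensor_space K A Ht)" "X = smash_map K S iA iH t"
    by (rule smash_surj[OF assms(1)])
  from SP.K.field_axioms MA.module_axioms HT.module_axioms t(1) have "P (smash_map K S iA iH t)"
    by (induction rule: tensor_space_induct) (simp_all add: smash_map_simps smash_map_closed gen add smult)
  then show ?thesis using t(2) by simp
qed

abbreviation "hatX \<equiv> hat K S A Ht act iA iH"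

lemma hat_smash_map:
  assumes "t \<in> carrier (tensor_space K A Ht)"
  shows "hatX (smash_map K S iA iH t) g = tensor_act K A act t g"
  using SP.smash_bij assms unfolding hat_def bij_betw_def tensor_simps by (simp add: inv_into_f_f)

lemma hat_gen:
  assumes "a \<in> carrier A" "x \<in> carrier Ht" "g \<in> carrier A"
  shows "hatX (iA a \<otimes>\<^bsub>S\<^esub> iH x) g = a \<otimes>\<^bsub>A\<^esub> act x g"
  using hat_smash_map[OF pure_tensor_closed[OF assms(1,2)], of g] assms
  by (simp add: smash_map_simps tensor_act_simps)

lemma hat_add:
  assumes "X \<in> carrier S" "Y \<in> carrier S" "g \<in> carrier A"
  shows "hatX (X \<oplus>\<^bsub>S\<^esub> Y) g = hatX X g \<oplus>\<^bsub>A\<^esub> hatX Y g"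
proof -
  obtain s t where s: "s \<in> carrier (tensor_space K A Ht)" "X = smash_map K S iA iH s"
    and t: "t \<in> carrier (tensor_space K A Ht)" "Y = smash_map K S iA iH t"
    using smash_surj assms by metis
  interpret T: module K "tensor_space K A Ht" by (rule tensor_module)
  have "X \<oplus>\<^bsub>S\<^esub> Y = smash_map K S iA iH (s \<oplus>\<^bsub>tensor_space K A Ht\<^esub> t)"
    using s t by (simp add: smash_map_simps)
  then show ?thesis using s t assms(3) by (simp add: hat_smash_map tensor_act_simps)
qed

lemma hat_smult:
  assumes "X \<in> carrier S" "c \<in> carrier K" "g \<in> carrier A"
  shows "hatX (c \<odot>\<^bsub>S\<^esub> X) g = c \<odot>\<^bsub>A\<^esub> hatX X g"
proof -
  obtain s where s: "s \<in> carrier (tensor_space K A Ht)" "X = smash_map K S iA iH s"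
    by (rule smash_surj[OF assms(1)])
  interpret T: module K "tensor_space K A Ht" by (rule tensor_module)
  have "c \<odot>\<^bsub>S\<^esub> X = smash_map K S iA iH (c \<odot>\<^bsub>tensor_space K A Ht\<^esub> s)"
    using s assms by (simp add: smash_map_simps)
  then show ?thesis using s assms by (simp add: hat_smash_map tensor_act_simps)
qed

lemma hat_closed: "X \<in> carrier S \<Longrightarrow> g \<in> carrier A \<Longrightarrow> hatX X g \<in> carrier A"
  by (induction rule: smash_induct) (simp_all add: hat_gen hat_add hat_smult)

text \<open>Left multiplication by \<open>iA f\<close> changes only the coefficient \<open>a\<close>
  of a generator \<open>iA a\<close> times \<open>iH x\<close>, and \<open>hatX\<close> multiplies
  by that coefficient last.\<close>

lemma hat_mult_left:
  assumes "X \<in> carrier S" "f \<in> carrier A" "g \<in> carrier A"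
  shows "hatX (iA f \<otimes>\<^bsub>S\<^esub> X) g = f \<otimes>\<^bsub>A\<^esub> hatX X g"
  using assms(1)
proof (induction rule: smash_induct)
  case (gen a x)
  have "iA f \<otimes>\<^bsub>S\<^esub> (iA a \<otimes>\<^bsub>S\<^esub> iH x) = iA (f \<otimes>\<^bsub>A\<^esub> a) \<otimes>\<^bsub>S\<^esub> iH x"
    using gen assms by (simp add: SP.A.m_assoc)
  then show ?case using gen assms by (simp add: hat_gen MA.A.m_assoc del: iA_simps(3))
qed (use assms in \<open>simp_all add: hat_add hat_smult hat_closed algebra_simps_SA\<close>)

lemma hat_one: "g \<in> carrier A \<Longrightarrow> hatX \<one>\<^bsub>S\<^esub> g = g"
  using hat_gen[of "\<one>\<^bsub>A\<^esub>" "\<one>\<^bsub>Ht\<^esub>" g] by (simp add: MA.act_one)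

end

section \<open>Restriction of scalars and left module structures on the smash product\<close>

definition with_smult :: "('b, 'v, 'm) module_scheme \<Rightarrow> ('r \<Rightarrow> 'v \<Rightarrow> 'v) \<Rightarrow> ('r, 'v) module" where
  "with_smult V f = \<lparr>carrier = carrier V, mult = mult V, one = one V, zero = zero V, add = add V, smult = f\<rparr>"

lemma with_smult_simps [simp]:
  "carrier (with_smult V f) = carrier V" "zero (with_smult V f) = zero V" "add (with_smult V f) = add V"
  "smult (with_smult V f) = f"
  by (simp_all add: with_smult_def)

lemma with_smult_abelian_group:
  assumes "abelian_group V" shows "abelian_group (with_smult V f)"
proof -
  interpret V: abelian_group V by fact
  show ?thesis
  proof (rule abelian_groupI)
    fix x assume "x \<in> carrier (with_smult V f)"
    then show "\<exists>y\<in>carrier (with_smult V f). y \<oplus>\<^bsub>with_smult V f\<^esub> x = \<zero>\<^bsub>with_smult V f\<^esub>"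
      by (intro bexI[of _ "\<ominus>\<^bsub>V\<^esub> x"]) (auto simp: V.l_neg)
  qed (auto simp: V.a_ac)
qed

lemma with_smult_finsum: "finsum (with_smult V f) = finsum V"
  by (intro ext) (simp add: finsum_def finprod_def)

text \<open>In the application \<open>A\<close> is the fraction field \<open>L\<close> and
  \<open>D\<close> is \<open>\<Lambda>\<close>. Both occur because elements of \<open>F\<close> have
  coefficients in \<open>L\<close>, whereas the finiteness argument needs the noetherian ring
  \<open>\<Lambda>\<close>.\<close>

locale smash_subring = smash_action K S A Ht \<Delta> \<epsilon> act iA iH
  for K :: "'k ring" and S :: "('k, 's) module" and A :: "('k, 'a) module" and Ht :: "('k, 'h) module"
    and \<Delta> \<epsilon> act iA iH +
  fixes D :: "'a set"
  assumes D_subring: "subring D A" and D_alg: "k_algebra K (A\<lparr>carrier := D\<rparr>)"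
    and D_cring: "cring (A\<lparr>carrier := D\<rparr>)"
    and D_act: "x \<in> carrier Ht \<Longrightarrow> a \<in> D \<Longrightarrow> act x a \<in> D"
begin

abbreviation "R \<equiv> A\<lparr>carrier := D\<rparr>"
abbreviation "LS \<equiv> with_smult S (\<lambda>r s. iA r \<otimes>\<^bsub>S\<^esub> s)"

lemma D_closed [simp]: "a \<in> D \<Longrightarrow> a \<in> carrier A"
  using subringE(1)[OF D_subring] by blast

lemma LS_module: "module R LS"
proof (rule moduleI)
  show "cring R" by (rule D_cring)
  show "abelian_group LS" by (rule with_smult_abelian_group) (rule SP.A.is_abelian_group)
qed (simp_all add: algebra_simps_SA SP.A.m_assoc)

end

sublocale smash_subring \<subseteq> LS: module R LS by (rule LS_module)

context smash_subring
begin

text \<open>Scalars of \<open>K\<close> act through \<open>c 1 \<in> D\<close>, so left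
  \<open>D\<close>-spans are subspaces over \<open>K\<close>. This settles the scalar cases of the
  inductions below.\<close>

lemma span_smult_K:
  assumes "E \<subseteq> carrier S" "z \<in> mspan R LS E" "c \<in> carrier K"
  shows "c \<odot>\<^bsub>S\<^esub> z \<in> mspan R LS E"
proof -
  interpret R: k_algebra K R by (rule D_alg)
  have N: "submodule (mspan R LS E) R LS" by (rule LS.mspan_submodule) (use assms in simp)
  then have z: "z \<in> carrier S" using LS.submoduleE(1)[OF N] assms(2) by auto
  have "c \<odot>\<^bsub>A\<^esub> \<one>\<^bsub>A\<^esub> \<in> D" using R.smult_closed[OF assms(3), of "\<one>\<^bsub>A\<^esub>"] subringE(3)[OF D_subring] by simp
  then have "iA (c \<odot>\<^bsub>A\<^esub> \<one>\<^bsub>A\<^esub>) \<otimes>\<^bsub>S\<^esub> z \<in> mspan R LS E"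
    using LS.submoduleE(4)[OF N _ assms(2)] by simp
  then show ?thesis using assms(3) z by (simp add: SP.smult_mult_left)
qed

text \<open>In \<open>a x \<lambda> = \<Sum> (x\<^sub>(\<^sub>1\<^sub>) \<triangleright> \<lambda>) a x\<^sub>(\<^sub>2\<^sub>)\<close> only the left coefficients depend on \<open>\<lambda> \<in> D\<close>.\<close>

lemma mult_D_finite:
  assumes "X \<in> carrier S"
  shows "\<exists>E. finite E \<and> E \<subseteq> carrier S \<and> (\<forall>d\<in>D. X \<otimes>\<^bsub>S\<^esub> iA d \<in> mspan R LS E)"
  using assms
proof (induction rule: smash_induct)
  case (gen a x)
  define \<beta> where "\<beta> d = (\<lambda>u v. iA (act u d) \<otimes>\<^bsub>S\<^esub> iH v)" for d
  have \<beta>: "\<And>v w. v \<in> carrier Ht \<Longrightarrow> w \<in> carrier Ht \<Longrightarrow> tensor_lift K S (\<beta> d) (pure_tensor K Ht Ht v w) = \<beta> d v w"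
    "\<And>s t. s \<in> carrier (tensor_space K Ht Ht) \<Longrightarrow> t \<in> carrier (tensor_space K Ht Ht) \<Longrightarrow>
     tensor_lift K S (\<beta> d) (s \<oplus>\<^bsub>tensor_space K Ht Ht\<^esub> t) = tensor_lift K S (\<beta> d) s \<oplus>\<^bsub>S\<^esub> tensor_lift K S (\<beta> d) t"
    "\<And>s c. s \<in> carrier (tensor_space K Ht Ht) \<Longrightarrow> c \<in> carrier K \<Longrightarrow>
     tensor_lift K S (\<beta> d) (c \<odot>\<^bsub>tensor_space K Ht Ht\<^esub> s) = c \<odot>\<^bsub>S\<^esub> tensor_lift K S (\<beta> d) s" if "d \<in> D" for d
    by (rule tensor_lift_bilinear[OF SP.K.field_axioms HT.module_axioms HT.module_axioms SP.module_axioms,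
        where \<beta> = "\<beta> d"]; simp add: \<beta>_def algebra_simps_SA that)+
  \<comment> \<open>\<open>E\<close> has to be chosen before \<open>d\<close>. The induction
    therefore runs over an arbitrary tensor \<open>t\<close>, later \<open>\<Delta> x\<close>, with
    \<open>d\<close> quantified inside.\<close>
  have "\<exists>E. finite E \<and> E \<subseteq> carrier S \<and>
      (\<forall>d\<in>D. tensor_lift K S (\<beta> d) t \<in> carrier S \<and> iA a \<otimes>\<^bsub>S\<^esub> tensor_lift K S (\<beta> d) t \<in> mspan R LS E)"
    if "t \<in> carrier (tensor_space K Ht Ht)" for t
    using SP.K.field_axioms HT.module_axioms HT.module_axioms that
  proof (induction rule: tensor_space_induct)
    case (pure u v)
    let ?E = "{iA a \<otimes>\<^bsub>S\<^esub> iH v}"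
    have E: "?E \<subseteq> carrier S" using pure gen by simp
    have N: "submodule (mspan R LS ?E) R LS" by (rule LS.mspan_submodule) (use E in simp)
    have "\<beta> d u v \<in> carrier S \<and> iA a \<otimes>\<^bsub>S\<^esub> \<beta> d u v \<in> mspan R LS ?E" if d: "d \<in> D" for d
    proof -
      have "iA a \<otimes>\<^bsub>S\<^esub> \<beta> d u v = iA (a \<otimes>\<^bsub>A\<^esub> act u d) \<otimes>\<^bsub>S\<^esub> iH v"
        using pure gen d by (simp add: \<beta>_def SP.A.m_assoc)
      \<comment> \<open>Commutativity of \<open>A\<close> moves the factor that depends on
        \<open>d\<close> to the front, where it acts as a scalar from \<open>D\<close>.\<close>
      also have "\<dots> = iA (act u d) \<otimes>\<^bsub>S\<^esub> (iA a \<otimes>\<^bsub>S\<^esub> iH v)"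
        using pure gen d comm[of a "act u d"] by (simp add: SP.A.m_assoc)
      also have "\<dots> \<in> mspan R LS ?E"
        using LS.submoduleE(4)[OF N, of "act u d"] D_act[OF pure(1) d] LS.mspan_superset[of ?E] by simp
      finally show ?thesis using pure d by (simp add: \<beta>_def)
    qed
    then show ?case using E pure by (intro exI[of _ ?E]) (simp add: \<beta>)
  next
    case (add s t)
    then obtain E E' where E: "finite E" "E \<subseteq> carrier S"
        "\<And>d. d \<in> D \<Longrightarrow> tensor_lift K S (\<beta> d) s \<in> carrier S \<and> iA a \<otimes>\<^bsub>S\<^esub> tensor_lift K S (\<beta> d) s \<in> mspan R LS E"
      and E': "finite E'" "E' \<subseteq> carrier S"
        "\<And>d. d \<in> D \<Longrightarrow> tensor_lift K S (\<beta> d) t \<in> carrier S \<and> iA a \<otimes>\<^bsub>S\<^esub> tensor_lift K S (\<beta> d) t \<in> mspan R LS E'"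
      by auto
    have N: "submodule (mspan R LS (E \<union> E')) R LS" by (rule LS.mspan_submodule) (use E E' in simp)
    have sub: "mspan R LS E \<subseteq> mspan R LS (E \<union> E')" "mspan R LS E' \<subseteq> mspan R LS (E \<union> E')"
      by (rule LS.mspan_mono, simp)+
    have "iA a \<otimes>\<^bsub>S\<^esub> tensor_lift K S (\<beta> d) s \<oplus>\<^bsub>S\<^esub> iA a \<otimes>\<^bsub>S\<^esub> tensor_lift K S (\<beta> d) t \<in> mspan R LS (E \<union> E')"
      if "d \<in> D" for d
      using LS.submoduleE(5)[OF N subsetD[OF sub(1)] subsetD[OF sub(2)]] E(3)[OF that] E'(3)[OF that] by simp
    then show ?case using E E' add.hyps gen
      by (intro exI[of _ "E \<union> E'"]) (simp add: \<beta> algebra_simps_SA)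
  next
    case (smult c s)
    then obtain E where E: "finite E" "E \<subseteq> carrier S"
        "\<And>d. d \<in> D \<Longrightarrow> tensor_lift K S (\<beta> d) s \<in> carrier S \<and> iA a \<otimes>\<^bsub>S\<^esub> tensor_lift K S (\<beta> d) s \<in> mspan R LS E"
      by auto
    then show ?case using smult.hyps gen span_smult_K[OF E(2)]
      by (intro exI[of _ E]) (simp add: \<beta> algebra_simps_SA)
  qed
  from this[OF comult_closed[OF gen(2)]] obtain E where E: "finite E" "E \<subseteq> carrier S"
    "\<And>d. d \<in> D \<Longrightarrow> tensor_lift K S (\<beta> d) (\<Delta> x) \<in> carrier S \<and> iA a \<otimes>\<^bsub>S\<^esub> tensor_lift K S (\<beta> d) (\<Delta> x) \<in> mspan R LS E"
    by auto
  have "(iA a \<otimes>\<^bsub>S\<^esub> iH x) \<otimes>\<^bsub>S\<^esub> iA d = iA a \<otimes>\<^bsub>S\<^esub> tensor_lift K S (\<beta> d) (\<Delta> x)" if "d \<in> D" for d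
    using SP.smash_comm[OF gen(2), of d] gen that by (simp add: SP.A.m_assoc \<beta>_def)
  then show ?case using E by (intro exI[of _ E]) simp
next
  case (add X Y)
  then obtain E E' where E: "finite E" "E \<subseteq> carrier S" "\<And>d. d \<in> D \<Longrightarrow> X \<otimes>\<^bsub>S\<^esub> iA d \<in> mspan R LS E"
    and E': "finite E'" "E' \<subseteq> carrier S" "\<And>d. d \<in> D \<Longrightarrow> Y \<otimes>\<^bsub>S\<^esub> iA d \<in> mspan R LS E'"
    by auto
  have N: "submodule (mspan R LS (E \<union> E')) R LS" by (rule LS.mspan_submodule) (use E E' in simp)
  have sub: "mspan R LS E \<subseteq> mspan R LS (E \<union> E')" "mspan R LS E' \<subseteq> mspan R LS (E \<union> E')"
    by (rule LS.mspan_mono, simp)+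
  have "X \<otimes>\<^bsub>S\<^esub> iA d \<oplus>\<^bsub>S\<^esub> Y \<otimes>\<^bsub>S\<^esub> iA d \<in> mspan R LS (E \<union> E')" if "d \<in> D" for d
    using LS.submoduleE(5)[OF N subsetD[OF sub(1) E(3)[OF that]] subsetD[OF sub(2) E'(3)[OF that]]] by simp
  then show ?case using E E' add.hyps by (intro exI[of _ "E \<union> E'"]) (simp add: algebra_simps_SA)
next
  case (smult c X)
  then obtain E where E: "finite E" "E \<subseteq> carrier S" "\<And>d. d \<in> D \<Longrightarrow> X \<otimes>\<^bsub>S\<^esub> iA d \<in> mspan R LS E" by auto
  then show ?case using smult.hyps span_smult_K[OF E(2)]
    by (intro exI[of _ E]) (simp add: algebra_simps_SA)
qed

end

section \<open>Annihilators modulo a right ideal\<close>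

context smash_subring
begin

text \<open>The set is the annihilator of the class of \<open>X\<close> in \<open>F / J\<close>, on
  which \<open>D\<close> acts by right multiplication. It is the preimage of \<open>J\<close> under
  \<open>d \<mapsto> X d\<close>, so it suffices that \<open>X D\<close> lies in a space that is
  finite-dimensional modulo \<open>J\<close>.\<close>

lemma annihilator_finite_codim:
  assumes noeth: "noetherian_ring R" and F: "subring F S" "submodule F K S" and DF: "iA ` D \<subseteq> F"
    and J: "right_ideal J (S\<lparr>carrier := F\<rparr>)" "iA ` m \<subseteq> J" and m: "m \<subseteq> D" "finite_codim K R m"
    and X: "X \<in> F"
  shows "finite_codim K R {d \<in> D. X \<otimes>\<^bsub>S\<^esub> iA d \<in> J}"
proof -
  interpret R: k_algebra K R by (rule D_alg)
  have FS: "ring (S\<lparr>carrier := F\<rparr>)" by (rule SP.A.subring_is_ring[OF F(1)])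
  note JD = right_idealD[OF FS J(1), simplified]
  note FE = subringE[OF F(1)]
  have FS': "F \<subseteq> carrier S" by (rule FE(1))
  have iF: "iA d \<in> F" if "d \<in> D" for d using DF that by blast
  have JS: "J \<subseteq> carrier S" using JD(1) FS' by blast
  \<comment> \<open>A scalar \<open>c\<close> reaches \<open>J\<close> through right multiplication
    by \<open>c 1\<close>, an element of the subspace \<open>F\<close>.\<close>
  have JK: "submodule J K S"
  proof (rule SP.submoduleI)
    fix c x assume c: "c \<in> carrier K" "x \<in> J"
    then have "c \<odot>\<^bsub>S\<^esub> x = x \<otimes>\<^bsub>S\<^esub> (c \<odot>\<^bsub>S\<^esub> \<one>\<^bsub>S\<^esub>)" using JS by (simp add: SP.smult_mult_right subsetD)
    then show "c \<odot>\<^bsub>S\<^esub> x \<in> J" using JD(5) c SP.submoduleE(4)[OF F(2) c(1) FE(3)] by simp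
  next
    fix x assume x: "x \<in> J"
    then have "\<ominus>\<^bsub>S\<^esub> x = x \<otimes>\<^bsub>S\<^esub> (\<ominus>\<^bsub>S\<^esub> \<one>\<^bsub>S\<^esub>)" using JS by (simp add: SP.A.r_minus subsetD)
    then show "\<ominus>\<^bsub>S\<^esub> x \<in> J" using JD(5)[OF x] FE(5)[OF FE(3)] by simp
  qed (use JS JD in auto)
  obtain E where E: "finite E" "E \<subseteq> carrier S" "\<And>d. d \<in> D \<Longrightarrow> X \<otimes>\<^bsub>S\<^esub> iA d \<in> mspan R LS E"
    using mult_D_finite[OF subsetD[OF FS' X]] by (elim exE conjE) simp
  have FR: "submodule F R LS"
  proof (rule LS.submoduleI)
    fix x assume "x \<in> F"
    have "\<ominus>\<^bsub>LS\<^esub> x = \<ominus>\<^bsub>S\<^esub> x"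
      by (simp add: a_inv_def m_inv_def)
    then show "\<ominus>\<^bsub>LS\<^esub> x \<in> F" using FE(5)[OF \<open>x \<in> F\<close>] by simp
  qed (use FE iF in auto)
  \<comment> \<open>\<open>W\<close>, the left \<open>D\<close>-span of \<open>XD\<close>, is the
    bimodule \<open>D X D\<close> generated by \<open>X\<close>.\<close>
  define XD where "XD = (\<lambda>d. X \<otimes>\<^bsub>S\<^esub> iA d) ` D"
  have XDF: "XD \<subseteq> F" using FE(6)[OF X iF] by (auto simp: XD_def)
  have XDS: "XD \<subseteq> carrier LS" using XDF FS' by simp
  define W where "W = mspan R LS XD"
  have W: "submodule W R LS" unfolding W_def by (rule LS.mspan_submodule[OF XDS])
  have WF: "W \<subseteq> F" unfolding W_def by (rule LS.mspan_least[OF FR XDF])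
  have E0: "submodule (mspan R LS E) R LS" by (rule LS.mspan_submodule) (use E in simp)
  have "W \<subseteq> mspan R LS E" unfolding W_def by (rule LS.mspan_least[OF E0]) (use E in \<open>auto simp: XD_def\<close>)
  also have "\<dots> \<subseteq> mspan R LS (E \<union> {\<zero>\<^bsub>LS\<^esub>})" by (rule LS.mspan_mono[OF Un_upper1])
  finally have WE: "W \<subseteq> mspan R LS (E \<union> {\<zero>\<^bsub>LS\<^esub>})" .
  \<comment> \<open>The elements of \<open>E\<close> may lie outside \<open>F\<close>. The new
    generators belong to \<open>W \<subseteq> F\<close>, and only for such \<open>g\<close> does
    \<open>J\<close> contain the products of \<open>m\<close> with \<open>g\<close>.\<close>
  have "\<exists>G. finite G \<and> G \<subseteq> W \<and> W = mspan R LS (G \<union> {\<zero>\<^bsub>LS\<^esub>})"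
    by (rule LS.noetherian_finitely_generated[OF noeth LS.zero_submodule E(1) _ W _ WE])
      (use E(2) LS.submodule_zero[OF W] in auto)
  then obtain G where G: "finite G" "G \<subseteq> W" "W = mspan R LS (G \<union> {\<zero>\<^bsub>LS\<^esub>})" by (elim exE conjE)
  have GF: "G \<subseteq> F" using G(2) WF by (rule order_trans)
  obtain B where B: "finite B" "B \<subseteq> D" "mspan K R (B \<union> m) = D"
    using m(2) unfolding finite_codim_def k_span_eq_mspan by auto
  define E2 where "E2 = (\<lambda>(b, g). iA b \<otimes>\<^bsub>S\<^esub> g) ` (B \<times> G)"
  have E2: "finite E2" "E2 \<subseteq> carrier S"
  proof -
    show "finite E2" unfolding E2_def using B(1) G(1) by simp
    have "iA b \<otimes>\<^bsub>S\<^esub> g \<in> carrier S" if "b \<in> B" "g \<in> G" for b g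
      using that B(2) GF FS' by (simp add: subset_iff)
    then show "E2 \<subseteq> carrier S" unfolding E2_def by auto
  qed
  define Z where "Z = mspan K S (E2 \<union> J)"
  have Z: "submodule Z K S" unfolding Z_def by (rule SP.mspan_submodule) (use E2 JS in simp)
  have EZ: "E2 \<union> J \<subseteq> Z" unfolding Z_def by (rule SP.mspan_superset)
  \<comment> \<open>For fixed \<open>g\<close> the admissible \<open>r\<close> form a
    \<open>K\<close>-subspace of \<open>D\<close>. It contains \<open>B\<close> by the choice of
    \<open>E2\<close>, and \<open>m\<close> because \<open>J\<close> contains the image of
    \<open>m\<close> and absorbs \<open>g \<in> F\<close> on the right.\<close>
  have gen: "iA r \<otimes>\<^bsub>S\<^esub> g \<in> Z" if r: "r \<in> D" and g: "g \<in> G" for r g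
  proof -
    have gS: "g \<in> carrier S" "g \<in> F" using g GF FS' by auto
    have "submodule {r \<in> D. iA r \<otimes>\<^bsub>S\<^esub> g \<in> Z} K R"
    proof (rule R.submoduleI)
      show "\<zero>\<^bsub>R\<^esub> \<in> {r \<in> D. iA r \<otimes>\<^bsub>S\<^esub> g \<in> Z}"
      proof -
        have "iA \<zero>\<^bsub>A\<^esub> = \<zero>\<^bsub>S\<^esub>" using iA_simps(4)[of "\<zero>\<^bsub>K\<^esub>" "\<zero>\<^bsub>A\<^esub>"] by simp
        then show ?thesis using SP.submodule_zero[OF Z] gS subringE(2)[OF D_subring] by simp
      qed
    next
      fix c x assume c: "c \<in> carrier K" "x \<in> {r \<in> D. iA r \<otimes>\<^bsub>S\<^esub> g \<in> Z}"
      then have "c \<odot>\<^bsub>S\<^esub> (iA x \<otimes>\<^bsub>S\<^esub> g) \<in> Z" using SP.submoduleE(4)[OF Z] by simp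
      then show "c \<odot>\<^bsub>R\<^esub> x \<in> {r \<in> D. iA r \<otimes>\<^bsub>S\<^esub> g \<in> Z}"
        using c R.smult_closed[of c x] gS by (simp add: SP.smult_mult_left)
    next
      fix x assume x: "x \<in> {r \<in> D. iA r \<otimes>\<^bsub>S\<^esub> g \<in> Z}"
      have "\<ominus>\<^bsub>R\<^esub> x = (\<ominus>\<^bsub>K\<^esub> \<one>\<^bsub>K\<^esub>) \<odot>\<^bsub>A\<^esub> x"
        using x R.smult_l_minus[of "\<one>\<^bsub>K\<^esub>" x] R.smult_one[of x] by simp
      moreover have "(\<ominus>\<^bsub>K\<^esub> \<one>\<^bsub>K\<^esub>) \<odot>\<^bsub>A\<^esub> x \<in> D" using x R.smult_closed[of "\<ominus>\<^bsub>K\<^esub> \<one>\<^bsub>K\<^esub>" x] by simp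
      moreover have "(\<ominus>\<^bsub>K\<^esub> \<one>\<^bsub>K\<^esub>) \<odot>\<^bsub>S\<^esub> (iA x \<otimes>\<^bsub>S\<^esub> g) \<in> Z" using SP.submoduleE(4)[OF Z] x by simp
      ultimately show "\<ominus>\<^bsub>R\<^esub> x \<in> {r \<in> D. iA r \<otimes>\<^bsub>S\<^esub> g \<in> Z}"
        using x gS by (simp add: SP.smult_mult_left)
    next
      fix x y assume xy: "x \<in> {r \<in> D. iA r \<otimes>\<^bsub>S\<^esub> g \<in> Z}" "y \<in> {r \<in> D. iA r \<otimes>\<^bsub>S\<^esub> g \<in> Z}"
      then have "iA x \<otimes>\<^bsub>S\<^esub> g \<oplus>\<^bsub>S\<^esub> iA y \<otimes>\<^bsub>S\<^esub> g \<in> Z" using SP.submoduleE(5)[OF Z] by simp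
      then show "x \<oplus>\<^bsub>R\<^esub> y \<in> {r \<in> D. iA r \<otimes>\<^bsub>S\<^esub> g \<in> Z}"
        using xy gS subringE(7)[OF D_subring] by (simp add: SP.A.l_distr)
    qed auto
    moreover have "b \<in> {r \<in> D. iA r \<otimes>\<^bsub>S\<^esub> g \<in> Z}" if "b \<in> B" for b
      using that B(2) g EZ by (auto simp: E2_def)
    moreover have "\<mu> \<in> {r \<in> D. iA r \<otimes>\<^bsub>S\<^esub> g \<in> Z}" if "\<mu> \<in> m" for \<mu>
      using that m(1) J(2) JD(5)[of "iA \<mu>" g] gS EZ by auto
    ultimately have "mspan K R (B \<union> m) \<subseteq> {r \<in> D. iA r \<otimes>\<^bsub>S\<^esub> g \<in> Z}"
      by (intro R.mspan_least) auto
    then show ?thesis using r B(3) by auto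
  qed
  have ZS: "Z \<subseteq> carrier S" by (rule SP.submoduleE(1)[OF Z])
  \<comment> \<open>\<open>Z\<close> is a \<open>K\<close>-subspace that need not be stable under
    left multiplication by \<open>D\<close>, since \<open>J\<close> is a right ideal. Its largest
    left \<open>D\<close>-submodule is used instead; once it contains \<open>G\<close>, it contains
    \<open>W\<close>.\<close>
  have "submodule {y \<in> carrier S. \<forall>r\<in>D. iA r \<otimes>\<^bsub>S\<^esub> y \<in> Z} R LS"
  proof (rule LS.submoduleI)
    fix a y assume a: "a \<in> carrier R" "y \<in> {y \<in> carrier S. \<forall>r\<in>D. iA r \<otimes>\<^bsub>S\<^esub> y \<in> Z}"
    have "iA r \<otimes>\<^bsub>S\<^esub> (iA a \<otimes>\<^bsub>S\<^esub> y) \<in> Z" if r: "r \<in> D" for r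
    proof -
      have "iA r \<otimes>\<^bsub>S\<^esub> (iA a \<otimes>\<^bsub>S\<^esub> y) = iA (r \<otimes>\<^bsub>A\<^esub> a) \<otimes>\<^bsub>S\<^esub> y"
        using a r by (simp add: SP.A.m_assoc)
      then show ?thesis using a subringE(6)[OF D_subring r, of a] by (simp del: iA_simps)
    qed
    then show "a \<odot>\<^bsub>LS\<^esub> y \<in> {y \<in> carrier S. \<forall>r\<in>D. iA r \<otimes>\<^bsub>S\<^esub> y \<in> Z}" using a by simp
  next
    fix y assume y: "y \<in> {y \<in> carrier S. \<forall>r\<in>D. iA r \<otimes>\<^bsub>S\<^esub> y \<in> Z}"
    have "\<ominus>\<^bsub>LS\<^esub> y = \<ominus>\<^bsub>S\<^esub> y" by (simp add: a_inv_def m_inv_def)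
    then show "\<ominus>\<^bsub>LS\<^esub> y \<in> {y \<in> carrier S. \<forall>r\<in>D. iA r \<otimes>\<^bsub>S\<^esub> y \<in> Z}"
      using y SP.submoduleE(3)[OF Z] by (simp add: SP.A.r_minus)
  qed (use SP.submodule_zero[OF Z] SP.submoduleE(5)[OF Z] in \<open>auto simp: SP.A.r_distr\<close>)
  moreover have "G \<union> {\<zero>\<^bsub>LS\<^esub>} \<subseteq> {y \<in> carrier S. \<forall>r\<in>D. iA r \<otimes>\<^bsub>S\<^esub> y \<in> Z}"
    using gen GF FS' SP.submodule_zero[OF Z] by auto
  ultimately have WZ: "W \<subseteq> {y \<in> carrier S. \<forall>r\<in>D. iA r \<otimes>\<^bsub>S\<^esub> y \<in> Z}"
    unfolding G(3) by (rule LS.mspan_least)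
  have "X \<otimes>\<^bsub>S\<^esub> iA d \<in> Z" if d: "d \<in> D" for d
  proof -
    have "X \<otimes>\<^bsub>S\<^esub> iA d \<in> W" using LS.mspan_superset[of XD] d unfolding W_def XD_def by blast
    then have "iA \<one>\<^bsub>A\<^esub> \<otimes>\<^bsub>S\<^esub> (X \<otimes>\<^bsub>S\<^esub> iA d) \<in> Z" using WZ subringE(3)[OF D_subring] by blast
    then show ?thesis using d X FS' by auto
  qed
  then have "finite_codim K R {d \<in> carrier R. X \<otimes>\<^bsub>S\<^esub> iA d \<in> J}"
    using X FS' R.smult_closed subringE(7)[OF D_subring]
    by (intro finite_codim_preimage[OF SP.K.field_axioms R.module_axioms SP.module_axioms _ JK E2])
      (auto simp: k_linear_def Z_def[symmetric] algebra_simps_SA)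
  then show ?thesis by simp
qed

end

text \<open>Commutativity of \<open>R\<close> makes the order reversal in the opposite ring
  harmless, so right multiplication gives an ordinary \<open>R\<close>-module.\<close>

lemma right_quotient_restrict_module:
  fixes A :: "('k, 'a) module" and R :: "('k, 'r) module"
  assumes A: "ring A" and J: "right_ideal J A" and R: "cring R" and i: "i \<in> ring_hom R A"
  shows "module R (with_smult (right_quotient A J) (\<lambda>r v. i r \<odot>\<^bsub>right_quotient A J\<^esub> v))"
proof -
  interpret R: cring R by fact
  interpret V: left_module "opposite A" "right_quotient A J" by (rule right_quotient_left_module[OF A J])
  have iA: "i r \<in> carrier A" if "r \<in> carrier R" for r using ring_hom_closed[OF i that] .
  show ?thesis
  proof (rule moduleI)
    show "abelian_group (with_smult (right_quotient A J) (\<lambda>r v. i r \<odot>\<^bsub>right_quotient A J\<^esub> v))"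
      by (rule with_smult_abelian_group[OF V.abelian_group_axioms])
    fix a b x assume a: "a \<in> carrier R" "b \<in> carrier R"
      and x: "x \<in> carrier (with_smult (right_quotient A J) (\<lambda>r v. i r \<odot>\<^bsub>right_quotient A J\<^esub> v))"
    have "i (a \<otimes>\<^bsub>R\<^esub> b) = i a \<otimes>\<^bsub>opposite A\<^esub> i b"
      using ring_hom_mult[OF i a(2,1)] R.m_comm[OF a] by simp
    then show "(a \<otimes>\<^bsub>R\<^esub> b) \<odot>\<^bsub>with_smult (right_quotient A J) (\<lambda>r v. i r \<odot>\<^bsub>right_quotient A J\<^esub> v)\<^esub> x =
      a \<odot>\<^bsub>with_smult (right_quotient A J) (\<lambda>r v. i r \<odot>\<^bsub>right_quotient A J\<^esub> v)\<^esub>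
      (b \<odot>\<^bsub>with_smult (right_quotient A J) (\<lambda>r v. i r \<odot>\<^bsub>right_quotient A J\<^esub> v)\<^esub> x)"
      using V.smult_assoc[of "i a" "i b" x] a x iA by simp
  qed (use R iA V.smult_closed V.smult_l_distr V.smult_r_distr V.smult_one in
      \<open>simp_all add: ring_hom_add[OF i] ring_hom_one[OF i]\<close>)
qed

lemma weight_space_with_smult:
  "weight_space R (\<lambda>r. r) (with_smult V (\<lambda>r v. i r \<odot>\<^bsub>V\<^esub> v)) n = weight_space R i V n"
  by (simp add: weight_space_def)

section \<open>The proper right ideal attached to a maximal ideal\<close>

context smash_subring
begin

text \<open>This is the largest right ideal inside the set of \<open>X \<in> F\<close> with
  \<open>hatX X 1 \<in> m\<close>: quantifying over \<open>Y\<close> makes closure under right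
  multiplication a matter of associativity. For \<open>\<mu> \<in> m\<close> the value at
  \<open>1\<close> of \<open>\<mu> Y\<close> is \<open>\<mu>\<close> times an element of
  \<open>D\<close>, and \<open>1\<close> is excluded because its value at \<open>1\<close> is
  \<open>1\<close>.\<close>

lemma hat_proper_right_ideal:
  assumes F: "subring F S" "iA ` D \<subseteq> F" and hatD: "\<And>X g. X \<in> F \<Longrightarrow> g \<in> D \<Longrightarrow> hatX X g \<in> D"
    and m: "ideal m R" "m \<noteq> D"
  shows "right_ideal {X \<in> F. \<forall>Y\<in>F. hatX (X \<otimes>\<^bsub>S\<^esub> Y) \<one>\<^bsub>A\<^esub> \<in> m} (S\<lparr>carrier := F\<rparr>)"
    and "iA ` m \<subseteq> {X \<in> F. \<forall>Y\<in>F. hatX (X \<otimes>\<^bsub>S\<^esub> Y) \<one>\<^bsub>A\<^esub> \<in> m}"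
    and "\<one>\<^bsub>S\<^esub> \<notin> {X \<in> F. \<forall>Y\<in>F. hatX (X \<otimes>\<^bsub>S\<^esub> Y) \<one>\<^bsub>A\<^esub> \<in> m}"
proof -
  interpret m: ideal m R by fact
  interpret FS: ring "S\<lparr>carrier := F\<rparr>" by (rule SP.A.subring_is_ring[OF F(1)])
  note FE = subringE[OF F(1)]
  have FS [simp]: "X \<in> F \<Longrightarrow> X \<in> carrier S" for X using FE(1) by blast
  have one: "\<one>\<^bsub>A\<^esub> \<in> D" by (rule subringE(3)[OF D_subring])
  have mD: "m \<subseteq> D" using m.a_subset by simp
  let ?I = "{X \<in> F. \<forall>Y\<in>F. hatX (X \<otimes>\<^bsub>S\<^esub> Y) \<one>\<^bsub>A\<^esub> \<in> m}"
  show "right_ideal ?I (S\<lparr>carrier := F\<rparr>)"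
  proof (rule FS.right_idealI)
    have "hatX \<zero>\<^bsub>S\<^esub> \<one>\<^bsub>A\<^esub> = \<zero>\<^bsub>A\<^esub>"
      using hat_smult[of "\<zero>\<^bsub>S\<^esub>" "\<zero>\<^bsub>K\<^esub>" "\<one>\<^bsub>A\<^esub>"] hat_closed[of "\<zero>\<^bsub>S\<^esub>" "\<one>\<^bsub>A\<^esub>"] by simp
    then show "\<zero>\<^bsub>S\<lparr>carrier := F\<rparr>\<^esub> \<in> ?I" using FE(2) m.zero_closed by simp
    show "x \<oplus>\<^bsub>S\<lparr>carrier := F\<rparr>\<^esub> y \<in> ?I" if xy: "x \<in> ?I" "y \<in> ?I" for x y
    proof -
      have "hatX ((x \<oplus>\<^bsub>S\<^esub> y) \<otimes>\<^bsub>S\<^esub> Y) \<one>\<^bsub>A\<^esub> \<in> m" if Y: "Y \<in> F" for Y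
      proof -
        have "hatX ((x \<oplus>\<^bsub>S\<^esub> y) \<otimes>\<^bsub>S\<^esub> Y) \<one>\<^bsub>A\<^esub> = hatX (x \<otimes>\<^bsub>S\<^esub> Y) \<one>\<^bsub>A\<^esub> \<oplus>\<^bsub>A\<^esub> hatX (y \<otimes>\<^bsub>S\<^esub> Y) \<one>\<^bsub>A\<^esub>"
          using xy Y by (simp add: SP.A.l_distr hat_add)
        then show ?thesis using m.a_closed[of "hatX (x \<otimes>\<^bsub>S\<^esub> Y) \<one>\<^bsub>A\<^esub>" "hatX (y \<otimes>\<^bsub>S\<^esub> Y) \<one>\<^bsub>A\<^esub>"] xy Y by simp
      qed
      then show ?thesis using xy FE(7) by simp
    qed
    show "x \<otimes>\<^bsub>S\<lparr>carrier := F\<rparr>\<^esub> a \<in> ?I" if "x \<in> ?I" "a \<in> carrier (S\<lparr>carrier := F\<rparr>)" for x a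
      using that FE(6) by (simp add: SP.A.m_assoc)
  qed auto
  have "hatX (iA \<mu> \<otimes>\<^bsub>S\<^esub> Y) \<one>\<^bsub>A\<^esub> \<in> m" if "\<mu> \<in> m" "Y \<in> F" for \<mu> Y
    using that mD hatD[OF that(2) one] m.I_r_closed[OF that(1), of "hatX Y \<one>\<^bsub>A\<^esub>"]
    by (simp add: hat_mult_left subset_iff)
  then show "iA ` m \<subseteq> ?I" using subset_trans[OF image_mono[OF mD] F(2)]
    by (simp add: image_subset_iff)
  have "\<one>\<^bsub>A\<^esub> \<notin> m" using m.one_imp_carrier m(2) by auto
  moreover have "hatX (\<one>\<^bsub>S\<^esub> \<otimes>\<^bsub>S\<^esub> \<one>\<^bsub>S\<^esub>) \<one>\<^bsub>A\<^esub> = \<one>\<^bsub>A\<^esub>" by (simp add: hat_one)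
  ultimately show "\<one>\<^bsub>S\<^esub> \<notin> ?I" using FE(3) by (metis (mono_tags, lifting) mem_Collect_eq)
qed

end

section \<open>Simple Harish-Chandra modules over the opposite of a Galois order\<close>

theorem theorem4p5:
  fixes K :: "'k ring"
    and Ht :: "('k, 'h) module" and \<Delta> :: "'h \<Rightarrow> ('h \<times> 'h \<Rightarrow> 'k) set"
    and \<epsilon> :: "'h \<Rightarrow> 'k" and antipode :: "'h \<Rightarrow> 'h" and H :: "'h set"
    and L :: "('k, 'l) module" and Lam :: "'l set" and act :: "'h \<Rightarrow> 'l \<Rightarrow> 'l"
    and S :: "('k, 's) module" and iL :: "'l \<Rightarrow> 's" and iH :: "'h \<Rightarrow> 's"
    and F :: "'s set" and m :: "'l set"
  assumes "hopf_galois_order_setting K Ht \<Delta> \<epsilon> antipode H L Lam act"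
    and "smash_product K S L Ht \<Delta> act iL iH"
    and "galois_order K Ht H L Lam act S iL iH F"
    and "maximalideal m (L\<lparr>carrier := Lam\<rparr>)"
  shows "(\<exists>J. maximal_right_ideal J (S\<lparr>carrier := F\<rparr>) \<and> iL ` m \<subseteq> J) \<and>
    (\<exists>M :: ('s, 's set) module. simple_module (opposite (S\<lparr>carrier := F\<rparr>)) M \<and>
       weight_space (L\<lparr>carrier := Lam\<rparr>) iL M m \<noteq> {\<zero>\<^bsub>M\<^esub>}) \<and>
    (finite_codim K (L\<lparr>carrier := Lam\<rparr>) m \<longrightarrow>
       Irr K (L\<lparr>carrier := Lam\<rparr>) iL (opposite (S\<lparr>carrier := F\<rparr>)) m \<noteq> {})"
proof -
  interpret HG: hopf_galois_order_setting K Ht \<Delta> \<epsilon> antipode H L Lam act by fact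
  interpret SP: smash_product K S L Ht \<Delta> act iL iH by fact
  let ?R = "L\<lparr>carrier := Lam\<rparr>" and ?F = "S\<lparr>carrier := F\<rparr>"
  interpret LA: module_algebra K L Ht \<Delta> \<epsilon> act by (rule HG.act_extends)
  interpret MLam: module_algebra K ?R Ht \<Delta> \<epsilon> act by (rule HG.lam_module_algebra)
  interpret Lf: field L using HG.lam_fractions by (simp add: is_fraction_field_def)
  interpret N: noetherian_domain ?R by (rule HG.lam_noetherian)
  interpret smash_subring K S L Ht \<Delta> \<epsilon> act iL iH Lam
  proof (intro smash_subring.intro smash_action.intro smash_action_axioms.intro smash_subring_axioms.intro)
    fix x assume x: "x \<in> carrier Ht"
    then show "\<Delta> x \<in> carrier (tensor_space K Ht Ht)"
      using HG.comult_hom by (auto simp: k_alg_hom_def k_linear_def tensor_simps)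
    show "act x a \<in> Lam" if "a \<in> Lam" for a
      using MLam.act_linear[OF x] that by (auto simp: k_linear_def)
  next
    show "subring Lam L" using HG.lam_subalgebra by (simp add: k_subalgebra_def)
  qed (use SP.smash_product_axioms HG.act_extends HG.k_algebra_axioms MLam.k_algebra_axioms N.is_cring
        Lf.m_comm in simp_all)
  have F: "subring F S" "submodule F K S" and LF: "iL ` Lam \<subseteq> F"
    and hatF: "\<And>X g. X \<in> F \<Longrightarrow> g \<in> Lam \<Longrightarrow> hat K S L Ht act iL iH X g \<in> Lam"
    using assms(3) by (simp_all add: galois_order_def k_subalgebra_def)
  interpret FR: ring ?F by (rule SP.A.subring_is_ring[OF F(1)])
  interpret m: maximalideal m ?R by fact
  have mLam: "m \<subseteq> Lam" using m.a_subset by simp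
  have "m \<noteq> Lam" using m.I_notcarr by auto
  note I = hat_proper_right_ideal[OF F(1) LF hatF m.is_ideal this]
  obtain J where J: "maximal_right_ideal J ?F" and mJ: "iL ` m \<subseteq> J"
    using FR.maximal_right_ideal_exists[OF I(1)] I(2,3) by auto
  have Jr: "right_ideal J ?F" and JF: "J \<noteq> F" using J by (simp_all add: maximal_right_ideal_def)
  note JD = right_idealD[OF FR.ring_axioms Jr]
  let ?M = "right_quotient ?F J"
  note Q = FR.right_quotient_simps[OF Jr]
  have simple: "simple_module (opposite ?F) ?M" by (rule right_quotient_simple[OF FR.ring_axioms J])
  have iLF: "iL r \<in> F" if "r \<in> Lam" for r using LF that by blast
  have oneF: "\<one>\<^bsub>S\<^esub> \<in> F" by (rule subringE(3)[OF F(1)])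
  let ?v = "J +>\<^bsub>?F\<^esub> \<one>\<^bsub>S\<^esub>"
  have one: "\<one>\<^bsub>S\<^esub> \<notin> J"
  proof
    assume "\<one>\<^bsub>S\<^esub> \<in> J"
    then have "a \<in> J" if "a \<in> F" for a
      using JD(5)[of "\<one>\<^bsub>S\<^esub>" a] that subringE(1)[OF F(1)] by auto
    then show False using JF JD(1) by auto
  qed
  \<comment> \<open>The zeroth power of \<open>m\<close> is all of \<open>\<Lambda>\<close>, so the
    class of \<open>1\<close> is killed only from exponent 1 on.\<close>
  have "iL r \<odot>\<^bsub>?M\<^esub> ?v = \<zero>\<^bsub>?M\<^esub>" if "r \<in> ideal_pow ?R m N" "1 \<le> N" for r N
  proof -
    obtain N' where "N = Suc N'" using \<open>1 \<le> N\<close> by (cases N) auto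
    then have r: "r \<in> m" using N.ideal_pow_Suc_subset[OF m.is_ideal] that(1) by blast
    then have "iL r \<odot>\<^bsub>?M\<^esub> ?v = J +>\<^bsub>?F\<^esub> iL r"
      using Q(4)[of "iL r" "\<one>\<^bsub>S\<^esub>"] iLF mLam oneF by auto
    moreover have "iL r \<in> F" "iL r \<in> J" using iLF mLam mJ r by auto
    ultimately show ?thesis using Q(2) Q(5)[of "iL r"] by simp
  qed
  moreover have "?v \<in> carrier ?M" unfolding Q(1) using oneF by auto
  ultimately have v: "?v \<in> weight_space ?R iL ?M m" unfolding weight_space_def by blast
  have "?v \<noteq> \<zero>\<^bsub>?M\<^esub>" unfolding Q(2) using Q(5)[of "\<one>\<^bsub>S\<^esub>"] oneF one by simp
  with v have weight: "weight_space ?R iL ?M m \<noteq> {\<zero>\<^bsub>?M\<^esub>}" by blast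
  have "harish_chandra_module K ?R iL (opposite ?F) ?M" if fc: "finite_codim K ?R m"
  proof -
    \<comment> \<open>The weight decomposition concerns modules over the commutative ring
      \<open>\<Lambda>\<close>, so the quotient is first restricted along \<open>iL\<close>.\<close>
    let ?M' = "with_smult ?M (\<lambda>r v. iL r \<odot>\<^bsub>?M\<^esub> v)"
    have hom: "iL \<in> ring_hom ?R ?F" using iLF by (intro ring_hom_memI) simp_all
    have mod: "module ?R ?M'"
      by (rule right_quotient_restrict_module[OF FR.ring_axioms Jr N.is_cring hom])
    have "finite_codim K ?R {r \<in> carrier ?R. r \<odot>\<^bsub>?M'\<^esub> u = \<zero>\<^bsub>?M'\<^esub>}" if u: "u \<in> carrier ?M'" for u
    proof -
      obtain X where X: "X \<in> F" "u = J +>\<^bsub>?F\<^esub> X" using u Q(1) by auto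
      have "r \<odot>\<^bsub>?M'\<^esub> u = \<zero>\<^bsub>?M'\<^esub> \<longleftrightarrow> X \<otimes>\<^bsub>S\<^esub> iL r \<in> J" if r: "r \<in> Lam" for r
        using Q(2) Q(4)[of "iL r" X] Q(5)[of "X \<otimes>\<^bsub>S\<^esub> iL r"] subringE(6)[OF F(1) X(1) iLF[OF r]] X iLF[OF r]
        by simp
      then have "{r \<in> carrier ?R. r \<odot>\<^bsub>?M'\<^esub> u = \<zero>\<^bsub>?M'\<^esub>} = {r \<in> Lam. X \<otimes>\<^bsub>S\<^esub> iL r \<in> J}" by auto
      then show ?thesis
        using annihilator_finite_codim[OF N.noetherian_ring_axioms F LF Jr mJ mLam fc X(1)] by simp
    qed
    then have "internal_direct_sum ?M' (cofinite_maximal_ideals K ?R) (weight_space ?R (\<lambda>r. r) ?M')"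
      by (rule finite_dimensional_weight_decomposition[OF D_alg mod N.noetherian_ring_axioms])
    \<comment> \<open>Restriction keeps the additive structure, hence the finite sums, and defines
      scalar multiplication through \<open>iL\<close>, hence the weight spaces agree as
      well.\<close>
    then have "internal_direct_sum ?M (cofinite_maximal_ideals K ?R) (weight_space ?R iL ?M)"
      unfolding internal_direct_sum_def weight_space_with_smult with_smult_finsum with_smult_simps .
    then show ?thesis
      using simple by (simp add: harish_chandra_module_def simple_module_def)
  qed
  then have "Irr K ?R iL (opposite ?F) m \<noteq> {}" if "finite_codim K ?R m"
    using that simple weight unfolding Irr_def Let_def by (auto simp: quotient_def)
  then show ?thesis using J mJ simple weight by blast
qed

end
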